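(* Let $d,p,s\in\mathbb{N}$, $m\in\mathbb{N}_0$, $\Theta\subset\mathbb{R}^p$, $\theta_0\in\Theta$ and $k=2p+1$. Let the noise sequences, the mappings $G_t^{(i,r)}$, the random Fourier features $\varphi=(\varphi_1,\dots,\varphi_k)$ with drawn parameters $(\vartheta_1,\dots,\vartheta_k)$, and the time-average estimator $\hat\theta^{\mathrm{TA}}$ be as in the context. Suppose the following hold. (A1) For each $n\in\mathbb{N}$, the observed and simulated time series of length $n$ are $X_t^{\mathrm{obs}}=G_t^{(n,0)}(\boldsymbol{\varepsilon}_t^{(0)},\theta_0)$ and $X_t^{(r)}(\theta)=G_t^{(n,r)}(\boldsymbol{\varepsilon}_t^{(r)},\theta)$, $t=1,\dots,n$, for all $r=1,\dots,s$ and $\theta\in\Theta$. (A2) For each $t\in\mathbb{N}$ and $r=0,1,\dots,s$ there is a measurable mapping $G_t^{(r)}:\mathbb{R}^\infty\times\Theta\to\mathbb{R}^d$ such that $(G_t^{(r)}(\boldsymbol{\varepsilon}_j,\theta))_{j\in\mathbb{Z}}$ is a stationary ergodic process, and for some $q>2$, as $n\to\infty$, $$\sup_{\theta\in\Theta}\Big(\frac1n\sum_{t=1}^n\big\|G_t^{(n,r)}(\boldsymbol{\varepsilon}_0,\theta)-G_t^{(r)}(\boldsymbol{\varepsilon}_0,\theta)\big\|_{\mathcal{L}^q(\theta)}\Big)\to0 .$$ (A3) Let $P_{\theta,t}^{(r)}$ denote the distribution of $[G_{t-m}^{(r)}(\boldsymbol{\varepsilon}_{-m},\theta),\dots,G_t^{(r)}(\boldsymbol{\varepsilon}_0,\theta)]^\top$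 and $\bar P_{\theta,n}^{(r)}=\frac1{n-m}\sum_{t=m+1}^nP_{\theta,t}^{(r)}$. For all $\theta\in\Theta$ there is a probability distribution $P_\theta$ on $\mathbb{R}^{(m+1)\times d}$ such that, for every bounded continuous $\phi:\mathbb{R}^{(m+1)\times d}\to\mathbb{R}$, as $n\to\infty$, $$\sup_{\theta\in\Theta}\max_{0\le r\le s}\Big|\int\phi\,d\bar P_{\theta,n}^{(r)}-\int\phi\,dP_\theta\Big|\to0 .$$ (A4) (i) $\Theta$ is a compact semialgebraic subset of $\mathbb{R}^p$ with non-empty interior. (ii) The map $\theta\mapsto P_\theta$ is injective. (iii) Writing $\psi_\theta$ for the characteristic function of $P_\theta$, the map $(\theta,\omega)\mapsto\psi_\theta(\omega)$ admits a jointly real analytic extension to $O\times\mathbb{R}^{(m+1)\times d}$, where $O\subset\mathbb{R}^p$ is an open neighborhood of $\Theta$. (A5) The parameters $(\vartheta_1,\dots,\vartheta_k)$ that have been drawn yield a function $\Phi:\Theta\to\mathbb{R}^k$, $\Phi(\theta)=\int_{\mathbb{R}^{(m+1)\times d}}\varphi(x)\,dP_\theta(x)$, that is one-to-one. (A6) For all $\epsilon>0$ there exists $\eta_G=\eta_G(\epsilon)>0$ such that $$\sup_{i\in\mathbb{N}}\ \sup_{t\in\mathbb{N}}\ \max_{0\le r\le s}\ \mathbb{E}\Big(\sup_{\theta,\theta'\in\Theta,\ \|\theta-\theta'\|\le\epsilon}\big\|G_t^{(i,r)}(\boldsymbol{\varepsilon}_0,\theta)-G_t^{(i,r)}(\boldsymbol{\varepsilon}_0,\theta')\big\|\Big)<\eta_G,$$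 with $\eta_G\to0$ as $\epsilon\to0$, where $\mathbb{E}$ is expectation with respect to the law of the noise inputs. (A7) There exist $\Psi>0$ and $\beta>2$ such that, for some $q>2$ and for all $j\in\mathbb{N}_0$, $$\sup_{i\in\mathbb{N}}\sup_{\theta\in\Theta}\sup_{t\in\mathbb{N}}\max_{0\le r\le s}\big\|G_t^{(i,r)}(\boldsymbol{\varepsilon}_0,\theta)-G_t^{(i,r)}(\tilde{\boldsymbol{\varepsilon}}_{0,j},\theta)\big\|_{\mathcal{L}^q(\theta)}\le\Psi\,(j\vee1)^{-\beta},$$ $$\sup_{i\in\mathbb{N}}\sup_{\theta\in\Theta}\sup_{t\in\mathbb{N}}\max_{0\le r\le s}\big\|G_t^{(i,r)}(\boldsymbol{\varepsilon}_0,\theta)\big\|_{\mathcal{L}^q(\theta)}\le\Psi .$$ Then $\hat\theta^{\mathrm{TA}}\to\theta_0$ in probability as $n\to\infty$.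
   Context: Noise. $(\varepsilon_i)_{i\in\mathbb{Z}}$ is an iid sequence of (real) random variables; $(\varepsilon_i^{(r)})_{i\in\mathbb{Z}}$, $r=0,1,\dots,s$, and $(\varepsilon_i^* )_{i\in\mathbb{Z}}$ are iid copies of this sequence. Put $\boldsymbol{\varepsilon}_t=(\varepsilon_t,\varepsilon_{t-1},\dots)$, $\boldsymbol{\varepsilon}_t^{(r)}=(\varepsilon_t^{(r)},\varepsilon_{t-1}^{(r)},\dots)$, and, for $j\in\mathbb{N}_0$, $\tilde{\boldsymbol{\varepsilon}}_{t,j}=(\varepsilon_t,\dots,\varepsilon_{t-j+1},\varepsilon^*_{t-j},\varepsilon_{t-j-1},\dots)$ (the input $\varepsilon_{t-j}$ is replaced by an independent copy). $\mathbb{R}^\infty$ carries the $\sigma$-algebra generated by all finite projections. Mappings. For each $t\in\mathbb{N}$, $i\in\mathbb{N}$, $r=0,1,\dots,s$, $G_t^{(i,r)}:\mathbb{R}^\infty\times\Theta\to\mathbb{R}^d$ is measurable and $(G_t^{(i,r)}(\boldsymbol{\varepsilon}_j,\theta))_{j\in\mathbb{Z}}$ is a stationary ergodic process for each $\theta$. Norms. $\|\cdot\|$ is the Euclidean norm; for a random vector $X$ whose law depends on $\theta$, $\|X\|_{\mathcal{L}^q(\theta)}=(\mathbb{E}_\theta\|X\|^q)^{1/q}$, where $\mathbb{E}_\theta$ is expectation under that $\theta$-dependent law. $a\vee b=\max(a,b)$. Random Fourier features. For $x=(x_1,\dots,x_{m+1})^\top\in\mathbb{R}^{(m+1)\times d}$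 with $x_j\in\mathbb{R}^d$, $$\varphi_i(x)=\cos\Big(\sum_{j=1}^{m+1}\Omega_{i,j}\cdot x_j+\alpha_i\Big),\quad i=1,\dots,k,$$ where $\Omega_{i,j}\sim N(0,I_d)$ iid and $\alpha_i\sim U(-\pi,\pi)$ iid are drawn independently of each other and of the data (noise). Put $\vartheta_i=(\Omega_{i,1}^\top,\dots,\Omega_{i,m+1}^\top,\alpha_i)^\top$ and $\varphi=(\varphi_1,\dots,\varphi_k):\mathbb{R}^{(m+1)\times d}\to\mathbb{R}^k$. The drawn parameters are regarded as fixed; they do not change with $n$, and probabilities and expectations are with respect to the noise inputs. Estimator. For $t_1\le t_2$ write $X_{t_1:t_2}=(X_{t_1},\dots,X_{t_2})^\top$. For $t=m+1,\dots,n$ let $f_t^{\mathrm{obs}}=\varphi(X^{\mathrm{obs}}_{t-m:t})$, $f_t^{(r)}(\theta)=\varphi(X^{(r)}_{t-m:t}(\theta))$, $\bar f_t^{\mathrm{sim}}(\theta)=\frac1s\sum_{r=1}^sf_t^{(r)}(\theta)$; let $F^{\mathrm{obs}}=\frac1{n-m}\sum_{t=m+1}^nf_t^{\mathrm{obs}}$, $\bar F^{\mathrm{sim}}(\theta)=\frac1{n-m}\sum_{t=m+1}^n\bar f_t^{\mathrm{sim}}(\theta)$, and $\hat Q_n^{\mathrm{TA}}(\theta)=F^{\mathrm{obs}}-\bar F^{\mathrm{sim}}(\theta)$. The time-average estimator $\hat\theta^{\mathrm{TA}}$ (depending on $n$) is any $\Theta$-valued random variable satisfying $\|\hat Q_n^{\mathrm{TA}}(\hat\theta^{\mathrm{TA}})\|\le\inf_{\theta\in\Theta}\|\hat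 Q_n^{\mathrm{TA}}(\theta)\|+o_p(1)$. Semialgebraic set. A subset of $\mathbb{R}^p$ of the form $\bigcup_{i=1}^a\bigcap_{j=1}^{b_i}\{x\in\mathbb{R}^p: f_{i,j}(x)*_{i,j}0\}$ with $a,b_i\in\mathbb{N}$, $f_{i,j}$ real polynomials in $x_1,\dots,x_p$ and each $*_{i,j}$ either $<$ or $=$. A complex-valued function is real analytic if its real and imaginary parts are. *)

theory Defs
  imports "HOL-Probability.Probability"
begin

section \<open>Convergence in probability, norms and expectations\<close>

text \<open>Meant for measurable \<open>X n\<close> (measurability is always required separately).\<close>

definition tendsto_in_prob :: "'w measure \<Rightarrow> (nat \<Rightarrow> 'w \<Rightarrow> 'a::metric_space) \<Rightarrow> 'a \<Rightarrow> bool" where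
  "tendsto_in_prob M X c \<longleftrightarrow>
     (\<forall>e>0. (\<lambda>n. measure M {w \<in> space M. dist (X n w) c > e}) \<longlonglongrightarrow> 0)"

text \<open>Values in \<^typ>\<open>ennreal\<close>, so that a vector without \<open>q\<close>-th moment has norm \<open>\<infinity>\<close> (and not the
  default value 0 of a non-existing Bochner integral).\<close>

definition Lq_norm :: "'w measure \<Rightarrow> real \<Rightarrow> ('w \<Rightarrow> 'a::real_normed_vector) \<Rightarrow> ennreal" where
  "Lq_norm M q X =
     (let I = \<integral>\<^sup>+w. ennreal (norm (X w) powr q) \<partial>M
      in if I = \<infinity> then \<infinity> else ennreal (enn2real I powr (1 / q)))"

text \<open>Expectation of a nonnegative function as the infimum over measurable majorants. It agrees with
  \<open>\<integral>\<^sup>+\<close> whenever \<open>f\<close> is measurable with respect to the completion of \<open>M\<close>; it is needed because a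
  supremum over an uncountable parameter set need not be Borel measurable, and \<open>\<integral>\<^sup>+\<close> would
  silently be a lower integral then.\<close>

definition upper_expectation :: "'a measure \<Rightarrow> ('a \<Rightarrow> ennreal) \<Rightarrow> ennreal" where
  "upper_expectation M f =
     (INF g\<in>{g \<in> borel_measurable M. \<forall>x\<in>space M. f x \<le> g x}. \<integral>\<^sup>+x. g x \<partial>M)"

section \<open>Noise and stationary ergodic processes\<close>

abbreviation R_inf :: "(nat \<Rightarrow> real) measure" where
  "R_inf \<equiv> PiM UNIV (\<lambda>_. borel)"

text \<open>\<open>Base\<close>, \<open>Copy r\<close> and \<open>Star\<close> stand for the sequences written \<open>\<epsilon>\<close>, \<open>\<epsilon>\<close> with superscript
  \<open>(r)\<close>, and \<open>\<epsilon>\<close> with superscript \<open>*\<close>.\<close>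

datatype noise_source = Base | Copy nat | Star

definition noise_sources :: "nat \<Rightarrow> noise_source set" where
  "noise_sources s = {Base, Star} \<union> Copy ` {0..s}"

definition iid_noise :: "'w measure \<Rightarrow> nat \<Rightarrow> (noise_source \<Rightarrow> int \<Rightarrow> 'w \<Rightarrow> real) \<Rightarrow> bool" where
  "iid_noise M s \<epsilon> \<longleftrightarrow>
     prob_space M \<and>
     prob_space.indep_vars M (\<lambda>_. borel) (\<lambda>(c, i). \<epsilon> c i) (noise_sources s \<times> UNIV) \<and>
     (\<forall>c\<in>noise_sources s. \<forall>i. distr M borel (\<epsilon> c i) = distr M borel (\<epsilon> Base 0))"

definition past :: "(int \<Rightarrow> 'w \<Rightarrow> real) \<Rightarrow> int \<Rightarrow> 'w \<Rightarrow> nat \<Rightarrow> real" where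
  "past e t w = (\<lambda>l. e (t - int l) w)"

definition past_replaced ::
  "(int \<Rightarrow> 'w \<Rightarrow> real) \<Rightarrow> (int \<Rightarrow> 'w \<Rightarrow> real) \<Rightarrow> int \<Rightarrow> nat \<Rightarrow> 'w \<Rightarrow> nat \<Rightarrow> real" where
  "past_replaced e e' t j w = (\<lambda>l. if l = j then e' (t - int l) w else e (t - int l) w)"

definition stationary_ergodic :: "'w measure \<Rightarrow> (int \<Rightarrow> 'w \<Rightarrow> 'b::topological_space) \<Rightarrow> bool" where
  "stationary_ergodic M Y \<longleftrightarrow>
     (\<forall>j. Y j \<in> borel_measurable M) \<and>
     (\<forall>h. distr M (PiM UNIV (\<lambda>_. borel)) (\<lambda>w j. Y (j + h) w)
         = distr M (PiM UNIV (\<lambda>_. borel)) (\<lambda>w j. Y j w)) \<and>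
     (\<forall>A\<in>sets (PiM UNIV (\<lambda>_. borel)). (\<lambda>y j. y (j + 1)) -` A = A \<longrightarrow>
         measure (distr M (PiM UNIV (\<lambda>_. borel)) (\<lambda>w j. Y j w)) A \<in> {0, 1})"

section \<open>Semialgebraic sets and real analytic functions\<close>

definition semialgebraic :: "'a::euclidean_space set \<Rightarrow> bool" where
  "semialgebraic S \<longleftrightarrow>
     (\<exists>(a::nat) (b::nat \<Rightarrow> nat) (f::nat \<Rightarrow> nat \<Rightarrow> 'a \<Rightarrow> real) (strict::nat \<Rightarrow> nat \<Rightarrow> bool).
        a \<ge> 1 \<and> (\<forall>i\<in>{1..a}. b i \<ge> 1) \<and>
        (\<forall>i\<in>{1..a}. \<forall>j\<in>{1..b i}. real_polynomial_function (f i j)) \<and>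
        S = (\<Union>i\<in>{1..a}. \<Inter>j\<in>{1..b i}. {x. if strict i j then f i j x < 0 else f i j x = 0}))"

text \<open>Local expansion into a multivariate power series, for open \<open>S\<close>; the multi-indices are the
  extensional functions from \<^term>\<open>Basis\<close> to the natural numbers, and the sums are unconditional.\<close>

definition real_analytic_on :: "('a::euclidean_space \<Rightarrow> real) \<Rightarrow> 'a set \<Rightarrow> bool" where
  "real_analytic_on f S \<longleftrightarrow>
     (\<forall>x\<in>S. \<exists>e>0. \<exists>c :: ('a \<Rightarrow> nat) \<Rightarrow> real. \<forall>y\<in>ball x e.
        ((\<lambda>a. c a * (\<Prod>b\<in>Basis. ((y - x) \<bullet> b) ^ a b)) has_sum f y) (Basis \<rightarrow>\<^sub>E UNIV))"

definition complex_real_analytic_on :: "('a::euclidean_space \<Rightarrow> complex) \<Rightarrow> 'a set \<Rightarrow> bool" where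
  "complex_real_analytic_on f S \<longleftrightarrow>
     real_analytic_on (\<lambda>x. Re (f x)) S \<and> real_analytic_on (\<lambda>x. Im (f x)) S"

definition char_fun :: "'a::euclidean_space measure \<Rightarrow> 'a \<Rightarrow> complex" where
  "char_fun P \<omega> = (CLINT x|P. iexp (\<omega> \<bullet> x))"

section \<open>Windows, time averages and random Fourier features\<close>

text \<open>\<open>\<real>\<close> to the power \<open>(m+1) \<times> d\<close> is rendered as \<^typ>\<open>real^'d^'m\<close>, whose row index type
  is a finite linear order with \<open>m + 1\<close> elements. The first row has lag \<open>m\<close>, the last one lag \<open>0\<close>.\<close>

definition lag :: "'m::{finite,linorder} \<Rightarrow> nat" where
  "lag j = card {i. j < i}"

text \<open>Used for \<open>t > m\<close> only, where the natural number \<open>t - lag j\<close> is not truncated.\<close>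

definition window :: "(nat \<Rightarrow> real^'d) \<Rightarrow> nat \<Rightarrow> real^'d^'m::{finite,linorder}" where
  "window X t = (\<chi> j. X (t - lag j))"

definition window_law ::
  "'w measure \<Rightarrow> (int \<Rightarrow> 'w \<Rightarrow> real) \<Rightarrow> (nat \<Rightarrow> nat \<Rightarrow> (nat \<Rightarrow> real) \<Rightarrow> real^'p \<Rightarrow> real^'d)
     \<Rightarrow> nat \<Rightarrow> real^'p \<Rightarrow> nat \<Rightarrow> (real^'d^'m::{finite,linorder}) measure" where
  "window_law M e H r \<theta> t =
     distr M borel (\<lambda>w. \<chi> j. H (t - lag j) r (past e (- int (lag j)) w) \<theta>)"

definition average_law :: "nat \<Rightarrow> nat \<Rightarrow> (nat \<Rightarrow> 'a::topological_space measure) \<Rightarrow> 'a measure" where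
  "average_law m n P =
     measure_of UNIV (sets borel) (\<lambda>A. (\<Sum>t\<in>{m+1..n}. emeasure (P t) A) / of_nat (n - m))"

lemma sets_average_law: "sets (average_law m n P) = sets borel"
  unfolding average_law_def by (metis sets.sigma_sets_eq sets_measure_of space_borel subset_UNIV
    Pow_UNIV)

lemma emeasure_average_law:
  assumes "\<And>t. t \<in> {m+1..n} \<Longrightarrow> sets (P t) = sets borel" and A: "A \<in> sets borel"
  shows "emeasure (average_law m n P) A
       = (\<Sum>t\<in>{m+1..n}. emeasure (P t) A) / of_nat (n - m)"
proof (rule emeasure_measure_of[OF average_law_def])
  show "countably_additive (sets (average_law m n P))
     (\<lambda>A. (\<Sum>t\<in>{m+1..n}. emeasure (P t) A) / of_nat (n - m))"
    unfolding sets_average_law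
  proof (rule countably_additiveI)
    fix B :: "nat \<Rightarrow> 'a set"
    assume B: "range B \<subseteq> sets borel" "disjoint_family B" "(\<Union>i. B i) \<in> sets borel"
    have "(\<Sum>t\<in>{m+1..n}. emeasure (P t) (\<Union>i. B i))
        = (\<Sum>t\<in>{m+1..n}. \<Sum>i. emeasure (P t) (B i))"
      using assms(1) B by (intro sum.cong refl suminf_emeasure[symmetric]) auto
    also have "\<dots> = (\<Sum>i. \<Sum>t\<in>{m+1..n}. emeasure (P t) (B i))"
      by (intro suminf_sum[symmetric]) auto
    finally show "(\<Sum>i. (\<Sum>t\<in>{m+1..n}. emeasure (P t) (B i)) / of_nat (n - m)) =
        (\<Sum>t\<in>{m+1..n}. emeasure (P t) (\<Union>i. B i)) / of_nat (n - m)"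
      by (simp add: divide_ennreal_def)
  qed
next
  show "A \<in> sets (average_law m n P)"
    using A by (simp add: sets_average_law)
next
  show "positive (sets (average_law m n P)) (\<lambda>A. (\<Sum>t\<in>{m+1..n}. emeasure (P t) A) / of_nat (n - m))"
    by (simp add: positive_def)
qed auto

definition time_avg :: "nat \<Rightarrow> nat \<Rightarrow> (nat \<Rightarrow> 'a::real_vector) \<Rightarrow> 'a" where
  "time_avg m n f = (1 / real (n - m)) *\<^sub>R (\<Sum>t\<in>{m+1..n}. f t)"

definition rff :: "real^'d^'m^'k \<Rightarrow> real^'k \<Rightarrow> real^'d^'m \<Rightarrow> real^'k" where
  "rff Om al x = (\<chi> i. cos ((\<Sum>j\<in>UNIV. Om $ i $ j \<bullet> x $ j) + al $ i))"

text \<open>The random parameters live on a probability space of their own, separate from that of the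
  noise; this expresses their independence of the data. The vectors \<open>Om i j\<close> and the numbers
  \<open>al i\<close> have different types, so their mutual independence is that of the generated
  \<open>\<sigma>\<close>-algebras.\<close>

definition rff_draw :: "'x measure \<Rightarrow> ('x \<Rightarrow> real^'d^'m^'k) \<Rightarrow> ('x \<Rightarrow> real^'k) \<Rightarrow> bool" where
  "rff_draw N Om al \<longleftrightarrow>
     prob_space N \<and>
     (\<forall>i j. distributed N lborel (\<lambda>u. Om u $ i $ j)
        (\<lambda>x. ennreal (\<Prod>c\<in>UNIV. std_normal_density (x $ c)))) \<and>
     (\<forall>i. distributed N lborel (\<lambda>u. al u $ i)
        (\<lambda>x. indicator {- pi<..<pi} x / measure lborel {- pi<..<pi})) \<and>
     prob_space.indep_sets N (\<lambda>\<iota>. case \<iota> of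
        Inl (i, j) \<Rightarrow> {(\<lambda>u. Om u $ i $ j) -` A \<inter> space N | A. A \<in> sets borel}
      | Inr i \<Rightarrow> {(\<lambda>u. al u $ i) -` A \<inter> space N | A. A \<in> sets borel}) UNIV"

section \<open>The time-average estimator\<close>

definition Q_TA ::
  "(real^'d^'m::{finite,linorder} \<Rightarrow> real^'k) \<Rightarrow> nat \<Rightarrow> nat \<Rightarrow> nat
     \<Rightarrow> (nat \<Rightarrow> real^'d) \<Rightarrow> (nat \<Rightarrow> nat \<Rightarrow> real^'d) \<Rightarrow> real^'k" where
  "Q_TA \<phi> m s n xobs xsim =
     time_avg m n (\<lambda>t. \<phi> (window xobs t))
     - time_avg m n (\<lambda>t. (1 / real s) *\<^sub>R (\<Sum>r\<in>{1..s}. \<phi> (window (xsim r) t)))"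

text \<open>\<open>Q n w \<theta>\<close> is the criterion vector for sample size \<open>n\<close>, and the \<open>o\<close>-in-probability term is a
  sequence \<open>R\<close> of random variables tending to 0 in probability. The criterion is defined for
  \<open>n > m\<close> only.\<close>

definition approx_minimizer ::
  "'w measure \<Rightarrow> nat \<Rightarrow> 'b::real_normed_vector set \<Rightarrow> (nat \<Rightarrow> 'w \<Rightarrow> 'b \<Rightarrow> 'c::real_normed_vector)
     \<Rightarrow> (nat \<Rightarrow> 'w \<Rightarrow> 'b) \<Rightarrow> bool" where
  "approx_minimizer M m \<Theta> Q est \<longleftrightarrow>
     (\<forall>n>m. est n \<in> borel_measurable M \<and> (\<forall>w\<in>space M. est n w \<in> \<Theta>)) \<and>
     (\<exists>R :: nat \<Rightarrow> 'w \<Rightarrow> real. (\<forall>n. R n \<in> borel_measurable M) \<and> tendsto_in_prob M R 0 \<and>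
        (\<forall>n>m. \<forall>w\<in>space M.
           norm (Q n w (est n w)) \<le> (INF \<theta>\<in>\<Theta>. norm (Q n w \<theta>)) + R n w))"

end

theory Submission
  imports Defs
begin

text \<open>The features are bounded and Lipschitz, so by (A7) replacing one noise input \<open>j\<close> steps back
  changes the expected feature by a summable amount. Telescoping over \<open>j\<close>, redrawing all inputs older
  than \<open>J\<close> changes it by a tail sum, and this also bounds the covariance of two features at distance
  \<open>J\<close>: the variance of the time average tends to 0. Its mean tends to \<open>\<Phi>(\<theta>)\<close> by (A2) and (A3). By (A6)
  the time averages are stochastically equicontinuous in \<open>\<theta>\<close>, so on the compact set \<open>\<Theta>\<close> the
  convergence is uniform and \<open>\<Phi>\<close> is continuous. Since \<open>\<Phi>\<close> is injective by (A5), \<open>\<theta>0\<close> is a well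
  separated zero of the limit criterion, and approximate minimizers converge to it.\<close>

section \<open>Redrawing coordinates of an iid sequence\<close>

text \<open>The maps change with both \<open>n\<close> and \<open>t\<close>, so the time averages
  belong to a triangular array of terms with different laws, and the weak law needs bounds that are
  uniform in \<open>n\<close> and \<open>t\<close>. They are obtained on the product space
  \<open>S\<close> of iid sequences: the pasts at two times are one sequence and its shift, so a
  covariance is an integral over \<open>S\<close>. Redrawing the far past is measured in L1 by two
  independent tails glued to the same first \<open>J\<close> coordinates. Telescoping only compares
  \<open>J\<close> with \<open>J + K\<close>; that the remainder vanishes as \<open>K\<close> grows
  is a separate fact, an L1 form of Levy's upward theorem proved from cylinder sets. Oscillations
  take values in \<open>ennreal\<close>, so that no integrability has to be carried along. Suprema
  over \<open>\<Theta>\<close> are never integrated: one measurable majorant, chosen before the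
  parameters, takes their place, and it controls the averages and the limit \<open>\<Phi>\<close>
  with the same radius.\<close>

context sequence_space
begin

text \<open>Two sequences share their first \<open>J\<close> coordinates and have independent tails.
  For integrable \<open>f\<close> the result agrees, up to a factor 2, with the L1 distance from
  \<open>f\<close> to its conditional expectation given those coordinates.\<close>

definition tail_osc :: "((nat \<Rightarrow> 'a) \<Rightarrow> real) \<Rightarrow> nat \<Rightarrow> ennreal" where
  "tail_osc f J = (\<integral>\<^sup>+x. \<integral>\<^sup>+y. \<integral>\<^sup>+z. ennreal \<bar>f (comb_seq J x y) - f (comb_seq J x z)\<bar> \<partial>S \<partial>S \<partial>S)"

text \<open>The L1 version of the dependence measure in (A7), where the input \<open>j\<close> steps
  back is replaced by a fresh one.\<close>

definition coord_osc :: "((nat \<Rightarrow> 'a) \<Rightarrow> real) \<Rightarrow> nat \<Rightarrow> ennreal" where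
  "coord_osc f j = (\<integral>\<^sup>+x. \<integral>\<^sup>+y. ennreal \<bar>f x - f (x(j := y))\<bar> \<partial>M \<partial>S)"

lemma nn_integral_comb_seq:
  assumes [measurable]: "f \<in> borel_measurable S"
  shows "(\<integral>\<^sup>+x. \<integral>\<^sup>+y. f (comb_seq i x y) \<partial>S \<partial>S) = (\<integral>\<^sup>+x. f x \<partial>S)"
proof -
  have "(\<integral>\<^sup>+x. f x \<partial>S) = (\<integral>\<^sup>+p. f ((\<lambda>(x, y). comb_seq i x y) p) \<partial>(S \<Otimes>\<^sub>M S))"
    by (subst PiM_comb_seq[symmetric, of i], subst nn_integral_distr) auto
  then show ?thesis
    by (subst (asm) P.nn_integral_fst[symmetric]) auto
qed

lemma nn_integral_case_nat:
  assumes [measurable]: "f \<in> borel_measurable S"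
  shows "(\<integral>\<^sup>+a. \<integral>\<^sup>+y. f (case_nat a y) \<partial>S \<partial>M) = (\<integral>\<^sup>+x. f x \<partial>S)"
proof -
  have "(\<integral>\<^sup>+x. f x \<partial>S) = (\<integral>\<^sup>+p. f ((\<lambda>(x, y). case_nat x y) p) \<partial>(M \<Otimes>\<^sub>M S))"
    by (subst PiM_iter[symmetric], subst nn_integral_distr) auto
  then show ?thesis
    by (subst (asm) P.nn_integral_fst[symmetric]) auto
qed

lemmas emeasure_space_eq_1 = P.emeasure_space_1 M.emeasure_space_1

lemma measurable_upd_seq [measurable (raw)]:
  assumes "f \<in> measurable N S" "g \<in> measurable N M"
  shows "(\<lambda>x. (f x)(j := g x)) \<in> measurable N S"
  using measurable_fun_upd[of UNIV UNIV j f N "\<lambda>_. M" g] assms by auto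

text \<open>\<open>comb_seq J x (case_nat a y)\<close> carries \<open>x\<close> before position
  \<open>J\<close>, \<open>a\<close> at \<open>J\<close> and \<open>y\<close> after it, so
  exchanging \<open>a\<close> alone redraws position \<open>J\<close>.\<close>

lemma comb_seq_upd: "(comb_seq J x (case_nat a y))(J := b) = comb_seq J x (case_nat b y)"
  by (auto simp: comb_seq_def fun_eq_iff split: nat.split)

lemma comb_seq_Suc_comb_seq:
  "comb_seq (Suc J) (comb_seq J x (case_nat b w)) y = comb_seq J x (case_nat b y)"
  by (auto simp: comb_seq_def fun_eq_iff split: nat.split intro!: arg_cong[of _ _ y])

text \<open>Redraw the coordinate \<open>J\<close> first and the coordinates beyond it afterwards.\<close>

lemma tail_osc_Suc:
  assumes [measurable]: "f \<in> borel_measurable S"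
  shows "tail_osc f J \<le> coord_osc f J + tail_osc f (Suc J)"
proof -
  interpret pair_sigma_finite M S ..
  let ?c = "\<lambda>x a y. f (comb_seq J x (case_nat a y))"
  \<comment> \<open>Both tails are split into their first entry and the rest: \<open>a\<close>,
    \<open>y\<close> on one side, \<open>b\<close>, \<open>z\<close> on the other.\<close>
  have "tail_osc f J = (\<integral>\<^sup>+x. \<integral>\<^sup>+a. \<integral>\<^sup>+y. \<integral>\<^sup>+b. \<integral>\<^sup>+z. ennreal \<bar>?c x a y - ?c x b z\<bar> \<partial>S \<partial>M \<partial>S \<partial>M \<partial>S)"
    unfolding tail_osc_def
  proof (rule nn_integral_cong)
    fix x assume [measurable]: "x \<in> space S"
    have "(\<integral>\<^sup>+z. ennreal \<bar>f (comb_seq J x y) - f (comb_seq J x z)\<bar> \<partial>S)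
        = (\<integral>\<^sup>+b. \<integral>\<^sup>+z. ennreal \<bar>f (comb_seq J x y) - ?c x b z\<bar> \<partial>S \<partial>M)" for y
      by (rule nn_integral_case_nat[symmetric]) measurable
    then have "(\<integral>\<^sup>+y. \<integral>\<^sup>+z. ennreal \<bar>f (comb_seq J x y) - f (comb_seq J x z)\<bar> \<partial>S \<partial>S)
       = (\<integral>\<^sup>+y. \<integral>\<^sup>+b. \<integral>\<^sup>+z. ennreal \<bar>f (comb_seq J x y) - ?c x b z\<bar> \<partial>S \<partial>M \<partial>S)"
      by simp
    also have "\<dots> = (\<integral>\<^sup>+a. \<integral>\<^sup>+y. \<integral>\<^sup>+b. \<integral>\<^sup>+z. ennreal \<bar>?c x a y - ?c x b z\<bar> \<partial>S \<partial>M \<partial>S \<partial>M)"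
      by (rule nn_integral_case_nat[symmetric]) measurable
    finally show "(\<integral>\<^sup>+y. \<integral>\<^sup>+z. ennreal \<bar>f (comb_seq J x y) - f (comb_seq J x z)\<bar> \<partial>S \<partial>S) = \<dots>" .
  qed
  \<comment> \<open>The intermediate point \<open>?c x b y\<close> differs from the first argument
    at position \<open>J\<close> only, and from the second beyond \<open>J\<close> only.\<close>
  also have "\<dots> \<le> (\<integral>\<^sup>+x. \<integral>\<^sup>+a. \<integral>\<^sup>+y. \<integral>\<^sup>+b. \<integral>\<^sup>+z. (ennreal \<bar>?c x a y - ?c x b y\<bar> + ennreal \<bar>?c x b y - ?c x b z\<bar>) \<partial>S \<partial>M \<partial>S \<partial>M \<partial>S)"
    by (intro nn_integral_mono) (auto simp flip: ennreal_plus)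
  also have "\<dots> = (\<integral>\<^sup>+x. \<integral>\<^sup>+a. \<integral>\<^sup>+y. \<integral>\<^sup>+b. ennreal \<bar>?c x a y - ?c x b y\<bar> \<partial>M \<partial>S \<partial>M \<partial>S)
       + (\<integral>\<^sup>+x. \<integral>\<^sup>+y. \<integral>\<^sup>+b. \<integral>\<^sup>+z. ennreal \<bar>?c x b y - ?c x b z\<bar> \<partial>S \<partial>M \<partial>S \<partial>S)"
    by (simp add: nn_integral_add emeasure_space_eq_1 cong: nn_integral_cong)
  also have "(\<integral>\<^sup>+x. \<integral>\<^sup>+a. \<integral>\<^sup>+y. \<integral>\<^sup>+b. ennreal \<bar>?c x a y - ?c x b y\<bar> \<partial>M \<partial>S \<partial>M \<partial>S) = coord_osc f J"
  proof -
    have "coord_osc f J = (\<integral>\<^sup>+x. \<integral>\<^sup>+w. \<integral>\<^sup>+b. ennreal \<bar>f (comb_seq J x w) - f ((comb_seq J x w)(J := b))\<bar> \<partial>M \<partial>S \<partial>S)"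
      unfolding coord_osc_def by (rule nn_integral_comb_seq[symmetric]) measurable
    also have "\<dots> = (\<integral>\<^sup>+x. \<integral>\<^sup>+a. \<integral>\<^sup>+y. \<integral>\<^sup>+b. ennreal \<bar>?c x a y - f ((comb_seq J x (case_nat a y))(J := b))\<bar> \<partial>M \<partial>S \<partial>M \<partial>S)"
      by (intro nn_integral_cong nn_integral_case_nat[symmetric]) measurable
    finally show ?thesis by (simp add: comb_seq_upd)
  qed
  also have "(\<integral>\<^sup>+x. \<integral>\<^sup>+y. \<integral>\<^sup>+b. \<integral>\<^sup>+z. ennreal \<bar>?c x b y - ?c x b z\<bar> \<partial>S \<partial>M \<partial>S \<partial>S) = tail_osc f (Suc J)"
  proof -
    let ?d = "\<lambda>v y. f (comb_seq (Suc J) v y)"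
    have "tail_osc f (Suc J) = (\<integral>\<^sup>+x. \<integral>\<^sup>+v. \<integral>\<^sup>+y. \<integral>\<^sup>+z. ennreal \<bar>?d (comb_seq J x v) y - ?d (comb_seq J x v) z\<bar> \<partial>S \<partial>S \<partial>S \<partial>S)"
      unfolding tail_osc_def by (rule nn_integral_comb_seq[symmetric]) measurable
    also have "\<dots> = (\<integral>\<^sup>+x. \<integral>\<^sup>+b. \<integral>\<^sup>+w. \<integral>\<^sup>+y. \<integral>\<^sup>+z. ennreal \<bar>?d (comb_seq J x (case_nat b w)) y - ?d (comb_seq J x (case_nat b w)) z\<bar> \<partial>S \<partial>S \<partial>S \<partial>M \<partial>S)"
      by (intro nn_integral_cong nn_integral_case_nat[symmetric]) measurable
    \<comment> \<open>The coordinates \<open>w\<close> are overwritten by \<open>y\<close> and by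
      \<open>z\<close>, so the integral over \<open>w\<close> contributes only the factor 1.\<close>
    also have "\<dots> = (\<integral>\<^sup>+x. \<integral>\<^sup>+b. \<integral>\<^sup>+y. \<integral>\<^sup>+z. ennreal \<bar>?c x b y - ?c x b z\<bar> \<partial>S \<partial>S \<partial>M \<partial>S)"
      by (simp add: comb_seq_Suc_comb_seq emeasure_space_eq_1)
    also have "\<dots> = (\<integral>\<^sup>+x. \<integral>\<^sup>+y. \<integral>\<^sup>+b. \<integral>\<^sup>+z. ennreal \<bar>?c x b y - ?c x b z\<bar> \<partial>S \<partial>M \<partial>S \<partial>S)"
      by (intro nn_integral_cong Fubini'[symmetric]) measurable
    finally show ?thesis by (simp add: emeasure_space_eq_1)
  qed
  finally show ?thesis .
qed

section \<open>Vanishing of the tail oscillation\<close>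

lemma tail_osc_le_approx:
  assumes [measurable]: "f \<in> borel_measurable S" "g \<in> borel_measurable S"
  shows "tail_osc f J \<le> tail_osc g J + 2 * (\<integral>\<^sup>+x. ennreal \<bar>f x - g x\<bar> \<partial>S)"
proof -
  let ?h = "\<lambda>x. ennreal \<bar>f x - g x\<bar>"
  have "tail_osc f J \<le> (\<integral>\<^sup>+x. \<integral>\<^sup>+y. \<integral>\<^sup>+z. (ennreal \<bar>g (comb_seq J x y) - g (comb_seq J x z)\<bar>
      + ?h (comb_seq J x y) + ?h (comb_seq J x z)) \<partial>S \<partial>S \<partial>S)"
    unfolding tail_osc_def by (intro nn_integral_mono) (auto simp flip: ennreal_plus)
  also have "\<dots> = tail_osc g J + (\<integral>\<^sup>+x. \<integral>\<^sup>+y. ?h (comb_seq J x y) \<partial>S \<partial>S) + (\<integral>\<^sup>+x. \<integral>\<^sup>+z. ?h (comb_seq J x z) \<partial>S \<partial>S)"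
    unfolding tail_osc_def by (simp add: nn_integral_add emeasure_space_eq_1 cong: nn_integral_cong)
  \<comment> \<open>Both spliced sequences have law \<open>S\<close>, so the error of approximation
    is paid once for each of them.\<close>
  also have "\<dots> = tail_osc g J + 2 * (\<integral>\<^sup>+x. ?h x \<partial>S)"
    by (subst (1 2) nn_integral_comb_seq) (auto simp: mult_2 add.assoc)
  finally show ?thesis .
qed

lemma tail_osc_add:
  assumes [measurable]: "f \<in> borel_measurable S" "g \<in> borel_measurable S"
  shows "tail_osc (\<lambda>x. f x + g x) J \<le> tail_osc f J + tail_osc g J"
proof -
  have "tail_osc (\<lambda>x. f x + g x) J \<le> (\<integral>\<^sup>+x. \<integral>\<^sup>+y. \<integral>\<^sup>+z. (ennreal \<bar>f (comb_seq J x y) - f (comb_seq J x z)\<bar>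
      + ennreal \<bar>g (comb_seq J x y) - g (comb_seq J x z)\<bar>) \<partial>S \<partial>S \<partial>S)"
    unfolding tail_osc_def by (intro nn_integral_mono) (auto simp flip: ennreal_plus)
  also have "\<dots> = tail_osc f J + tail_osc g J"
    unfolding tail_osc_def by (simp add: nn_integral_add emeasure_space_eq_1 cong: nn_integral_cong)
  finally show ?thesis .
qed

text \<open>Approximation in L1 costs at most twice the error, uniformly in \<open>J\<close>, so the
  limit over \<open>J\<close> survives it. This serves for countable disjoint unions and again for
  L1 limits of simple functions.\<close>

lemma tail_osc_tendsto_0_approx:
  assumes [measurable]: "f \<in> borel_measurable S"
    and approx: "\<And>e. e > 0 \<Longrightarrow> \<exists>g\<in>borel_measurable S.
      (\<integral>\<^sup>+x. ennreal \<bar>f x - g x\<bar> \<partial>S) \<le> ennreal e \<and> tail_osc g \<longlonglongrightarrow> 0"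
  shows "tail_osc f \<longlonglongrightarrow> 0"
proof (rule tendsto_zero_ennreal)
  fix r :: real assume "r > 0"
  then obtain g where [measurable]: "g \<in> borel_measurable S"
    and g: "(\<integral>\<^sup>+x. ennreal \<bar>f x - g x\<bar> \<partial>S) \<le> ennreal (r / 4)" "tail_osc g \<longlonglongrightarrow> 0"
    using approx[of "r / 4"] by auto
  have "\<forall>\<^sub>F J in sequentially. tail_osc g J < ennreal (r / 2)"
    using g(2) \<open>r > 0\<close> by (intro order_tendstoD(2)) auto
  then show "\<forall>\<^sub>F J in sequentially. tail_osc f J < ennreal r"
  proof eventually_elim
    case (elim J)
    have "tail_osc f J \<le> tail_osc g J + 2 * ennreal (r / 4)"
      by (intro order_trans[OF tail_osc_le_approx[of f g]] add_left_mono mult_left_mono g) auto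
    also have "2 * ennreal (r / 4) = ennreal (r / 2)"
      using \<open>r > 0\<close> by (simp add: ennreal_mult'[symmetric] flip: ennreal_numeral)
    also have "tail_osc g J + ennreal (r / 2) < ennreal (r / 2) + ennreal (r / 2)"
      using elim by (subst add.commute, intro ennreal_add_left_cancel_less[THEN iffD2]) auto
    also have "\<dots> = ennreal r"
      using \<open>r > 0\<close> by (simp flip: ennreal_plus)
    finally show ?case .
  qed
qed

text \<open>A set that constrains finitely many coordinates has oscillation 0 from some
  \<open>J\<close> on; induction over the intersection-stable generator carries the limit to all
  measurable sets.\<close>

lemma tail_osc_indicator_tendsto_0:
  assumes "A \<in> sets S"
  shows "tail_osc (indicator A) \<longlonglongrightarrow> 0"
proof -
  have "A \<in> sigma_sets (\<Pi>\<^sub>E i\<in>UNIV. space M) (prod_algebra UNIV (\<lambda>_. M))"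
    using assms by (simp add: sets_PiM)
  with Int_stable_prod_algebra prod_algebra_sets_into_space show ?thesis
  proof (induction rule: sigma_sets_induct_disjoint)
    case (basic A)
    then obtain J E where A: "A = prod_emb UNIV (\<lambda>_. M) J (\<Pi>\<^sub>E j\<in>J. E j)" "finite J"
      by (auto elim!: prod_algebraE)
    \<comment> \<open>\<open>K\<close> lies beyond every constrained coordinate; inserting 0 keeps
      \<open>Max\<close> meaningful for empty \<open>J\<close>.\<close>
    define K where "K = Suc (Max (insert 0 J))"
    have K: "i < K" if "i \<in> J" for i
      using that A(2) by (auto simp: K_def less_Suc_eq_le intro!: Max_ge)
    have "tail_osc (indicator A) k = 0" if "k \<ge> K" for k
    proof -
      have *: "comb_seq k x y \<in> A \<longleftrightarrow> comb_seq k x z \<in> A" if "x \<in> space S" "y \<in> space S" "z \<in> space S" for x y z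
        using that K \<open>k \<ge> K\<close> by (auto simp: A(1) prod_emb_iff comb_seq_def space_PiM PiE_iff extensional_def Pi_iff)
          (meson order_less_le_trans)+
      then have "\<bar>indicator A (comb_seq k x y) - indicator A (comb_seq k x z) :: real\<bar> = 0"
        if "x \<in> space S" "y \<in> space S" "z \<in> space S" for x y z
        using *[OF that] by (auto simp: indicator_def)
      then have "tail_osc (indicator A) k = (\<integral>\<^sup>+x. \<integral>\<^sup>+y. \<integral>\<^sup>+z. 0 \<partial>S \<partial>S \<partial>S)"
        unfolding tail_osc_def by (intro nn_integral_cong) (simp del: abs_eq_0)
      then show ?thesis by simp
    qed
    then have "\<forall>\<^sub>F k in sequentially. tail_osc (indicator A) k = 0"
      by (auto simp: eventually_sequentially)
    then show ?case by (simp add: tendsto_eventually)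
  next
    case empty
    then show ?case by (simp add: tail_osc_def)
  next
    case (compl A)
    have "tail_osc (indicator ((\<Pi>\<^sub>E i\<in>UNIV. space M) - A)) k = tail_osc (indicator A) k" for k
      unfolding tail_osc_def
    proof (intro nn_integral_cong)
      fix x y z assume "x \<in> space S" "y \<in> space S" "z \<in> space S"
      then have "comb_seq k x y \<in> (\<Pi>\<^sub>E i\<in>UNIV. space M)" "comb_seq k x z \<in> (\<Pi>\<^sub>E i\<in>UNIV. space M)"
        by (auto simp: space_PiM comb_seq_def PiE_iff)
      then show "ennreal \<bar>indicator ((\<Pi>\<^sub>E i\<in>UNIV. space M) - A) (comb_seq k x y) - indicator ((\<Pi>\<^sub>E i\<in>UNIV. space M) - A) (comb_seq k x z)\<bar>
        = ennreal \<bar>indicator A (comb_seq k x y) - indicator A (comb_seq k x z)\<bar>"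
        by (auto simp: indicator_def)
    qed
    with compl show ?case by simp
  next
    case (union A)
    then have A [measurable]: "A i \<in> sets S" for i
      by (auto simp: sets_PiM)
    \<comment> \<open>Finite subunions approximate the union in L1 by continuity of the measure, and
      by disjointness their indicators are sums of indicators.\<close>
    define B where "B N = (\<Union>i<N. A i)" for N :: nat
    have [measurable]: "B N \<in> sets S" for N
      unfolding B_def by auto
    have B: "tail_osc (indicator (B N)) \<longlonglongrightarrow> 0" for N
    proof (induction N)
      case 0
      then show ?case by (simp add: B_def tail_osc_def)
    next
      case (Suc N)
      have "B N \<inter> A N = {}"
        using union(1) by (auto simp: B_def disjoint_family_on_def) (metis IntI emptyE less_irrefl)
      then have eq: "indicator (B (Suc N)) = (\<lambda>x. indicator (B N) x + indicator (A N) x :: real)"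
        by (auto simp: B_def lessThan_Suc indicator_def fun_eq_iff)
      have lim: "(\<lambda>J. tail_osc (indicator (B N)) J + tail_osc (indicator (A N)) J) \<longlonglongrightarrow> 0"
        using tendsto_add[OF Suc.IH union(3)[of N]] by simp
      show ?case
        unfolding eq by (rule tendsto_sandwich[OF _ _ tendsto_const lim]) (auto intro!: always_eventually tail_osc_add)
    qed
    have "(\<lambda>N. measure S (B N)) \<longlonglongrightarrow> measure S (\<Union>N. B N)"
      by (intro P.finite_Lim_measure_incseq) (auto simp: incseq_def B_def intro: less_le_trans)
    moreover have "(\<Union>N. B N) = (\<Union>i. A i)"
      by (auto simp: B_def)
    ultimately have "(\<lambda>N. measure S (\<Union>i. A i) - measure S (B N)) \<longlonglongrightarrow> measure S (\<Union>i. A i) - measure S (\<Union>i. A i)"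
      by (intro tendsto_diff tendsto_const) simp
    then have lim: "(\<lambda>N. measure S (\<Union>i. A i) - measure S (B N)) \<longlonglongrightarrow> 0"
      by simp
    show ?case
    proof (rule tail_osc_tendsto_0_approx)
      fix e :: real assume "e > 0"
      obtain N where N: "measure S (\<Union>i. A i) - measure S (B N) < e"
        using order_tendstoD(2)[OF lim \<open>e > 0\<close>] by (auto simp: eventually_sequentially)
      have sub: "B N \<subseteq> (\<Union>i. A i)" by (auto simp: B_def)
      then have "(\<integral>\<^sup>+x. ennreal \<bar>indicator (\<Union>i. A i) x - indicator (B N) x\<bar> \<partial>S) = (\<integral>\<^sup>+x. indicator ((\<Union>i. A i) - B N) x \<partial>S)"
        by (intro nn_integral_cong) (auto simp: indicator_def)
      also have "\<dots> = ennreal (measure S ((\<Union>i. A i) - B N))"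
        by (simp add: P.emeasure_eq_measure)
      also have "\<dots> \<le> ennreal e"
        using N sub by (subst P.finite_measure_Diff) (auto intro!: ennreal_leI)
      finally show "\<exists>g\<in>borel_measurable S.
        (\<integral>\<^sup>+x. ennreal \<bar>indicator (\<Union>i. A i) x - g x\<bar> \<partial>S) \<le> ennreal e \<and> tail_osc g \<longlonglongrightarrow> 0"
        using B by (intro bexI[of _ "indicator (B N)"]) auto
    qed measurable
  qed
qed

text \<open>Finitely many applications of \<open>tail_osc_Suc\<close> leave a remainder that bounds
  on single coordinates alone do not control; this removes it.\<close>

lemma tail_osc_tendsto_0:
  assumes "integrable S f"
  shows "tail_osc f \<longlonglongrightarrow> 0"
  using assms
proof (induction rule: integrable_induct)
  case (base A c)
  then have [measurable]: "A \<in> sets S" by simp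
  have "tail_osc (\<lambda>x. indicator A x *\<^sub>R c) k = ennreal \<bar>c\<bar> * tail_osc (indicator A) k" for k
  proof -
    have *: "ennreal \<bar>u *\<^sub>R c - v *\<^sub>R c\<bar> = ennreal \<bar>c\<bar> * ennreal \<bar>u - v\<bar>" for u v :: real
      by (metis abs_ge_zero abs_mult ennreal_mult mult.commute real_scaleR_def scaleR_left_diff_distrib)
    have "tail_osc (\<lambda>x. indicator A x *\<^sub>R c) k = (\<integral>\<^sup>+x. \<integral>\<^sup>+y. \<integral>\<^sup>+z. ennreal \<bar>c\<bar> *
        ennreal \<bar>indicator A (comb_seq k x y) - indicator A (comb_seq k x z)\<bar> \<partial>S \<partial>S \<partial>S)"
      unfolding tail_osc_def
      by (simp only: *)
    then show ?thesis
      unfolding tail_osc_def by (simp add: nn_integral_cmult cong: nn_integral_cong)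
  qed
  then show ?case
    using ennreal_tendsto_cmult[OF _ tail_osc_indicator_tendsto_0[of A], of "ennreal \<bar>c\<bar>"] by simp
next
  case (add f g)
  have [measurable]: "f \<in> borel_measurable S" "g \<in> borel_measurable S"
    using add by auto
  have lim: "(\<lambda>J. tail_osc f J + tail_osc g J) \<longlonglongrightarrow> 0"
    using tendsto_add[OF add.IH] by simp
  show ?case
    by (rule tendsto_sandwich[OF _ _ tendsto_const lim]) (auto intro!: always_eventually tail_osc_add)
next
  case (lim f s)
  have [measurable]: "f \<in> borel_measurable S" "s i \<in> borel_measurable S" for i
    using lim by auto
  have "(\<lambda>i. \<integral>\<^sup>+x. norm (f x - s i x) \<partial>S) \<longlonglongrightarrow> 0"
  proof (rule nn_integral_dominated_convergence_norm[where w = "\<lambda>x. 2 * norm (f x)"])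
    show "(\<integral>\<^sup>+x. ennreal (2 * norm (f x)) \<partial>S) < \<infinity>"
      using integrable_mult_right[OF integrable_norm[OF lim(4)], of 2, THEN integrableD(2)]
      by (simp add: less_top)
  qed (use lim in auto)
  then show ?case
  proof (intro tail_osc_tendsto_0_approx)
    fix e :: real assume "e > 0"
    assume "(\<lambda>i. \<integral>\<^sup>+x. norm (f x - s i x) \<partial>S) \<longlonglongrightarrow> 0"
    then obtain i where "(\<integral>\<^sup>+x. norm (f x - s i x) \<partial>S) < ennreal e"
      using order_tendstoD(2)[of _ 0 sequentially "ennreal e"] \<open>e > 0\<close> by (auto simp: eventually_sequentially)
    then show "\<exists>g\<in>borel_measurable S. (\<integral>\<^sup>+x. ennreal \<bar>f x - g x\<bar> \<partial>S) \<le> ennreal e \<and> tail_osc g \<longlonglongrightarrow> 0"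
      using lim.IH by (intro bexI[of _ "s i"]) auto
  qed simp
qed

lemma tail_osc_le_suminf:
  assumes f: "integrable S f" and osc: "\<And>j. coord_osc f j \<le> ennreal (c j)"
    and c: "summable c" "\<And>j. c j \<ge> 0"
  shows "tail_osc f J \<le> ennreal (\<Sum>j. c (j + J))"
proof -
  have [measurable]: "f \<in> borel_measurable S" using f by simp
  have sm: "summable (\<lambda>j. c (j + J))"
    using c by (simp add: summable_iff_shift)
  have step: "tail_osc f J \<le> ennreal (\<Sum>j<K. c (j + J)) + tail_osc f (J + K)" for K
  proof (induction K)
    case (Suc K)
    have "tail_osc f (J + K) \<le> ennreal (c (J + K)) + tail_osc f (J + Suc K)"
      using order_trans[OF tail_osc_Suc add_right_mono[OF osc]] by simp
    then have "tail_osc f J \<le> ennreal (\<Sum>j<K. c (j + J)) + (ennreal (c (J + K)) + tail_osc f (J + Suc K))"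
      using Suc.IH by (meson add_left_mono order_trans)
    then show ?case
      by (simp add: ennreal_plus[symmetric] c sum_nonneg add.assoc[symmetric] add.commute[of J K] del: ennreal_plus)
  qed simp
  have "tail_osc f J \<le> ennreal (\<Sum>j. c (j + J)) + tail_osc f (K + J)" for K
    using step[of K] sum_le_suminf[OF sm, of "{..<K}"] c
    by (auto simp: add.commute elim!: order_trans intro!: add_left_mono ennreal_leI)
  \<comment> \<open>Only \<open>K\<close> tends to infinity; \<open>J\<close> stays fixed and
    determines the tail of the series.\<close>
  then have "tail_osc f J \<le> ennreal (\<Sum>j. c (j + J)) + 0"
    using LIMSEQ_ignore_initial_segment[OF tail_osc_tendsto_0[OF f], of J]
    by (intro tendsto_lowerbound[OF tendsto_add[OF tendsto_const]]) auto
  then show ?thesis by simp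
qed

section \<open>Covariances under the product measure\<close>

lemma integral_comb_seq:
  fixes f :: "(nat \<Rightarrow> 'a) \<Rightarrow> real"
  assumes [measurable]: "f \<in> borel_measurable S" and f: "\<And>x. \<bar>f x\<bar> \<le> B"
  shows "(\<integral>x. \<integral>y. f (comb_seq i x y) \<partial>S \<partial>S) = (\<integral>x. f x \<partial>S)"
proof -
  interpret SS: pair_prob_space S S ..
  have "(\<integral>x. f x \<partial>S) = (\<integral>p. f ((\<lambda>(x, y). comb_seq i x y) p) \<partial>(S \<Otimes>\<^sub>M S))"
    by (subst PiM_comb_seq[symmetric, of i], subst integral_distr) auto
  also have "\<dots> = (\<integral>x. \<integral>y. f (comb_seq i x y) \<partial>S \<partial>S)"
    by (subst SS.integral_fst'[symmetric]) (auto intro!: SS.P.integrable_const_bound[where B = B] f)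
  finally show ?thesis ..
qed

text \<open>Redrawing the coordinates of \<open>x\<close> from \<open>J\<close> on makes \<open>f x\<close> independent of the shifted sequence.\<close>

lemma covariance_le_tail_osc:
  fixes f g :: "(nat \<Rightarrow> 'a) \<Rightarrow> real"
  assumes [measurable]: "f \<in> borel_measurable S" "g \<in> borel_measurable S"
    and f: "\<And>x. \<bar>f x\<bar> \<le> B" and g: "\<And>x. \<bar>g x\<bar> \<le> 1"
  shows "ennreal \<bar>(\<integral>x. f x * g (\<lambda>l. x (l + J)) \<partial>S) - (\<integral>x. f x \<partial>S) * (\<integral>x. g x \<partial>S)\<bar> \<le> tail_osc f J"
proof -
  have B: "B \<ge> 0" using f[of undefined] by linarith
  have fg: "\<bar>f x * g y\<bar> \<le> B" for x y
    using mult_mono[OF f g B abs_ge_zero] by (simp add: abs_mult)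
  have [measurable]: "(\<lambda>x l. x (l + J)) \<in> measurable S S"
    by (rule measurable_PiM_single') (auto simp: space_PiM PiE_iff)
  note int = P.integrable_const_bound[where B = B, OF AE_I2]
  have intf: "integrable S (\<lambda>y. f (comb_seq J x y))" "integrable S (\<lambda>y. f (comb_seq J x y) * g y)"
    if [measurable]: "x \<in> space S" for x
    by (auto intro!: int f fg)
  have intg: "integrable S g"
    by (rule P.integrable_const_bound[where B = 1]) (auto intro!: g)
  \<comment> \<open>A non-integrable \<open>h\<close> has integral 0 by default, which
    \<open>B \<ge> 0\<close> covers.\<close>
  have bound: "\<bar>\<integral>y. h y \<partial>S\<bar> \<le> B" if h: "\<And>x. \<bar>h x\<bar> \<le> B" for h :: "(nat \<Rightarrow> 'a) \<Rightarrow> real"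
  proof (cases "integrable S h")
    case True
    have "\<bar>\<integral>y. h y \<partial>S\<bar> \<le> (\<integral>y. \<bar>h y\<bar> \<partial>S)" by (rule integral_abs_bound)
    also have "\<dots> \<le> B" using True h by (intro P.integral_le_const) auto
    finally show ?thesis .
  qed (use B in \<open>simp add: not_integrable_integral_eq\<close>)
  \<comment> \<open>After splicing at \<open>J\<close> the shifted sequence is exactly the second
    component \<open>y\<close>, so \<open>g\<close> no longer sees \<open>x\<close>.\<close>
  have "(\<integral>x. f x * g (\<lambda>l. x (l + J)) \<partial>S)
      = (\<integral>x. \<integral>y. f (comb_seq J x y) * g (\<lambda>l. comb_seq J x y (l + J)) \<partial>S \<partial>S)"
    by (rule integral_comb_seq[symmetric, of _ B]) (auto intro: fg)
  then have "(\<integral>x. f x * g (\<lambda>l. x (l + J)) \<partial>S) - (\<integral>x. f x \<partial>S) * (\<integral>x. g x \<partial>S)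
      = (\<integral>x. \<integral>y. f (comb_seq J x y) * g y \<partial>S \<partial>S)
        - (\<integral>x. (\<integral>z. f (comb_seq J x z) \<partial>S) * (\<integral>y. g y \<partial>S) \<partial>S)"
    by (simp add: comb_seq_add integral_comb_seq[of f B J] f)
  also have "\<dots> = (\<integral>x. (\<integral>y. f (comb_seq J x y) * g y \<partial>S)
        - (\<integral>z. f (comb_seq J x z) \<partial>S) * (\<integral>y. g y \<partial>S) \<partial>S)"
    by (intro Bochner_Integration.integral_diff[symmetric] int integrable_mult_left)
      (auto intro!: bound f fg)
  \<comment> \<open>The mean of \<open>f\<close> is computed with a tail \<open>z\<close>
    independent of \<open>y\<close>. Both products then share the factor \<open>g y\<close>, and
    what remains is the difference in \<open>tail_osc\<close>.\<close>
  also have "\<dots> = (\<integral>x. \<integral>y. \<integral>z. (f (comb_seq J x y) - f (comb_seq J x z)) * g y \<partial>S \<partial>S \<partial>S)"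
  proof (intro Bochner_Integration.integral_cong refl)
    fix x assume x: "x \<in> space S"
    let ?b = "\<integral>z. f (comb_seq J x z) \<partial>S"
    have "(\<integral>y. \<integral>z. (f (comb_seq J x y) - f (comb_seq J x z)) * g y \<partial>S \<partial>S) = (\<integral>y. (f (comb_seq J x y) - ?b) * g y \<partial>S)"
      using intf[OF x] by (simp add: P.prob_space)
    also have "\<dots> = (\<integral>y. f (comb_seq J x y) * g y - ?b * g y \<partial>S)"
      by (simp add: left_diff_distrib)
    also have "\<dots> = (\<integral>y. f (comb_seq J x y) * g y \<partial>S) - ?b * (\<integral>y. g y \<partial>S)"
      using intf[OF x] intg by simp
    finally show "(\<integral>y. f (comb_seq J x y) * g y \<partial>S) - ?b * (\<integral>y. g y \<partial>S)
      = (\<integral>y. \<integral>z. (f (comb_seq J x y) - f (comb_seq J x z)) * g y \<partial>S \<partial>S)" ..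
  qed
  finally have eq: "(\<integral>x. f x * g (\<lambda>l. x (l + J)) \<partial>S) - (\<integral>x. f x \<partial>S) * (\<integral>x. g x \<partial>S) = \<dots>" .
  have abs_le: "ennreal \<bar>\<integral>x. h x \<partial>S\<bar> \<le> (\<integral>\<^sup>+x. ennreal \<bar>h x\<bar> \<partial>S)" for h :: "(nat \<Rightarrow> 'a) \<Rightarrow> real"
    using integral_norm_bound_ennreal[of S h] by (cases "integrable S h") (auto simp: not_integrable_integral_eq)
  have "ennreal \<bar>\<integral>x. \<integral>y. \<integral>z. (f (comb_seq J x y) - f (comb_seq J x z)) * g y \<partial>S \<partial>S \<partial>S\<bar>
      \<le> (\<integral>\<^sup>+x. \<integral>\<^sup>+y. \<integral>\<^sup>+z. ennreal \<bar>(f (comb_seq J x y) - f (comb_seq J x z)) * g y\<bar> \<partial>S \<partial>S \<partial>S)"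
    by (intro order_trans[OF abs_le] nn_integral_mono order_refl)
  also have "\<dots> \<le> tail_osc f J"
    unfolding tail_osc_def
    by (intro nn_integral_mono ennreal_leI) (simp add: abs_mult mult_left_le g)
  finally show ?thesis
    unfolding eq .
qed

end

section \<open>Weak law for time averages\<close>

text \<open>Each row has at most \<open>2 * J0 + 1\<close> entries at distance less than
  \<open>J0\<close>, bounded by \<open>K\<close>; all others are at most \<open>\<delta>\<close>.
  For covariance bounds, division by the squared number of terms leaves \<open>\<delta>\<close> plus
  a term that vanishes with growing sample size.\<close>

lemma double_sum_off_diagonal_le:
  fixes g :: "nat \<Rightarrow> real" and \<delta> K :: real and J0 :: nat and A :: "nat set"
  assumes "\<And>J. J \<ge> J0 \<Longrightarrow> g J \<le> \<delta>" "\<And>J. g J \<le> K" "\<delta> \<ge> 0" "K \<ge> 0" "finite A"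
  shows "(\<Sum>t\<in>A. \<Sum>t'\<in>A. g (nat \<bar>int t - int t'\<bar>)) \<le> real (card A) * (real (card A) * \<delta> + real (2 * J0 + 1) * K)"
proof -
  have "(\<Sum>t'\<in>A. g (nat \<bar>int t - int t'\<bar>)) \<le> real (card A) * \<delta> + real (2 * J0 + 1) * K" for t
  proof -
    \<comment> \<open>Natural subtraction truncates \<open>t - J0\<close> at 0, which only shortens
      the interval.\<close>
    have "(\<Sum>t'\<in>A. g (nat \<bar>int t - int t'\<bar>)) \<le> (\<Sum>t'\<in>A. \<delta> + K * indicator {t - J0..t + J0} t')"
    proof (rule sum_mono)
      fix t'
      show "g (nat \<bar>int t - int t'\<bar>) \<le> \<delta> + K * indicator {t - J0..t + J0} t'"
      proof (cases "nat \<bar>int t - int t'\<bar> \<ge> J0")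
        case True
        then show ?thesis using assms(1)[OF True] assms(3,4) by (auto simp: indicator_def)
      next
        case False
        then have "t' \<in> {t - J0..t + J0}" by auto
        then show ?thesis using assms(2)[of "nat \<bar>int t - int t'\<bar>"] assms(3) by (auto simp: indicator_def)
      qed
    qed
    also have "\<dots> = real (card A) * \<delta> + K * real (card (A \<inter> {t - J0..t + J0}))"
      using assms(5) by (simp add: sum.distrib sum_distrib_left[symmetric] indicator_def sum.If_cases Int_def)
    finally have "(\<Sum>t'\<in>A. g (nat \<bar>int t - int t'\<bar>)) \<le> \<dots>" .
    moreover have "card (A \<inter> {t - J0..t + J0}) \<le> 2 * J0 + 1"
      by (rule order_trans[OF card_mono[of "{t - J0..t + J0}"]]) auto
    then have "K * real (card (A \<inter> {t - J0..t + J0})) \<le> real (2 * J0 + 1) * K"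
      using assms(4) by (subst mult.commute) (intro mult_right_mono, linarith)
    ultimately show ?thesis by linarith
  qed
  then have "(\<Sum>t\<in>A. \<Sum>t'\<in>A. g (nat \<bar>int t - int t'\<bar>)) \<le> (\<Sum>t\<in>A. real (card A) * \<delta> + real (2 * J0 + 1) * K)"
    by (intro sum_mono)
  then show ?thesis by simp
qed

lemma time_avg_cong: "(\<And>t. t \<in> {m+1..n} \<Longrightarrow> f t = g t) \<Longrightarrow> time_avg m n f = time_avg m n g"
  unfolding time_avg_def by (intro arg_cong[where f = "scaleR _"] sum.cong) auto

lemma time_avg_diff: "time_avg m n f - time_avg m n g = time_avg m n (\<lambda>t. f t - g t)"
  by (simp add: time_avg_def sum_subtractf scaleR_diff_right)

text \<open>Only the law of one past at a time is assumed. Joint laws at different times follow,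
  because an earlier past is a shift of the later one; all expectations can thus be computed on
  \<open>S\<close>, where coordinates can be redrawn.\<close>

locale iid_past = W: prob_space M + sequence_space \<mu> for M :: "'w measure" and \<mu> :: "real measure" +
  fixes e :: "int \<Rightarrow> 'w \<Rightarrow> real"
  assumes sets_noise [measurable_cong]: "sets \<mu> = sets borel"
    and past_measurable [measurable]: "\<And>t. past e t \<in> measurable M S"
    and distr_past: "\<And>t. distr M S (past e t) = S"
begin

lemma past_shift: "past e (t - int k) w = (\<lambda>l. past e t w (l + k))"
  by (auto simp: past_def fun_eq_iff algebra_simps)

lemma abs_expectation_le:
  fixes h :: "(nat \<Rightarrow> real) \<Rightarrow> real"
  assumes [measurable]: "h \<in> borel_measurable S" and h: "\<And>x. \<bar>h x\<bar> \<le> B"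
  shows "integrable S h" "\<bar>\<integral>x. h x \<partial>S\<bar> \<le> B"
proof -
  show int: "integrable S h"
    by (rule P.integrable_const_bound[where B = B]) (auto intro!: h)
  have "\<bar>\<integral>y. h y \<partial>S\<bar> \<le> (\<integral>y. \<bar>h y\<bar> \<partial>S)" by (rule integral_abs_bound)
  also have "\<dots> \<le> B" using int h by (intro P.integral_le_const) auto
  finally show "\<bar>\<integral>x. h x \<partial>S\<bar> \<le> B" .
qed

lemma integral_past:
  fixes f :: "(nat \<Rightarrow> real) \<Rightarrow> real"
  assumes "f \<in> borel_measurable S"
  shows "(\<integral>w. f (past e t w) \<partial>M) = (\<integral>x. f x \<partial>S)"
  using integral_distr[OF past_measurable assms] by (simp add: distr_past)

lemma nn_integral_past:
  assumes "f \<in> borel_measurable S"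
  shows "(\<integral>\<^sup>+w. f (past e t w) \<partial>M) = (\<integral>\<^sup>+x. f x \<partial>S)"
  using nn_integral_distr[OF past_measurable[of t], of f] assms by (simp add: distr_past)

lemma shift_measurable [measurable]: "(\<lambda>x l. x (l + k)) \<in> measurable S S"
  by (rule measurable_PiM_single') (auto simp: space_PiM PiE_iff)

text \<open>Splicing two draws at \<open>k\<close> gives a draw from \<open>S\<close> whose shift by
  \<open>k\<close> is the second draw.\<close>

lemma nn_integral_shift:
  assumes [measurable]: "f \<in> borel_measurable S"
  shows "(\<integral>\<^sup>+x. f (\<lambda>l. x (l + k)) \<partial>S) = (\<integral>\<^sup>+x. f x \<partial>S)"
proof -
  have "(\<integral>\<^sup>+x. f (\<lambda>l. x (l + k)) \<partial>S) = (\<integral>\<^sup>+x. \<integral>\<^sup>+y. f (\<lambda>l. comb_seq k x y (l + k)) \<partial>S \<partial>S)"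
    by (rule nn_integral_comb_seq[symmetric]) measurable
  then show ?thesis by (simp add: comb_seq_add emeasure_space_eq_1)
qed

text \<open>Centring makes the product of the means vanish and leaves the tail oscillation
  unchanged. Only the later function \<open>h\<close> has to forget its remote inputs; the earlier
  \<open>h'\<close> enters through its bound.\<close>

lemma covariance_past_le:
  assumes [measurable]: "h \<in> borel_measurable S" "h' \<in> borel_measurable S"
    and h: "\<And>x. \<bar>h x\<bar> \<le> 1" and h': "\<And>x. \<bar>h' x\<bar> \<le> 1"
    and osc: "\<And>j. coord_osc h j \<le> ennreal (c j)" and c: "summable c" "\<And>j. c j \<ge> 0"
    and t: "t' \<le> t"
  shows "\<bar>\<integral>w. (h (past e (int t) w) - (\<integral>x. h x \<partial>S)) * (h' (past e (int t') w) - (\<integral>x. h' x \<partial>S)) \<partial>M\<bar>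
     \<le> 2 * (\<Sum>j. c (j + (t - t')))"
proof -
  define f where "f x = h x - (\<integral>x. h x \<partial>S)" for x
  \<comment> \<open>Halving fits the bound 1 demanded by \<open>covariance_le_tail_osc\<close>; it
    returns as the factor 2 of the conclusion.\<close>
  define g where "g x = (h' x - (\<integral>x. h' x \<partial>S)) / 2" for x
  have [measurable]: "f \<in> borel_measurable S" "g \<in> borel_measurable S"
    unfolding f_def g_def by measurable
  have hb: "integrable S h"
    using h by (rule abs_expectation_le(1)[rotated]) measurable
  have f: "\<bar>f x\<bar> \<le> 2" for x
    using h[of x] abs_expectation_le(2)[OF assms(1) h] unfolding f_def by linarith
  have g: "\<bar>g x\<bar> \<le> 1" for x
    using h'[of x] abs_expectation_le(2)[OF assms(2) h'] unfolding g_def by simp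
  have f0: "(\<integral>x. f x \<partial>S) = 0"
    using hb by (simp add: f_def P.prob_space)
  define J where "J = t - t'"
  have sm: "0 \<le> (\<Sum>j. c (j + J))"
    using c by (intro suminf_nonneg) (simp_all add: summable_iff_shift)
  \<comment> \<open>The earlier past is the later one shifted by \<open>J\<close>, so both factors
    become functions of a single sequence.\<close>
  have "(\<integral>w. f (past e (int t) w) * g (past e (int t') w) \<partial>M)
      = (\<integral>w. f (past e (int t) w) * g (\<lambda>l. past e (int t) w (l + J)) \<partial>M)"
    using past_shift[of "int t" J] t by (simp add: J_def of_nat_diff)
  also have "\<dots> = (\<integral>x. f x * g (\<lambda>l. x (l + J)) \<partial>S)"
    by (rule integral_past) measurable
  finally have eq: "(\<integral>w. f (past e (int t) w) * g (past e (int t') w) \<partial>M) = \<dots>" .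
  have "ennreal \<bar>\<integral>x. f x * g (\<lambda>l. x (l + J)) \<partial>S\<bar> \<le> tail_osc f J"
    using covariance_le_tail_osc[of f g 2 J] f g f0 by simp
  also have "tail_osc f J = tail_osc h J"
    unfolding tail_osc_def f_def by simp
  also have "\<dots> \<le> ennreal (\<Sum>j. c (j + J))"
    by (rule tail_osc_le_suminf[OF hb osc c])
  finally have "\<bar>\<integral>x. f x * g (\<lambda>l. x (l + J)) \<partial>S\<bar> \<le> (\<Sum>j. c (j + J))"
    using sm by simp
  moreover have "(\<integral>w. (h (past e (int t) w) - (\<integral>x. h x \<partial>S)) * (h' (past e (int t') w) - (\<integral>x. h' x \<partial>S)) \<partial>M)
     = 2 * (\<integral>w. f (past e (int t) w) * g (past e (int t') w) \<partial>M)"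
    unfolding f_def g_def by simp
  ultimately show ?thesis
    unfolding eq J_def by simp
qed

text \<open>The covariance bound depends only on \<open>c\<close> and the distance of the two times,
  so Chebyshev's inequality works although \<open>h\<close> varies with \<open>n\<close> and
  \<open>t\<close>.\<close>

lemma weak_law_time_avg:
  fixes h :: "nat \<Rightarrow> nat \<Rightarrow> (nat \<Rightarrow> real) \<Rightarrow> real"
  assumes h_meas: "\<And>n t. t \<in> {m+1..n} \<Longrightarrow> h n t \<in> borel_measurable S"
    and h: "\<And>n t x. \<bar>h n t x\<bar> \<le> 1"
    and osc: "\<And>n t j. t \<in> {m+1..n} \<Longrightarrow> coord_osc (h n t) j \<le> ennreal (c j)"
    and c: "summable c" "\<And>j. c j \<ge> 0"
    and pos: "\<kappa> > 0" "\<rho> > 0"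
  shows "\<forall>\<^sub>F n in sequentially. measure M {w \<in> space M. \<kappa> \<le>
    \<bar>time_avg m n (\<lambda>t. h n t (past e (int t) w)) - time_avg m n (\<lambda>t. \<integral>x. h n t x \<partial>S)\<bar>} \<le> \<rho>"
proof -
  define \<gamma> where "\<gamma> J = 2 * (\<Sum>j. c (j + J))" for J
  have \<gamma>0: "\<gamma> J \<ge> 0" for J
    unfolding \<gamma>_def using c by (intro mult_nonneg_nonneg suminf_nonneg) (simp_all add: summable_iff_shift)
  have \<gamma>_le: "\<gamma> J \<le> \<gamma> 0" for J
    unfolding \<gamma>_def using suminf_split_initial_segment[OF c(1), of J] sum_nonneg[of "{..<J}" c] c(2) by simp
  \<comment> \<open>Chebyshev's inequality allows a second moment of
    \<open>\<rho> * \<kappa>\<^sup>2\<close>; half of it goes to pairs of distant times, half to the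
    near-diagonal term \<open>K / N\<close>.\<close>
  define \<delta> where "\<delta> = \<rho> * \<kappa>\<^sup>2 / 2"
  have \<delta>: "\<delta> > 0" using pos by (simp add: \<delta>_def)
  obtain J0 where J0: "\<And>J. J \<ge> J0 \<Longrightarrow> \<gamma> J \<le> \<delta>"
    using suminf_exist_split[OF half_gt_zero[OF \<delta>] c(1)] by (fastforce simp: \<gamma>_def)
  define K where "K = (2 * J0 + 1) * \<gamma> 0"
  have "(\<lambda>n. K / real n) \<longlonglongrightarrow> 0"
    by (rule lim_const_over_n)
  then have "\<forall>\<^sub>F n in sequentially. K / real n < \<delta>"
    using \<delta> by (rule order_tendstoD)
  then obtain N0 where N0: "\<And>n. n \<ge> N0 \<Longrightarrow> K / real n < \<delta>"
    by (auto simp: eventually_sequentially)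
  have "measure M {w \<in> space M. \<kappa> \<le>
    \<bar>time_avg m n (\<lambda>t. h n t (past e (int t) w)) - time_avg m n (\<lambda>t. \<integral>x. h n t x \<partial>S)\<bar>} \<le> \<rho>"
    if n: "n \<ge> m + N0 + 1" for n
  proof -
    let ?A = "{m+1..n}"
    define N where "N = card ?A"
    have N: "N = n - m" "N > 0" "N \<ge> N0" using n by (auto simp: N_def)
    define Y where "Y t w = h n t (past e (int t) w) - (\<integral>x. h n t x \<partial>S)" for t w
    have [measurable]: "Y t \<in> borel_measurable M" if "t \<in> ?A" for t
    proof -
      have [measurable]: "h n t \<in> borel_measurable S" using h_meas that .
      show ?thesis unfolding Y_def by measurable
    qed
    have Yb: "\<bar>Y t w\<bar> \<le> 2" if "t \<in> ?A" for t w
      using abs_expectation_le(2)[OF h_meas[OF that] h[of n t]] h[of n t "past e (int t) w"] unfolding Y_def by linarith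
    have int: "integrable M (\<lambda>w. Y t w * Y t' w)" if "t \<in> ?A" "t' \<in> ?A" for t t'
    proof (rule W.integrable_const_bound[where B = 4])
      show "AE x in M. norm (Y t x * Y t' x) \<le> 4"
        using mult_mono[OF Yb[OF that(1)] Yb[OF that(2)]] by (simp add: abs_mult)
    qed (use that in measurable)
    \<comment> \<open>\<open>covariance_past_le\<close> wants the later time first, hence the two
      cases.\<close>
    have cov: "(\<integral>w. Y t w * Y t' w \<partial>M) \<le> \<gamma> (nat \<bar>int t - int t'\<bar>)" if "t \<in> ?A" "t' \<in> ?A" for t t'
    proof (cases "t' \<le> t")
      case True
      have "\<bar>\<integral>w. Y t w * Y t' w \<partial>M\<bar> \<le> \<gamma> (t - t')"
        unfolding Y_def \<gamma>_def by (rule covariance_past_le) (use that True h_meas h osc c in auto)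
      moreover have "nat \<bar>int t - int t'\<bar> = t - t'" using True by auto
      ultimately show ?thesis by (simp only:)
    next
      case False
      have "\<bar>\<integral>w. Y t' w * Y t w \<partial>M\<bar> \<le> \<gamma> (t' - t)"
        unfolding Y_def \<gamma>_def by (rule covariance_past_le) (use that False h_meas h osc c in auto)
      moreover have "nat \<bar>int t - int t'\<bar> = t' - t" using False by auto
      ultimately show ?thesis by (simp only: mult.commute[of "Y t _"])
    qed
    define Z where "Z w = time_avg m n (\<lambda>t. Y t w)" for w
    have Z2: "(Z w)\<^sup>2 = (\<Sum>t\<in>?A. \<Sum>t'\<in>?A. Y t w * Y t' w) / (real N)\<^sup>2" for w
      unfolding Z_def time_avg_def N(1) by (simp add: power2_eq_square sum_product)
    have intZ: "integrable M (\<lambda>w. (Z w)\<^sup>2)"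
      unfolding Z2 by (intro integrable_divide Bochner_Integration.integrable_sum int)
    have "(\<integral>w. (Z w)\<^sup>2 \<partial>M) = (\<Sum>t\<in>?A. \<Sum>t'\<in>?A. \<integral>w. Y t w * Y t' w \<partial>M) / (real N)\<^sup>2"
    proof -
      have "(\<integral>w. (\<Sum>t\<in>?A. \<Sum>t'\<in>?A. Y t w * Y t' w) \<partial>M) = (\<Sum>t\<in>?A. \<integral>w. (\<Sum>t'\<in>?A. Y t w * Y t' w) \<partial>M)"
        by (intro Bochner_Integration.integral_sum Bochner_Integration.integrable_sum int)
      also have "\<dots> = (\<Sum>t\<in>?A. \<Sum>t'\<in>?A. \<integral>w. Y t w * Y t' w \<partial>M)"
        by (intro sum.cong refl Bochner_Integration.integral_sum int)
      finally show ?thesis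
        unfolding Z2 by simp
    qed
    also have "\<dots> \<le> (\<Sum>t\<in>?A. \<Sum>t'\<in>?A. \<gamma> (nat \<bar>int t - int t'\<bar>)) / (real N)\<^sup>2"
      by (intro divide_right_mono sum_mono cov) auto
    also have "\<dots> \<le> (N * (N * \<delta> + (2 * J0 + 1) * \<gamma> 0)) / (real N)\<^sup>2"
      unfolding N_def using \<gamma>_le \<delta> \<gamma>0 J0
      by (intro divide_right_mono double_sum_off_diagonal_le) auto
    also have "\<dots> = \<delta> + K / N"
      using N(2) by (simp add: K_def power2_eq_square field_simps)
    also have "\<dots> \<le> \<rho> * \<kappa>\<^sup>2"
      using N0[OF N(3)] unfolding \<delta>_def by linarith
    finally have EZ: "(\<integral>w. (Z w)\<^sup>2 \<partial>M) \<le> \<rho> * \<kappa>\<^sup>2" .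
    have "{w \<in> space M. \<kappa> \<le> \<bar>Z w\<bar>} = {w \<in> space M. \<kappa>\<^sup>2 \<le> (Z w)\<^sup>2}"
      using pos by (auto simp: abs_le_square_iff[symmetric])
    then have "measure M {w \<in> space M. \<kappa> \<le> \<bar>Z w\<bar>} \<le> (\<integral>w. (Z w)\<^sup>2 \<partial>M) / \<kappa>\<^sup>2"
      using integral_Markov_inequality_measure[OF intZ, of "space M" "\<kappa>\<^sup>2"] pos
      by (simp add: set_integral_space[OF intZ])
    also have "\<dots> \<le> \<rho>"
      using EZ pos by (simp add: field_simps)
    finally show ?thesis
      unfolding Z_def Y_def time_avg_diff .
  qed
  then show ?thesis
    unfolding eventually_sequentially by blast
qed

end

section \<open>Uniform convergence over the parameter set\<close>

text \<open>Stated with exceptional events, because the supremum over an uncountable \<open>\<Theta>\<close> need not be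
  measurable.\<close>

definition uniform_tendsto_in_prob ::
  "'w measure \<Rightarrow> 'b set \<Rightarrow> (nat \<Rightarrow> 'w \<Rightarrow> 'b \<Rightarrow> 'c::metric_space) \<Rightarrow> ('b \<Rightarrow> 'c) \<Rightarrow> bool" where
  "uniform_tendsto_in_prob M \<Theta> Z z \<longleftrightarrow>
     (\<forall>\<delta>>0. \<forall>\<rho>>0. \<forall>\<^sub>F n in sequentially. \<exists>A\<in>sets M. measure M A \<le> \<rho> \<and>
        (\<forall>w\<in>space M - A. \<forall>\<theta>\<in>\<Theta>. dist (Z n w \<theta>) (z \<theta>) \<le> \<delta>))"

text \<open>The exceptional events are united, so each may use only a share of
  \<open>\<rho>\<close>. Applied to a finite net of parameters, and later to the finitely many pairs
  of a series and a feature.\<close>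

lemma uniform_tendsto_in_prob_finite_family:
  assumes "prob_space M" and I: "finite I"
    and unif: "\<And>i. i \<in> I \<Longrightarrow> uniform_tendsto_in_prob M (T i) (Z i) (z i)"
    and pos: "\<delta> > 0" "\<rho> > 0"
  shows "\<forall>\<^sub>F n in sequentially. \<exists>A\<in>sets M. measure M A \<le> \<rho> \<and>
    (\<forall>w\<in>space M - A. \<forall>i\<in>I. \<forall>\<theta>\<in>T i. dist (Z i n w \<theta>) (z i \<theta>) \<le> \<delta>)"
proof -
  interpret prob_space M by fact
  \<comment> \<open>The added 1 avoids a division by 0 for empty \<open>I\<close>.\<close>
  let ?r = "\<rho> / (card I + 1)"
  have "\<forall>\<^sub>F n in sequentially. \<forall>i\<in>I. \<exists>A\<in>sets M. measure M A \<le> ?r \<and>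
    (\<forall>w\<in>space M - A. \<forall>\<theta>\<in>T i. dist (Z i n w \<theta>) (z i \<theta>) \<le> \<delta>)"
    using unif pos I by (intro eventually_ball_finite) (auto simp: uniform_tendsto_in_prob_def)
  then show ?thesis
  proof eventually_elim
    case (elim n)
    then obtain A where A: "\<And>i. i \<in> I \<Longrightarrow> A i \<in> sets M" "\<And>i. i \<in> I \<Longrightarrow> measure M (A i) \<le> ?r"
      "\<And>i w \<theta>. i \<in> I \<Longrightarrow> w \<in> space M - A i \<Longrightarrow> \<theta> \<in> T i \<Longrightarrow> dist (Z i n w \<theta>) (z i \<theta>) \<le> \<delta>"
      by metis
    have "measure M (\<Union>i\<in>I. A i) \<le> (\<Sum>i\<in>I. measure M (A i))"
      using I A by (intro finite_measure_subadditive_finite) auto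
    also have "\<dots> \<le> (\<Sum>i\<in>I. ?r)"
      by (intro sum_mono A)
    also have "\<dots> \<le> \<rho>"
      using pos by (simp add: field_simps)
    finally show ?case
      using A I by (intro bexI[of _ "\<Union>i\<in>I. A i"]) auto
  qed
qed

section \<open>Windows as functions of a single past\<close>

lemma borel_measurable_vec_lambda [measurable (raw)]:
  fixes f :: "'n::finite \<Rightarrow> 'a \<Rightarrow> 'b::euclidean_space"
  assumes [measurable]: "\<And>k. f k \<in> borel_measurable M"
  shows "(\<lambda>x. \<chi> k. f k x) \<in> borel_measurable M"
  by (subst borel_measurable_euclidean_space) (auto simp: Basis_vec_def inner_axis)

lemma lag_less_card: "lag (k :: 'm::{finite,linorder}) < CARD('m)"
proof -
  have "{i. k < i} \<subset> UNIV" by auto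
  then show ?thesis unfolding lag_def by (intro psubset_card_mono) auto
qed

text \<open>The row with index \<open>k\<close> reads the sequence from position
  \<open>lag k\<close> on. This makes the window at time \<open>t\<close> a function of the past at
  time \<open>t\<close> alone, as the covariance bounds require.\<close>

definition lagged_window ::
  "(nat \<Rightarrow> (nat \<Rightarrow> real) \<Rightarrow> real^'d) \<Rightarrow> nat \<Rightarrow> (nat \<Rightarrow> real) \<Rightarrow> real^'d^'m::{finite,linorder}" where
  "lagged_window H t x = (\<chi> k. H (t - lag k) (\<lambda>l. x (l + lag k)))"

lemma summable_delayed:
  fixes c :: "nat \<Rightarrow> real"
  assumes "summable c"
  shows "summable (\<lambda>j. if k \<le> j then c (j - k) else 0)"
  using assms summable_iff_shift[of "\<lambda>j. if k \<le> j then c (j - k) else 0" k] by simp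

lemma ennreal_lipschitz_le:
  fixes \<phi> :: "real^'d^'m \<Rightarrow> real"
  assumes "\<And>x y. \<bar>\<phi> x - \<phi> y\<bar> \<le> L * (\<Sum>k\<in>UNIV. norm (x $ k - y $ k))" "L > 0"
  shows "ennreal \<bar>\<phi> x - \<phi> y\<bar> \<le> (\<Sum>k\<in>UNIV. ennreal L * ennreal (norm (x $ k - y $ k)))"
proof -
  have "ennreal \<bar>\<phi> x - \<phi> y\<bar> \<le> ennreal (\<Sum>k\<in>UNIV. L * norm (x $ k - y $ k))"
    using assms(1) by (intro ennreal_leI) (simp add: sum_distrib_left)
  also have "\<dots> = (\<Sum>k\<in>UNIV. ennreal L * ennreal (norm (x $ k - y $ k)))"
    using assms(2) by (subst sum_ennreal[symmetric]) (auto simp: ennreal_mult)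
  finally show ?thesis .
qed

lemma ennreal_abs_time_avg_le:
  "ennreal \<bar>time_avg m n f\<bar> \<le> ennreal (1 / real (n - m)) * (\<Sum>t\<in>{m+1..n}. ennreal \<bar>f t :: real\<bar>)"
proof -
  have "ennreal \<bar>time_avg m n f\<bar> \<le> ennreal (1 / real (n - m) * (\<Sum>t\<in>{m+1..n}. \<bar>f t\<bar>))"
    unfolding time_avg_def by (intro ennreal_leI) (simp add: abs_mult divide_right_mono sum_abs)
  also have "\<dots> = ennreal (1 / real (n - m)) * (\<Sum>t\<in>{m+1..n}. ennreal \<bar>f t\<bar>)"
    by (subst ennreal_mult) (auto simp: sum_nonneg)
  finally show ?thesis .
qed

text \<open>One instance describes one series and one feature coordinate. The assumptions of the
  theorem appear in L1 form: \<open>equicontinuous\<close> supplies a measurable majorant instead of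
  the integral of a supremum, and \<open>mean\<close> is all that is known about
  \<open>\<Phi>\<close>, whose continuity is derived.\<close>

locale feature_family = iid_past M \<mu> e
  for M :: "'w measure" and \<mu> :: "real measure" and e :: "int \<Rightarrow> 'w \<Rightarrow> real" +
  fixes \<Theta> :: "'p::metric_space set"
    and H :: "nat \<Rightarrow> 'p \<Rightarrow> nat \<Rightarrow> (nat \<Rightarrow> real) \<Rightarrow> real^'d"
    and \<phi> :: "real^'d^'m::{finite,linorder} \<Rightarrow> real" and L :: real
    and m :: nat and c :: "nat \<Rightarrow> real" and \<Phi> :: "'p \<Rightarrow> real"
  assumes m: "CARD('m) = m + 1"
    and compact: "compact \<Theta>"
    and H_meas: "\<And>n t \<theta>. n \<ge> 1 \<Longrightarrow> t \<ge> 1 \<Longrightarrow> \<theta> \<in> \<Theta> \<Longrightarrow> H n \<theta> t \<in> borel_measurable S"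
    and feature_meas [measurable]: "\<phi> \<in> borel_measurable borel"
    and feature_bound: "\<And>x. \<bar>\<phi> x\<bar> \<le> 1"
    and feature_lipschitz: "\<And>x y. \<bar>\<phi> x - \<phi> y\<bar> \<le> L * (\<Sum>k\<in>UNIV. norm (x $ k - y $ k))"
    and L_pos: "L > 0"
    and dependence: "\<And>n t \<theta> j. n \<ge> 1 \<Longrightarrow> t \<ge> 1 \<Longrightarrow> \<theta> \<in> \<Theta> \<Longrightarrow>
       (\<integral>\<^sup>+x. \<integral>\<^sup>+y. ennreal (norm (H n \<theta> t x - H n \<theta> t (x(j := y)))) \<partial>\<mu> \<partial>S) \<le> ennreal (c j)"
    and summable_c: "summable c" and c_nonneg: "\<And>j. c j \<ge> 0"
    and equicontinuous: "\<And>\<eta>. \<eta> > 0 \<Longrightarrow> \<exists>\<delta>>0. \<forall>n\<ge>1. \<forall>t\<ge>1. \<exists>g\<in>borel_measurable S.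
       (\<forall>\<theta>\<in>\<Theta>. \<forall>\<theta>'\<in>\<Theta>. dist \<theta> \<theta>' \<le> \<delta> \<longrightarrow> (\<forall>x. ennreal (norm (H n \<theta> t x - H n \<theta>' t x)) \<le> g x)) \<and>
       (\<integral>\<^sup>+x. g x \<partial>S) \<le> ennreal \<eta>"
    and mean: "\<And>\<theta>. \<theta> \<in> \<Theta> \<Longrightarrow>
       (\<lambda>n. time_avg m n (\<lambda>t. \<integral>x. \<phi> (lagged_window (H n \<theta>) t x) \<partial>S)) \<longlonglongrightarrow> \<Phi> \<theta>"
begin

lemma lag_le: "lag (k :: 'm) \<le> m"
  using lag_less_card[of k] m by simp

lemma window_past:
  assumes "t > m"
  shows "(window (\<lambda>t. H n \<theta> t (past e (int t) w)) t :: real^'d^('m::{finite,linorder})) = lagged_window (H n \<theta>) t (past e (int t) w)"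
  unfolding window_def lagged_window_def
proof (intro arg_cong[of _ _ vec_lambda] ext)
  fix k :: 'm
  \<comment> \<open>Ensures that the natural subtraction \<open>t - lag k\<close> is exact.\<close>
  have "lag k \<le> t" using lag_le[of k] assms by simp
  then show "H n \<theta> (t - lag k) (past e (int (t - lag k)) w) = H n \<theta> (t - lag k) (\<lambda>l. past e (int t) w (l + lag k))"
    by (simp add: past_shift of_nat_diff)
qed

lemma lagged_meas:
  assumes "n \<ge> 1" "t > m" "\<theta> \<in> \<Theta>"
  shows "H n \<theta> (t - lag (k :: 'm)) \<in> borel_measurable S"
  using assms lag_le[of k] by (intro H_meas) auto

lemma lagged_window_meas:
  assumes "n \<ge> 1" "t > m" "\<theta> \<in> \<Theta>"
  shows "(lagged_window (H n \<theta>) t :: _ \<Rightarrow> real^'d^('m::{finite,linorder})) \<in> borel_measurable S"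
proof -
  have [measurable]: "H n \<theta> (t - lag (k :: 'm)) \<in> borel_measurable S" for k
    using lagged_meas assms .
  show ?thesis unfolding lagged_window_def by measurable
qed

text \<open>Input \<open>j\<close> of the window is input \<open>j - lag k\<close> of row
  \<open>k\<close>, and a row whose lag exceeds \<open>j\<close> does not see it. Each row thus
  delays \<open>c\<close> by at most \<open>m\<close> steps, which keeps the sum over the rows
  summable in \<open>j\<close>.\<close>

definition feature_dependence :: "nat \<Rightarrow> real" where
  "feature_dependence j = (\<Sum>k\<in>(UNIV :: 'm set). L * (if lag k \<le> j then c (j - lag k) else 0))"

lemma summable_feature_dependence: "summable feature_dependence"
  unfolding feature_dependence_def
  by (intro summable_sum summable_mult summable_delayed summable_c)

lemma feature_dependence_nonneg: "feature_dependence j \<ge> 0"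
  unfolding feature_dependence_def using L_pos c_nonneg by (intro sum_nonneg) auto

lemma coord_osc_feature:
  assumes n: "n \<ge> 1" "t > m" "\<theta> \<in> \<Theta>"
  shows "coord_osc (\<lambda>x. \<phi> (lagged_window (H n \<theta>) t x)) j \<le> ennreal (feature_dependence j)"
proof -
  have [measurable]: "H n \<theta> (t - lag (k :: 'm)) \<in> borel_measurable S" for k
    using lagged_meas n .
  have [measurable (raw)]: "(\<lambda>x l. f x (l + k)) \<in> measurable N S" if "f \<in> measurable N S" for f N and k :: nat
    by (rule measurable_compose[OF that shift_measurable])
  let ?D = "\<lambda>(k::'m) x y. ennreal (norm (H n \<theta> (t - lag k) (\<lambda>l. x (l + lag k)) - H n \<theta> (t - lag k) (\<lambda>l. (x(j := y)) (l + lag k))))"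
  have "coord_osc (\<lambda>x. \<phi> (lagged_window (H n \<theta>) t x)) j \<le> (\<integral>\<^sup>+x. \<integral>\<^sup>+y. (\<Sum>k\<in>UNIV. ennreal L * ?D k x y) \<partial>\<mu> \<partial>S)"
    unfolding coord_osc_def
    by (intro nn_integral_mono order_trans[OF ennreal_lipschitz_le[OF feature_lipschitz L_pos]]) (simp add: lagged_window_def)
  also have "\<dots> = (\<Sum>k\<in>UNIV. ennreal L * (\<integral>\<^sup>+x. \<integral>\<^sup>+y. ?D k x y \<partial>\<mu> \<partial>S))"
    by (simp add: nn_integral_sum nn_integral_cmult del: fun_upd_apply cong: nn_integral_cong)
  also have "\<dots> \<le> (\<Sum>k\<in>UNIV. ennreal L * ennreal (if lag (k :: 'm) \<le> j then c (j - lag k) else 0))"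
  proof (intro sum_mono mult_left_mono)
    fix k :: 'm
    show "(\<integral>\<^sup>+x. \<integral>\<^sup>+y. ?D k x y \<partial>\<mu> \<partial>S) \<le> ennreal (if lag k \<le> j then c (j - lag k) else 0)"
    proof (cases "lag k \<le> j")
      case True
      have eq: "(\<lambda>l. (x(j := y)) (l + lag k)) = (\<lambda>l. x (l + lag k))(j - lag k := y)" for x :: "nat \<Rightarrow> real" and y
        using True by (auto simp: fun_eq_iff)
      have "(\<integral>\<^sup>+x. \<integral>\<^sup>+y. ?D k x y \<partial>\<mu> \<partial>S) = (\<integral>\<^sup>+x. \<integral>\<^sup>+y. ennreal (norm (H n \<theta> (t - lag k) x - H n \<theta> (t - lag k) (x(j - lag k := y)))) \<partial>\<mu> \<partial>S)"
        unfolding eq by (rule nn_integral_shift) measurable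
      then show ?thesis
        using True dependence[of n "t - lag k" \<theta> "j - lag k"] n lag_le[of k] by simp
    next
      case False
      then have "(\<lambda>l. (x(j := y)) (l + lag k)) = (\<lambda>l. x (l + lag k))" for x :: "nat \<Rightarrow> real" and y
        by (auto simp: fun_eq_iff)
      then show ?thesis by simp
    qed
  qed auto
  also have "\<dots> = ennreal (feature_dependence j)"
    unfolding feature_dependence_def using L_pos c_nonneg
    by (subst sum_ennreal[symmetric]) (auto simp: ennreal_mult)
  finally show ?thesis .
qed

abbreviation feature_avg :: "nat \<Rightarrow> 'w \<Rightarrow> 'p \<Rightarrow> real" where
  "feature_avg n w \<theta> \<equiv> time_avg m n (\<lambda>t. \<phi> (window (\<lambda>t. H n \<theta> t (past e (int t) w)) t))"

lemma feature_avg_eq: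
  "feature_avg n w \<theta> = time_avg m n (\<lambda>t. \<phi> (lagged_window (H n \<theta>) t (past e (int t) w)))"
  by (intro time_avg_cong) (simp add: window_past)

text \<open>The singleton parameter set gives the form that
  \<open>uniform_tendsto_in_prob_finite_family\<close> accepts for the points of a net.\<close>

lemma pointwise_law:
  assumes "\<theta> \<in> \<Theta>"
  shows "uniform_tendsto_in_prob M {\<theta>} feature_avg \<Phi>"
  unfolding uniform_tendsto_in_prob_def
proof (intro allI impI)
  fix \<delta> \<rho> :: real assume pos: "\<delta> > 0" "\<rho> > 0"
  let ?h = "\<lambda>n t x. \<phi> (lagged_window (H n \<theta>) t x)"
  let ?a = "\<lambda>n. time_avg m n (\<lambda>t. \<integral>x. ?h n t x \<partial>S)"
  have meas: "?h n t \<in> borel_measurable S" if "t \<in> {m+1..n}" for n t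
    using lagged_window_meas[of n t \<theta>] that assms by (intro measurable_compose[OF _ feature_meas]) auto
  have "\<forall>\<^sub>F n in sequentially. measure M {w \<in> space M. \<delta> / 2 \<le> \<bar>feature_avg n w \<theta> - ?a n\<bar>} \<le> \<rho>"
    unfolding feature_avg_eq
    by (rule weak_law_time_avg[OF meas feature_bound _ summable_feature_dependence feature_dependence_nonneg])
      (use coord_osc_feature assms pos in auto)
  \<comment> \<open>One half of \<open>\<delta>\<close> covers the fluctuation around the mean, the
    other half the bias of the mean.\<close>
  moreover have "\<forall>\<^sub>F n in sequentially. dist (?a n) (\<Phi> \<theta>) < \<delta> / 2"
    using tendstoD[OF mean[OF assms], of "\<delta> / 2"] pos by simp
  ultimately show "\<forall>\<^sub>F n in sequentially. \<exists>A\<in>sets M. measure M A \<le> \<rho> \<and>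
      (\<forall>w\<in>space M - A. \<forall>\<theta>\<in>{\<theta>}. dist (feature_avg n w \<theta>) (\<Phi> \<theta>) \<le> \<delta>)"
  proof eventually_elim
    case (elim n)
    let ?A = "{w \<in> space M. \<delta> / 2 \<le> \<bar>feature_avg n w \<theta> - ?a n\<bar>}"
    have "(\<lambda>w. feature_avg n w \<theta>) \<in> borel_measurable M"
      unfolding feature_avg_eq unfolding time_avg_def
    proof (intro borel_measurable_scaleR borel_measurable_sum)
      fix t assume "t \<in> {m+1..n}"
      note [measurable] = meas[OF this]
      show "(\<lambda>w. ?h n t (past e (int t) w)) \<in> borel_measurable M" by measurable
    qed simp
    then have "?A \<in> sets M" by measurable
    moreover have "dist (feature_avg n w \<theta>) (\<Phi> \<theta>) \<le> \<delta>" if "w \<in> space M - ?A" for w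
    proof -
      have "\<not> \<delta> / 2 \<le> \<bar>feature_avg n w \<theta> - ?a n\<bar>"
        using that by blast
      moreover have "\<bar>?a n - \<Phi> \<theta>\<bar> < \<delta> / 2"
        using elim(2) unfolding dist_real_def .
      ultimately show ?thesis unfolding dist_real_def by linarith
    qed
    ultimately show ?case
      using elim(1) by (intro bexI[of _ ?A] conjI ballI) (simp_all only: singleton_iff)
  qed
qed

text \<open>The majorant \<open>Z\<close> is fixed before the pair of parameters, so a single event
  will control all close pairs at once; \<open>\<delta>\<close> does not depend on
  \<open>n\<close>.\<close>

lemma feature_avg_equicontinuous:
  assumes "\<eta> > 0"
  obtains \<delta> where "\<delta> > 0"
    and "\<And>n. n > m \<Longrightarrow> \<exists>Z\<in>borel_measurable M. (\<integral>\<^sup>+w. Z w \<partial>M) \<le> ennreal \<eta> \<and>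
       (\<forall>w\<in>space M. \<forall>\<theta>\<in>\<Theta>. \<forall>\<theta>'\<in>\<Theta>. dist \<theta> \<theta>' \<le> \<delta> \<longrightarrow> ennreal \<bar>feature_avg n w \<theta> - feature_avg n w \<theta>'\<bar> \<le> Z w)"
proof -
  \<comment> \<open>Each of the \<open>CARD('m)\<close> rows contributes at most
    \<open>L * \<eta>'\<close> to the mean of \<open>Z\<close>.\<close>
  define \<eta>' where "\<eta>' = \<eta> / (L * CARD('m))"
  have \<eta>': "\<eta>' > 0" "L * CARD('m) * \<eta>' = \<eta>"
    using assms L_pos by (auto simp: \<eta>'_def)
  obtain \<delta> where \<delta>: "\<delta> > 0" and "\<forall>n\<ge>1. \<forall>t\<ge>1. \<exists>g\<in>borel_measurable S.
       (\<forall>\<theta>\<in>\<Theta>. \<forall>\<theta>'\<in>\<Theta>. dist \<theta> \<theta>' \<le> \<delta> \<longrightarrow> (\<forall>x. ennreal (norm (H n \<theta> t x - H n \<theta>' t x)) \<le> g x)) \<and>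
       (\<integral>\<^sup>+x. g x \<partial>S) \<le> ennreal \<eta>'"
    using equicontinuous[OF \<eta>'(1)] by blast
  then obtain g where g_meas: "\<And>n t. n \<ge> 1 \<Longrightarrow> t \<ge> 1 \<Longrightarrow> g n t \<in> borel_measurable S"
    and g: "\<And>n t \<theta> \<theta>' x. n \<ge> 1 \<Longrightarrow> t \<ge> 1 \<Longrightarrow> \<theta> \<in> \<Theta> \<Longrightarrow> \<theta>' \<in> \<Theta> \<Longrightarrow> dist \<theta> \<theta>' \<le> \<delta> \<Longrightarrow>
       ennreal (norm (H n \<theta> t x - H n \<theta>' t x)) \<le> g n t x"
    and g_int: "\<And>n t. n \<ge> 1 \<Longrightarrow> t \<ge> 1 \<Longrightarrow> (\<integral>\<^sup>+x. g n t x \<partial>S) \<le> ennreal \<eta>'"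
    by metis
  have "\<exists>Z\<in>borel_measurable M. (\<integral>\<^sup>+w. Z w \<partial>M) \<le> ennreal \<eta> \<and>
       (\<forall>w\<in>space M. \<forall>\<theta>\<in>\<Theta>. \<forall>\<theta>'\<in>\<Theta>. dist \<theta> \<theta>' \<le> \<delta> \<longrightarrow> ennreal \<bar>feature_avg n w \<theta> - feature_avg n w \<theta>'\<bar> \<le> Z w)"
    if n: "n > m" for n
  proof -
    define N where "N = n - m"
    have N: "N > 0" using n by (simp add: N_def)
    let ?G = "\<lambda>t (k::'m) w. g n (t - lag k) (past e (int t - int (lag k)) w)"
    have ok: "n \<ge> 1" "t - lag k \<ge> 1" if "t \<in> {m+1..n}" for t and k :: 'm
      using that lag_le[of k] by auto
    have G_meas [measurable]: "(\<lambda>w. ?G t k w) \<in> borel_measurable M" if "t \<in> {m+1..n}" for t k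
      using g_meas[OF ok[OF that]] by measurable
    define Z where "Z w = ennreal (1 / N) * (\<Sum>t\<in>{m+1..n}. \<Sum>k\<in>UNIV. ennreal L * ?G t k w)" for w
    have [measurable]: "Z \<in> borel_measurable M"
      unfolding Z_def by (intro borel_measurable_times_ennreal borel_measurable_sum borel_measurable_const G_meas)
    have "(\<integral>\<^sup>+w. Z w \<partial>M) = ennreal (1 / N) * (\<Sum>t\<in>{m+1..n}. \<Sum>k\<in>UNIV. ennreal L * (\<integral>\<^sup>+w. ?G t k w \<partial>M))"
    proof -
      have "(\<integral>\<^sup>+w. Z w \<partial>M) = ennreal (1 / N) * (\<integral>\<^sup>+w. (\<Sum>t\<in>{m+1..n}. \<Sum>k\<in>UNIV. ennreal L * ?G t k w) \<partial>M)"
        unfolding Z_def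
        by (intro nn_integral_cmult borel_measurable_times_ennreal borel_measurable_sum borel_measurable_const G_meas)
      also have "(\<integral>\<^sup>+w. (\<Sum>t\<in>{m+1..n}. \<Sum>k\<in>UNIV. ennreal L * ?G t k w) \<partial>M)
          = (\<Sum>t\<in>{m+1..n}. \<integral>\<^sup>+w. (\<Sum>k\<in>UNIV. ennreal L * ?G t k w) \<partial>M)"
        by (intro nn_integral_sum borel_measurable_times_ennreal borel_measurable_sum borel_measurable_const G_meas)
      also have "\<dots> = (\<Sum>t\<in>{m+1..n}. \<Sum>k\<in>UNIV. ennreal L * (\<integral>\<^sup>+w. ?G t k w \<partial>M))"
        by (intro sum.cong refl) (simp add: nn_integral_sum nn_integral_cmult)
      finally show ?thesis .
    qed
    also have "\<dots> \<le> ennreal (1 / N) * (\<Sum>t\<in>{m+1..n}. \<Sum>k\<in>(UNIV :: 'm set). ennreal L * ennreal \<eta>')"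
      by (intro mult_left_mono sum_mono) (simp_all add: nn_integral_past[OF g_meas[OF ok]] g_int[OF ok])
    also have "\<dots> = ennreal \<eta>"
      using L_pos N \<eta>' by (simp add: N_def[symmetric] ennreal_mult[symmetric] ennreal_of_nat_eq_real_of_nat field_simps)
    finally have "(\<integral>\<^sup>+w. Z w \<partial>M) \<le> ennreal \<eta>" .
    moreover have "ennreal \<bar>feature_avg n w \<theta> - feature_avg n w \<theta>'\<bar> \<le> Z w"
      if \<theta>: "\<theta> \<in> \<Theta>" "\<theta>' \<in> \<Theta>" "dist \<theta> \<theta>' \<le> \<delta>" for w \<theta> \<theta>'
    proof -
      let ?d = "\<lambda>t. \<phi> (lagged_window (H n \<theta>) t (past e (int t) w)) - \<phi> (lagged_window (H n \<theta>') t (past e (int t) w))"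
      have "ennreal \<bar>feature_avg n w \<theta> - feature_avg n w \<theta>'\<bar> \<le> ennreal (1 / N) * (\<Sum>t\<in>{m+1..n}. ennreal \<bar>?d t\<bar>)"
        unfolding feature_avg_eq time_avg_diff N_def by (rule ennreal_abs_time_avg_le)
      also have "\<dots> \<le> Z w"
        unfolding Z_def
      proof (intro mult_left_mono sum_mono order_trans[OF ennreal_lipschitz_le[OF feature_lipschitz L_pos]])
        fix t and k :: 'm assume "t \<in> {m+1..n}"
        then show "ennreal (norm (lagged_window (H n \<theta>) t (past e (int t) w) $ k - lagged_window (H n \<theta>') t (past e (int t) w) $ k)) \<le> ?G t k w"
          using g[OF ok \<theta>] by (simp add: lagged_window_def past_shift)
      qed auto
      finally show ?thesis .
    qed
    ultimately show ?thesis by (intro bexI[of _ Z]) auto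
  qed
  with \<delta> show ?thesis using that by blast
qed

lemma expectation_feature_avg:
  assumes "\<theta> \<in> \<Theta>" "n > m"
  shows "integrable M (\<lambda>w. feature_avg n w \<theta>)"
    and "(\<integral>w. feature_avg n w \<theta> \<partial>M) = time_avg m n (\<lambda>t. \<integral>x. \<phi> (lagged_window (H n \<theta>) t x) \<partial>S)"
proof -
  let ?h = "\<lambda>t x. \<phi> (lagged_window (H n \<theta>) t x)"
  have meas: "?h t \<in> borel_measurable S" if "t \<in> {m+1..n}" for t
    using lagged_window_meas[of n t \<theta>] that assms by (intro measurable_compose[OF _ feature_meas]) auto
  have int: "integrable M (\<lambda>w. ?h t (past e (int t) w))" if "t \<in> {m+1..n}" for t
    using measurable_compose[OF past_measurable meas[OF that]]
    by (intro W.integrable_const_bound[where B = 1]) (auto intro!: feature_bound)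
  show "integrable M (\<lambda>w. feature_avg n w \<theta>)"
    unfolding feature_avg_eq unfolding time_avg_def
    by (intro integrable_scaleR_right Bochner_Integration.integrable_sum int)
  have "(\<integral>w. (\<Sum>t\<in>{m+1..n}. ?h t (past e (int t) w)) \<partial>M) = (\<Sum>t\<in>{m+1..n}. \<integral>w. ?h t (past e (int t) w) \<partial>M)"
    by (intro Bochner_Integration.integral_sum int)
  also have "\<dots> = (\<Sum>t\<in>{m+1..n}. \<integral>x. ?h t x \<partial>S)"
    by (intro sum.cong refl integral_past meas)
  finally show "(\<integral>w. feature_avg n w \<theta> \<partial>M) = time_avg m n (\<lambda>t. \<integral>x. ?h t x \<partial>S)"
    unfolding feature_avg_eq unfolding time_avg_def by simp
qed

text \<open>The mean of \<open>Z\<close> bounds the difference of the expected averages for every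
  \<open>n > m\<close>, and this passes to the limit. Averages and limit are served by the same
  \<open>\<delta>\<close>, so one net suffices in \<open>uniform_law\<close>.\<close>

lemma limit_equicontinuous:
  assumes "\<eta> > 0"
  obtains \<delta> where "\<delta> > 0"
    and "\<And>\<theta> \<theta>'. \<theta> \<in> \<Theta> \<Longrightarrow> \<theta>' \<in> \<Theta> \<Longrightarrow> dist \<theta> \<theta>' \<le> \<delta> \<Longrightarrow> \<bar>\<Phi> \<theta> - \<Phi> \<theta>'\<bar> \<le> \<eta>"
    and "\<And>n. n > m \<Longrightarrow> \<exists>Z\<in>borel_measurable M. (\<integral>\<^sup>+w. Z w \<partial>M) \<le> ennreal \<eta> \<and>
       (\<forall>w\<in>space M. \<forall>\<theta>\<in>\<Theta>. \<forall>\<theta>'\<in>\<Theta>. dist \<theta> \<theta>' \<le> \<delta> \<longrightarrow> ennreal \<bar>feature_avg n w \<theta> - feature_avg n w \<theta>'\<bar> \<le> Z w)"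
proof -
  obtain \<delta> where \<delta>: "\<delta> > 0" and
    Z: "\<And>n. n > m \<Longrightarrow> \<exists>Z\<in>borel_measurable M. (\<integral>\<^sup>+w. Z w \<partial>M) \<le> ennreal \<eta> \<and>
       (\<forall>w\<in>space M. \<forall>\<theta>\<in>\<Theta>. \<forall>\<theta>'\<in>\<Theta>. dist \<theta> \<theta>' \<le> \<delta> \<longrightarrow> ennreal \<bar>feature_avg n w \<theta> - feature_avg n w \<theta>'\<bar> \<le> Z w)"
    using feature_avg_equicontinuous[OF assms] by blast
  have "\<bar>\<Phi> \<theta> - \<Phi> \<theta>'\<bar> \<le> \<eta>" if \<theta>: "\<theta> \<in> \<Theta>" "\<theta>' \<in> \<Theta>" "dist \<theta> \<theta>' \<le> \<delta>" for \<theta> \<theta>'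
  proof -
    let ?a = "\<lambda>\<theta> n. time_avg m n (\<lambda>t. \<integral>x. \<phi> (lagged_window (H n \<theta>) t x) \<partial>S)"
    have "\<bar>?a \<theta> n - ?a \<theta>' n\<bar> \<le> \<eta>" if n: "n > m" for n
    proof -
      obtain Z where [measurable]: "Z \<in> borel_measurable M" and Z: "(\<integral>\<^sup>+w. Z w \<partial>M) \<le> ennreal \<eta>"
        "\<And>w. w \<in> space M \<Longrightarrow> ennreal \<bar>feature_avg n w \<theta> - feature_avg n w \<theta>'\<bar> \<le> Z w"
        using Z[OF n] \<theta> by blast
      note E = expectation_feature_avg[OF \<theta>(1) n] expectation_feature_avg[OF \<theta>(2) n]
      have eq: "?a \<theta> n - ?a \<theta>' n = (\<integral>w. feature_avg n w \<theta> - feature_avg n w \<theta>' \<partial>M)"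
        unfolding E(2,4)[symmetric] using E(1,3) by (rule Bochner_Integration.integral_diff[symmetric])
      have "ennreal \<bar>\<integral>w. feature_avg n w \<theta> - feature_avg n w \<theta>' \<partial>M\<bar>
          \<le> (\<integral>\<^sup>+w. ennreal \<bar>feature_avg n w \<theta> - feature_avg n w \<theta>'\<bar> \<partial>M)"
        using integral_norm_bound_ennreal[OF Bochner_Integration.integrable_diff[OF E(1,3)]] by simp
      also have "\<dots> \<le> (\<integral>\<^sup>+w. Z w \<partial>M)"
        by (intro nn_integral_mono Z)
      also note Z(1)
      finally have "ennreal \<bar>?a \<theta> n - ?a \<theta>' n\<bar> \<le> ennreal \<eta>"
        unfolding eq .
      then show ?thesis using assms by simp
    qed
    then have "\<forall>\<^sub>F n in sequentially. \<bar>?a \<theta> n - ?a \<theta>' n\<bar> \<le> \<eta>"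
      by (auto simp: eventually_at_top_dense)
    moreover have "(\<lambda>n. \<bar>?a \<theta> n - ?a \<theta>' n\<bar>) \<longlonglongrightarrow> \<bar>\<Phi> \<theta> - \<Phi> \<theta>'\<bar>"
      by (intro tendsto_rabs tendsto_diff mean \<theta>)
    ultimately show ?thesis
      by (intro tendsto_upperbound) auto
  qed
  with \<delta> Z show ?thesis using that by blast
qed

lemma continuous_on_limit: "continuous_on \<Theta> \<Phi>"
  unfolding continuous_on_iff
proof (intro ballI allI impI)
  fix \<theta> and \<kappa> :: real assume \<theta>: "\<theta> \<in> \<Theta>" and "\<kappa> > 0"
  then obtain \<delta> where "\<delta> > 0" and \<delta>: "\<And>\<theta> \<theta>'. \<theta> \<in> \<Theta> \<Longrightarrow> \<theta>' \<in> \<Theta> \<Longrightarrow> dist \<theta> \<theta>' \<le> \<delta> \<Longrightarrow> \<bar>\<Phi> \<theta> - \<Phi> \<theta>'\<bar> \<le> \<kappa> / 2"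
    using limit_equicontinuous[of "\<kappa> / 2"] by (metis half_gt_zero)
  have "dist (\<Phi> \<theta>') (\<Phi> \<theta>) < \<kappa>" if "\<theta>' \<in> \<Theta>" "dist \<theta>' \<theta> < \<delta>" for \<theta>'
    using \<delta>[OF that(1) \<theta>] that(2) \<open>\<kappa> > 0\<close> unfolding dist_real_def by linarith
  with \<open>\<delta> > 0\<close> show "\<exists>d>0. \<forall>\<theta>'\<in>\<Theta>. dist \<theta>' \<theta> < d \<longrightarrow> dist (\<Phi> \<theta>') (\<Phi> \<theta>) < \<kappa>"
    by blast
qed

text \<open>Every parameter is compared with a point of a finite net: the averages differ little off
  the event \<open>B\<close>, the limits by equicontinuity, and at the net point the pointwise law
  holds off the event \<open>A\<close>.\<close>

lemma uniform_law: "uniform_tendsto_in_prob M \<Theta> feature_avg \<Phi>"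
  unfolding uniform_tendsto_in_prob_def
proof (intro allI impI)
  fix \<kappa> \<rho> :: real assume pos: "\<kappa> > 0" "\<rho> > 0"
  \<comment> \<open>The first bound lets \<open>\<Phi>\<close> vary by at most
    \<open>\<kappa> / 4\<close>; the second lets Markov's inequality bound the probability of
    \<open>Z \<ge> \<kappa> / 4\<close> by \<open>\<rho> / 2\<close>.\<close>
  define \<eta> where "\<eta> = min (\<kappa> / 4) (\<rho> / 2 * (\<kappa> / 4))"
  have \<eta>: "\<eta> > 0" "\<eta> \<le> \<kappa> / 4" "\<eta> \<le> \<rho> / 2 * (\<kappa> / 4)"
    using pos by (auto simp: \<eta>_def)
  obtain \<delta> where "\<delta> > 0"
    and cont: "\<And>\<theta> \<theta>'. \<theta> \<in> \<Theta> \<Longrightarrow> \<theta>' \<in> \<Theta> \<Longrightarrow> dist \<theta> \<theta>' \<le> \<delta> \<Longrightarrow> \<bar>\<Phi> \<theta> - \<Phi> \<theta>'\<bar> \<le> \<eta>"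
    and Z: "\<And>n. n > m \<Longrightarrow> \<exists>Z\<in>borel_measurable M. (\<integral>\<^sup>+w. Z w \<partial>M) \<le> ennreal \<eta> \<and>
       (\<forall>w\<in>space M. \<forall>\<theta>\<in>\<Theta>. \<forall>\<theta>'\<in>\<Theta>. dist \<theta> \<theta>' \<le> \<delta> \<longrightarrow> ennreal \<bar>feature_avg n w \<theta> - feature_avg n w \<theta>'\<bar> \<le> Z w)"
    by (rule limit_equicontinuous[OF \<eta>(1)]) (rule that)
  obtain T where T: "T \<subseteq> \<Theta>" "finite T" "\<Theta> \<subseteq> (\<Union>\<theta>\<in>T. ball \<theta> \<delta>)"
  proof (rule compactE_image[OF compact, of \<Theta> "\<lambda>\<theta>. ball \<theta> \<delta>"])
    show "\<Theta> \<subseteq> (\<Union>\<theta>\<in>\<Theta>. ball \<theta> \<delta>)"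
      using \<open>\<delta> > 0\<close> by (meson UN_I centre_in_ball subsetI)
  qed auto
  have "\<forall>\<^sub>F n in sequentially. \<exists>A\<in>sets M. measure M A \<le> \<rho> / 2 \<and>
    (\<forall>w\<in>space M - A. \<forall>\<tau>\<in>T. \<forall>\<theta>\<in>{\<tau>}. dist (feature_avg n w \<theta>) (\<Phi> \<theta>) \<le> \<kappa> / 4)"
    using T pos by (intro uniform_tendsto_in_prob_finite_family W.prob_space_axioms pointwise_law) auto
  moreover have "\<forall>\<^sub>F n in sequentially. n > m"
    by (rule eventually_gt_at_top)
  ultimately show "\<forall>\<^sub>F n in sequentially. \<exists>A\<in>sets M. measure M A \<le> \<rho> \<and>
      (\<forall>w\<in>space M - A. \<forall>\<theta>\<in>\<Theta>. dist (feature_avg n w \<theta>) (\<Phi> \<theta>) \<le> \<kappa>)"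
  proof eventually_elim
    case (elim n)
    then obtain A where A: "A \<in> sets M" "measure M A \<le> \<rho> / 2"
      "\<And>w \<tau>. w \<in> space M - A \<Longrightarrow> \<tau> \<in> T \<Longrightarrow> dist (feature_avg n w \<tau>) (\<Phi> \<tau>) \<le> \<kappa> / 4"
      by auto
    obtain Z where [measurable]: "Z \<in> borel_measurable M" and Zint: "(\<integral>\<^sup>+w. Z w \<partial>M) \<le> ennreal \<eta>"
      and Z: "\<And>w \<theta> \<theta>'. w \<in> space M \<Longrightarrow> \<theta> \<in> \<Theta> \<Longrightarrow> \<theta>' \<in> \<Theta> \<Longrightarrow> dist \<theta> \<theta>' \<le> \<delta> \<Longrightarrow>
        ennreal \<bar>feature_avg n w \<theta> - feature_avg n w \<theta>'\<bar> \<le> Z w"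
      using Z[OF elim(2)] by blast
    \<comment> \<open>This is the event \<open>Z \<ge> \<kappa> / 4\<close>, written in the product
      form of Markov's inequality for \<open>ennreal\<close>.\<close>
    define B where "B = {w \<in> space M. 1 \<le> ennreal (4 / \<kappa>) * Z w}"
    have [measurable]: "B \<in> sets M" unfolding B_def by measurable
    have "emeasure M B \<le> ennreal (4 / \<kappa>) * (\<integral>\<^sup>+w. Z w * indicator (space M) w \<partial>M)"
      unfolding B_def by (rule nn_integral_Markov_inequality) measurable
    also have "(\<integral>\<^sup>+w. Z w * indicator (space M) w \<partial>M) = (\<integral>\<^sup>+w. Z w \<partial>M)"
      by (intro nn_integral_cong) simp
    also have "ennreal (4 / \<kappa>) * \<dots> \<le> ennreal (4 / \<kappa>) * ennreal \<eta>"
      by (intro mult_left_mono Zint) simp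
    also have "\<dots> = ennreal (4 / \<kappa> * \<eta>)"
      by (rule ennreal_mult[symmetric]) (use pos \<eta> in auto)
    also have "\<dots> \<le> ennreal (\<rho> / 2)"
      using pos \<eta>(3) by (intro ennreal_leI) (simp add: field_simps)
    finally have "measure M B \<le> \<rho> / 2"
      using pos by (simp add: W.emeasure_eq_measure)
    then have "measure M (A \<union> B) \<le> \<rho>"
      using A(2) measure_Un_le[OF A(1) \<open>B \<in> sets M\<close>] by simp
    moreover have "dist (feature_avg n w \<theta>) (\<Phi> \<theta>) \<le> \<kappa>" if w: "w \<in> space M - (A \<union> B)" and \<theta>: "\<theta> \<in> \<Theta>" for w \<theta>
    proof -
      obtain \<tau> where \<tau>: "\<tau> \<in> T" "dist \<theta> \<tau> \<le> \<delta>"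
        using T(3) \<theta> by (force simp: dist_commute)
      have "ennreal (4 / \<kappa>) * ennreal \<bar>feature_avg n w \<theta> - feature_avg n w \<tau>\<bar> \<le> ennreal (4 / \<kappa>) * Z w"
        using w \<theta> \<tau> T(1) by (intro mult_left_mono Z) auto
      also have "\<dots> < 1"
        using w by (auto simp: B_def not_le)
      finally have "ennreal (4 / \<kappa> * \<bar>feature_avg n w \<theta> - feature_avg n w \<tau>\<bar>) < ennreal 1"
        using pos by (subst ennreal_mult) auto
      then have "4 / \<kappa> * \<bar>feature_avg n w \<theta> - feature_avg n w \<tau>\<bar> < 1"
        by (rule ennreal_less_iff[THEN iffD1, rotated]) (use pos in auto)
      then have "\<bar>feature_avg n w \<theta> - feature_avg n w \<tau>\<bar> \<le> \<kappa> / 4"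
        using pos by (simp add: field_simps)
      moreover have "\<bar>feature_avg n w \<tau> - \<Phi> \<tau>\<bar> \<le> \<kappa> / 4"
        using A(3)[of w \<tau>] w \<tau> by (simp add: dist_real_def)
      moreover have "\<bar>\<Phi> \<theta> - \<Phi> \<tau>\<bar> \<le> \<kappa> / 4"
        using cont[of \<theta> \<tau>] \<theta> \<tau> T(1) \<eta>(2) by force
      ultimately show ?thesis
        using pos unfolding dist_real_def by linarith
    qed
    ultimately show ?case
      using A(1) by (intro bexI[of _ "A \<union> B"]) auto
  qed
qed

end

section \<open>Consistency\<close>

text \<open>By compactness \<open>q\<close> has norm at least some \<open>c > 0\<close> at distance
  \<open>\<epsilon>\<close> or more from \<open>\<theta>0\<close>. An estimate out there would put
  \<open>c\<close> below the sum of three quantities of at most \<open>c / 4\<close> each: the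
  uniform error at the estimate, the criterion at \<open>\<theta>0\<close>, and the slack
  \<open>R\<close>.\<close>

lemma approx_minimizer_consistent:
  fixes est :: "nat \<Rightarrow> 'w \<Rightarrow> 'b::real_normed_vector" and q :: "'b \<Rightarrow> 'c::real_normed_vector"
  assumes "prob_space M" and est: "approx_minimizer M m \<Theta> Q est"
    and unif: "uniform_tendsto_in_prob M \<Theta> Q q"
    and compact: "compact \<Theta>" and cont: "continuous_on \<Theta> q"
    and \<theta>0: "\<theta>0 \<in> \<Theta>" and q: "q \<theta>0 = 0" "\<And>\<theta>. \<theta> \<in> \<Theta> \<Longrightarrow> q \<theta> = 0 \<Longrightarrow> \<theta> = \<theta>0"
  shows "tendsto_in_prob M est \<theta>0"
  unfolding tendsto_in_prob_def
proof (intro allI impI)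
  interpret prob_space M by fact
  fix \<epsilon> :: real assume "\<epsilon> > 0"
  obtain R where R_meas [measurable]: "\<And>n. R n \<in> borel_measurable M" and R: "tendsto_in_prob M R 0"
    and est_le: "\<And>n w. n > m \<Longrightarrow> w \<in> space M \<Longrightarrow> norm (Q n w (est n w)) \<le> (INF \<theta>\<in>\<Theta>. norm (Q n w \<theta>)) + R n w"
    and est_in: "\<And>n w. n > m \<Longrightarrow> w \<in> space M \<Longrightarrow> est n w \<in> \<Theta>"
    using est unfolding approx_minimizer_def by metis
  define K where "K = \<Theta> \<inter> {\<theta>. \<epsilon> \<le> dist \<theta> \<theta>0}"
  have "closed {\<theta>. \<epsilon> \<le> dist \<theta> \<theta>0}"
    by (intro closed_Collect_le continuous_intros)
  then have "compact K"
    unfolding K_def using compact by (intro compact_Int_closed)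
  moreover have "continuous_on K (\<lambda>\<theta>. norm (q \<theta>))"
    by (intro continuous_on_norm continuous_on_subset[OF cont]) (auto simp: K_def)
  moreover have pos: "norm (q \<theta>) > 0" if "\<theta> \<in> K" for \<theta>
    using q(2)[of \<theta>] that \<open>\<epsilon> > 0\<close> by (auto simp: K_def)
  ultimately have "\<exists>c>0. \<forall>\<theta>\<in>K. c \<le> norm (q \<theta>)"
  \<comment> \<open>A minimum needs a nonempty set; for empty \<open>K\<close> any positive constant
    will do.\<close>
  proof (cases "K = {}")
    case False
    then obtain \<theta> where "\<theta> \<in> K" "\<forall>\<theta>'\<in>K. norm (q \<theta>) \<le> norm (q \<theta>')"
      using continuous_attains_inf[OF \<open>compact K\<close> False \<open>continuous_on K _\<close>] by blast
    then show ?thesis using pos by blast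
  qed (auto intro: zero_less_one)
  then obtain c where c: "c > 0" "\<And>\<theta>. \<theta> \<in> K \<Longrightarrow> c \<le> norm (q \<theta>)"
    by blast
  show "(\<lambda>n. measure M {w \<in> space M. dist (est n w) \<theta>0 > \<epsilon>}) \<longlonglongrightarrow> 0"
  proof (rule tendstoI)
    fix \<rho> :: real assume "\<rho> > 0"
    have "\<forall>\<^sub>F n in sequentially. \<exists>A\<in>sets M. measure M A \<le> \<rho> / 4 \<and>
        (\<forall>w\<in>space M - A. \<forall>\<theta>\<in>\<Theta>. dist (Q n w \<theta>) (q \<theta>) \<le> c / 4)"
      using unif[unfolded uniform_tendsto_in_prob_def, rule_format, of "c / 4" "\<rho> / 4"] c(1) \<open>\<rho> > 0\<close> by simp
    moreover have "\<forall>\<^sub>F n in sequentially. measure M {w \<in> space M. dist (R n w) 0 > c / 4} < \<rho> / 4"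
      using order_tendstoD(2)[OF R[unfolded tendsto_in_prob_def, rule_format, of "c / 4"], of "\<rho> / 4"] c(1) \<open>\<rho> > 0\<close>
      by simp
    moreover have "\<forall>\<^sub>F n in sequentially. n > m"
      by (rule eventually_gt_at_top)
    ultimately show "\<forall>\<^sub>F n in sequentially. dist (measure M {w \<in> space M. dist (est n w) \<theta>0 > \<epsilon>}) 0 < \<rho>"
    proof eventually_elim
      case (elim n)
      then obtain A where A: "A \<in> sets M" "measure M A \<le> \<rho> / 4"
        "\<And>w \<theta>. w \<in> space M - A \<Longrightarrow> \<theta> \<in> \<Theta> \<Longrightarrow> dist (Q n w \<theta>) (q \<theta>) \<le> c / 4"
        by auto
      let ?B = "{w \<in> space M. dist (R n w) 0 > c / 4}"
      have B: "?B \<in> sets M" by measurable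
      have "{w \<in> space M. dist (est n w) \<theta>0 > \<epsilon>} \<subseteq> A \<union> ?B"
      proof (rule ccontr)
        assume "\<not> ?thesis"
        then obtain w where "w \<in> {w \<in> space M. dist (est n w) \<theta>0 > \<epsilon>}" "w \<notin> A \<union> ?B"
          by blast
        then have w: "w \<in> space M" "w \<notin> A" "dist (R n w) 0 \<le> c / 4" "dist (est n w) \<theta>0 > \<epsilon>"
          by auto
        have in\<Theta>: "est n w \<in> \<Theta>" using est_in elim(3) w(1) .
        have "c \<le> norm (q (est n w))"
          using in\<Theta> w(4) by (intro c) (auto simp: K_def)
        also have "\<dots> \<le> norm (Q n w (est n w)) + c / 4"
          using A(3)[of w "est n w"] in\<Theta> w norm_triangle_ineq3[of "q (est n w)" "Q n w (est n w)"]
          by (simp add: dist_norm norm_minus_commute)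
        also have "norm (Q n w (est n w)) \<le> (INF \<theta>\<in>\<Theta>. norm (Q n w \<theta>)) + R n w"
          using est_le elim(3) w(1) .
        also have "(INF \<theta>\<in>\<Theta>. norm (Q n w \<theta>)) \<le> norm (Q n w \<theta>0)"
          by (intro cINF_lower \<theta>0) (auto intro!: bdd_belowI[of _ 0])
        also have "norm (Q n w \<theta>0) \<le> c / 4"
          using A(3)[of w \<theta>0] \<theta>0 w q(1) by (simp add: dist_norm)
        also have "R n w \<le> c / 4"
          using w(3) by (simp add: dist_real_def)
        finally show False using c(1) by simp
      qed
      then have "measure M {w \<in> space M. dist (est n w) \<theta>0 > \<epsilon>} \<le> measure M (A \<union> ?B)"
        using A(1) B by (intro finite_measure_mono) auto
      also have "\<dots> \<le> measure M A + measure M ?B"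
        using A(1) B by (rule measure_Un_le)
      also have "\<dots> < \<rho>"
        using A(2) elim(2) \<open>\<rho> > 0\<close> by simp
      finally show ?case by simp
    qed
  qed
qed

section \<open>From the noise array to iid sequences\<close>

lemma iid_noise_distr_seq:
  fixes f :: "nat \<Rightarrow> noise_source \<times> int"
  assumes noise: "iid_noise M s \<epsilon>" and f: "inj f" "range f \<subseteq> noise_sources s \<times> UNIV"
  defines "\<mu> \<equiv> distr M borel (\<epsilon> Base 0)"
  shows "(\<lambda>w l. case_prod \<epsilon> (f l) w) \<in> measurable M (PiM UNIV (\<lambda>_. \<mu>))" (is "?X \<in> _")
    and "distr M (PiM UNIV (\<lambda>_. \<mu>)) (\<lambda>w l. case_prod \<epsilon> (f l) w) = PiM UNIV (\<lambda>_. \<mu>)"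
proof -
  interpret prob_space M using noise by (simp add: iid_noise_def)
  let ?S = "PiM (UNIV :: nat set) (\<lambda>_. \<mu>)" and ?K = "range f"
  have indep: "indep_vars (\<lambda>_. borel) (case_prod \<epsilon>) ?K"
    using noise f(2) unfolding iid_noise_def by (auto intro: indep_vars_subset)
  then have meas: "case_prod \<epsilon> k \<in> borel_measurable M" if "k \<in> ?K" for k
    using that by (auto simp: indep_vars_def)
  have distr: "distr M borel (case_prod \<epsilon> k) = \<mu>" if "k \<in> ?K" for k
    using noise that f(2) unfolding iid_noise_def \<mu>_def by (cases k) auto
  have [measurable_cong]: "sets \<mu> = sets borel" by (simp add: \<mu>_def)
  have \<mu>: "prob_space \<mu>"
    using distr[of "f 0"] meas[of "f 0"] by (metis prob_space_distr rangeI)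
  have X: "?X \<in> measurable M (PiM UNIV (\<lambda>_. borel))"
    by (rule measurable_PiM_single') (auto intro: meas)
  have sets_eq: "sets ?S = sets (PiM UNIV (\<lambda>_. borel))"
    by (rule sets_PiM_cong) (simp_all add: \<mu>_def)
  show X': "?X \<in> measurable M ?S"
    using X by (subst measurable_cong_sets[OF refl sets_eq])
  have K: "distr M (PiM ?K (\<lambda>_. borel)) (\<lambda>w. \<lambda>k\<in>?K. case_prod \<epsilon> k w) = PiM ?K (\<lambda>_. \<mu>)"
  proof -
    have "distr M (PiM ?K (\<lambda>_. borel)) (\<lambda>w. \<lambda>k\<in>?K. case_prod \<epsilon> k w) = PiM ?K (\<lambda>k. distr M borel (case_prod \<epsilon> k))"
      using indep by (subst indep_vars_iff_distr_eq_PiM'[symmetric]) (blast, rule meas, simp_all)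
    also have "\<dots> = PiM ?K (\<lambda>_. \<mu>)"
      by (intro PiM_cong refl distr)
    finally show ?thesis .
  qed
  \<comment> \<open>Injectivity of \<open>f\<close> means that no variable is read twice, so
    reindexing the product over \<open>range f\<close> gives the product over the naturals.\<close>
  have "?S = distr (PiM ?K (\<lambda>_. \<mu>)) ?S (\<lambda>\<omega>. \<lambda>n\<in>UNIV. \<omega> (f n))"
    using \<mu> f(1) by (subst distr_PiM_reindex[of ?K "\<lambda>_. \<mu>" f UNIV]) auto
  also have "\<dots> = distr M ?S ((\<lambda>\<omega>. \<lambda>n\<in>UNIV. \<omega> (f n)) \<circ> (\<lambda>w. \<lambda>k\<in>?K. case_prod \<epsilon> k w))"
    unfolding K[symmetric]
  proof (rule distr_distr)
    have [measurable]: "(\<lambda>\<omega>. \<omega> (f n)) \<in> borel_measurable (PiM ?K (\<lambda>_. borel))" for n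
      by (rule measurable_component_singleton) auto
    show "(\<lambda>\<omega>. \<lambda>n\<in>UNIV. \<omega> (f n)) \<in> measurable (PiM ?K (\<lambda>_. borel)) ?S"
      by (subst measurable_cong_sets[OF refl sets_eq], rule measurable_PiM_single') auto
    show "(\<lambda>w. \<lambda>k\<in>?K. case_prod \<epsilon> k w) \<in> measurable M (PiM ?K (\<lambda>_. borel))"
      by (rule measurable_restrict) (rule meas)
  qed
  also have "(\<lambda>\<omega>. \<lambda>n\<in>UNIV. \<omega> (f n)) \<circ> (\<lambda>w. \<lambda>k\<in>?K. case_prod \<epsilon> k w) = ?X"
    by (auto simp: fun_eq_iff)
  finally show "distr M ?S ?X = ?S" ..
qed

text \<open>A past reads the array along \<open>\<lambda>l. (c, t - int l)\<close>, which is
  injective, so \<open>iid_noise_distr_seq\<close> gives its law.\<close>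

lemma iid_noise_iid_past:
  assumes noise: "iid_noise M s \<epsilon>" and c: "c \<in> noise_sources s"
  shows "iid_past M (distr M borel (\<epsilon> Base 0)) (\<epsilon> c)"
proof -
  let ?\<mu> = "distr M borel (\<epsilon> Base 0)"
  have M: "prob_space M" using noise by (simp add: iid_noise_def)
  interpret M: prob_space M by fact
  have "M.indep_vars (\<lambda>_. borel) (\<lambda>(c, i). \<epsilon> c i) (noise_sources s \<times> UNIV)"
    using noise by (simp add: iid_noise_def)
  moreover have "(Base, 0) \<in> noise_sources s \<times> UNIV"
    by (simp add: noise_sources_def)
  ultimately have "\<epsilon> Base 0 \<in> borel_measurable M"
    unfolding M.indep_vars_def by fastforce
  then have \<mu>: "prob_space ?\<mu>" by (rule M.prob_space_distr)
  interpret \<mu>: prob_space ?\<mu> by fact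
  have inj: "inj (\<lambda>l. (c, t - int l))" for t by (auto simp: inj_on_def)
  have range: "range (\<lambda>l. (c, t - int l)) \<subseteq> noise_sources s \<times> UNIV" for t
    using c by auto
  show ?thesis
  proof (intro iid_past.intro M iid_past_axioms.intro)
    show "sequence_space ?\<mu>"
      unfolding sequence_space_def product_prob_space_def product_prob_space_axioms_def product_sigma_finite_def
      using \<mu> \<mu>.sigma_finite_measure_axioms by simp
    show "past (\<epsilon> c) t \<in> measurable M (PiM UNIV (\<lambda>_. ?\<mu>))" for t
      using iid_noise_distr_seq(1)[OF noise inj range, of t] by (simp add: past_def[abs_def])
    show "distr M (PiM UNIV (\<lambda>_. ?\<mu>)) (past (\<epsilon> c) t) = PiM UNIV (\<lambda>_. ?\<mu>)" for t
      using iid_noise_distr_seq(2)[OF noise inj range, of t] by (simp add: past_def[abs_def])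
  qed simp
qed

lemma past_replaced_measurable:
  assumes noise: "iid_noise M s \<epsilon>"
  shows "past_replaced (\<epsilon> Base) (\<epsilon> Star) t j \<in> measurable M R_inf"
proof -
  interpret prob_space M using noise by (simp add: iid_noise_def)
  have "\<epsilon> c i \<in> borel_measurable M" if "c \<in> {Base, Star}" for c i
  proof -
    have "indep_vars (\<lambda>_. borel) (\<lambda>(c, i). \<epsilon> c i) (noise_sources s \<times> UNIV)"
      using noise by (simp add: iid_noise_def)
    moreover have "(c, i) \<in> noise_sources s \<times> UNIV"
      using that by (auto simp: noise_sources_def)
    ultimately show ?thesis unfolding indep_vars_def by fastforce
  qed
  then show ?thesis
    unfolding past_replaced_def[abs_def] by (intro measurable_PiM_single') auto
qed

text \<open>The replacement input and the original past form one iid sequence together, with the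
  replacement in front. Splitting off its first coordinate turns expressions in
  \<open>past_replaced\<close>, as in (A7), into an integral over a fresh coordinate, as in
  \<open>coord_osc\<close>.\<close>

lemma nn_integral_past_replaced:
  fixes F :: "(nat \<Rightarrow> real) \<Rightarrow> (nat \<Rightarrow> real) \<Rightarrow> ennreal"
  assumes noise: "iid_noise M s \<epsilon>"
    and F [measurable]: "case_prod F \<in> borel_measurable (R_inf \<Otimes>\<^sub>M R_inf)"
  defines "\<mu> \<equiv> distr M borel (\<epsilon> Base 0)"
  shows "(\<integral>\<^sup>+x. \<integral>\<^sup>+y. F x (x(j := y)) \<partial>\<mu> \<partial>PiM UNIV (\<lambda>_. \<mu>))
    = (\<integral>\<^sup>+w. F (past (\<epsilon> Base) 0 w) (past_replaced (\<epsilon> Base) (\<epsilon> Star) 0 j w) \<partial>M)"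
proof -
  have "Base \<in> noise_sources s" "Star \<in> noise_sources s"
    by (simp_all add: noise_sources_def)
  interpret iid_past M \<mu> "\<epsilon> Base"
    unfolding \<mu>_def by (rule iid_noise_iid_past[OF noise \<open>Base \<in> _\<close>])
  interpret pair_sigma_finite \<mu> S ..
  \<comment> \<open>Coordinate 0 is the replacement at time \<open>- j\<close>; coordinate
    \<open>l + 1\<close> is the original input at time \<open>- l\<close>.\<close>
  let ?f = "case_nat (Star, - int j) (\<lambda>l. (Base, - int l))"
  have f: "inj ?f" "range ?f \<subseteq> noise_sources s \<times> UNIV"
    using \<open>Base \<in> _\<close> \<open>Star \<in> _\<close> by (auto simp: inj_on_def split: nat.splits)
  define X where "X w l = case_prod \<epsilon> (?f l) w" for w l
  have X [measurable]: "X \<in> measurable M S" "distr M S X = S"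
    using iid_noise_distr_seq[OF noise f] unfolding X_def[abs_def] \<mu>_def by auto
  let ?T = "\<lambda>v l. v (Suc l)"
  have [measurable]: "?T \<in> measurable S S"
    using shift_measurable[of 1] by simp
  have F' [measurable (raw)]: "(\<lambda>p. F (a p) (b p)) \<in> borel_measurable N"
    if "a \<in> measurable N S" "b \<in> measurable N S" for a b and N :: "'z measure"
  proof -
    have "sets S = sets R_inf" by (rule sets_PiM_cong) (auto simp: sets_noise)
    then have "(\<lambda>p. (a p, b p)) \<in> measurable N (R_inf \<Otimes>\<^sub>M R_inf)"
      using that by (intro measurable_Pair) (simp_all cong: measurable_cong_sets)
    from measurable_compose[OF this F] show ?thesis by simp
  qed
  have meas: "(\<lambda>v. F (?T v) ((?T v)(j := v 0))) \<in> borel_measurable S"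
    by measurable
  have "(\<integral>\<^sup>+w. F (past (\<epsilon> Base) 0 w) (past_replaced (\<epsilon> Base) (\<epsilon> Star) 0 j w) \<partial>M)
      = (\<integral>\<^sup>+w. F (?T (X w)) ((?T (X w))(j := X w 0)) \<partial>M)"
    by (intro nn_integral_cong arg_cong2[of _ _ _ _ F])
      (auto simp: X_def past_def past_replaced_def fun_eq_iff)
  also have "\<dots> = (\<integral>\<^sup>+v. F (?T v) ((?T v)(j := v 0)) \<partial>S)"
    using nn_integral_distr[OF X(1), of "\<lambda>v. F (?T v) ((?T v)(j := v 0))"] meas X(2) by simp
  also have "\<dots> = (\<integral>\<^sup>+y. \<integral>\<^sup>+x. F x (x(j := y)) \<partial>S \<partial>\<mu>)"
    using nn_integral_case_nat[OF meas] by simp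
  also have "\<dots> = (\<integral>\<^sup>+x. \<integral>\<^sup>+y. F x (x(j := y)) \<partial>\<mu> \<partial>S)"
    by (rule Fubini'[symmetric]) measurable
  finally show ?thesis ..
qed

text \<open>The crude factor 2 comes from \<open>x \<le> l + x powr q * l powr (1 - q)\<close> with \<open>l\<close> the
  \<open>q\<close>-norm; it spares an appeal to Hoelder's inequality.\<close>

lemma nn_integral_norm_le_Lq_norm:
  fixes X :: "'w \<Rightarrow> 'a::{real_normed_vector,second_countable_topology}"
  assumes "prob_space M" and [measurable]: "X \<in> borel_measurable M" and q: "q > 1"
  shows "(\<integral>\<^sup>+w. ennreal (norm (X w)) \<partial>M) \<le> 2 * Lq_norm M q X"
proof -
  interpret prob_space M by fact
  define I where "I = (\<integral>\<^sup>+w. ennreal (norm (X w) powr q) \<partial>M)"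
  show ?thesis
  proof (cases "I = \<infinity>")
    case True
    then show ?thesis by (simp add: Lq_norm_def I_def[symmetric] ennreal_mult_top)
  next
    case False
    then obtain r where r: "r \<ge> 0" "I = ennreal r" by (cases I) auto
    \<comment> \<open>\<open>l\<close> stays free and positive here, because the norm itself may be
      0.\<close>
    have bound: "(\<integral>\<^sup>+w. ennreal (norm (X w)) \<partial>M) \<le> ennreal (l + l powr (1 - q) * r)" if l: "l > 0" for l
    proof -
      have "norm (X w) \<le> l + l powr (1 - q) * norm (X w) powr q" for w
      proof (cases "norm (X w) \<le> l")
        case False
        then have x: "norm (X w) > 0" "l \<le> norm (X w)" using l by linarith+
        \<comment> \<open>The exponent \<open>1 - q\<close> is negative, so the larger base
          \<open>norm (X w)\<close> has the smaller power.\<close>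
        have "norm (X w) = norm (X w) powr (1 - q) * norm (X w) powr q"
          using x by (simp add: powr_add[symmetric])
        also have "\<dots> \<le> l powr (1 - q) * norm (X w) powr q"
          using l x q by (intro mult_right_mono powr_mono2') auto
        finally show ?thesis using l by linarith
      qed (use l in \<open>auto intro: add_increasing2\<close>)
      then have "(\<integral>\<^sup>+w. ennreal (norm (X w)) \<partial>M)
          \<le> (\<integral>\<^sup>+w. ennreal l + ennreal (l powr (1 - q)) * ennreal (norm (X w) powr q) \<partial>M)"
        using l by (intro nn_integral_mono) (auto simp: ennreal_mult[symmetric] ennreal_plus[symmetric] intro!: ennreal_leI simp del: ennreal_plus)
      also have "\<dots> = ennreal l + ennreal (l powr (1 - q)) * I"
        by (simp add: nn_integral_add nn_integral_cmult I_def emeasure_space_1)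
      also have "\<dots> = ennreal (l + l powr (1 - q) * r)"
        using l r by (simp add: ennreal_mult)
      finally show ?thesis .
    qed
    have L: "Lq_norm M q X = ennreal (r powr (1 / q))"
      using r by (simp add: Lq_norm_def I_def[symmetric])
    show ?thesis
    proof (cases "r = 0")
      \<comment> \<open>With norm 0 the choice of \<open>l\<close> made in the other case is not
        positive; arbitrarily small \<open>l\<close> are used instead.\<close>
      case True
      have "(\<integral>\<^sup>+w. ennreal (norm (X w)) \<partial>M) \<le> 0 + ennreal l" if "l > 0" for l
        using bound[OF that] True by simp
      then have "(\<integral>\<^sup>+w. ennreal (norm (X w)) \<partial>M) \<le> 0"
        by (rule ennreal_le_epsilon)
      then show ?thesis by simp
    next
      case False
      then have r0: "r > 0" using r by simp
      \<comment> \<open>For \<open>l\<close> equal to the norm the two summands of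
        \<open>bound\<close> coincide, which produces the factor 2.\<close>
      let ?l = "r powr (1 / q)"
      have "?l powr (1 - q) * r = ?l powr (1 - q) * ?l powr q"
        using r0 q by (simp add: powr_powr)
      also have "\<dots> = ?l"
        using r0 by (simp add: powr_add[symmetric])
      finally have "(\<integral>\<^sup>+w. ennreal (norm (X w)) \<partial>M) \<le> ennreal (2 * ?l)"
        using bound[of ?l] r0 by simp
      then show ?thesis
        by (simp add: L ennreal_mult)
    qed
  qed
qed

text \<open>The averaged law is a mixture: draw \<open>t\<close> uniformly from
  \<open>{m+1..n}\<close>, then a point from \<open>P t\<close>. Integration against it is therefore
  iterated.\<close>

lemma integral_average_law:
  fixes f :: "'a::topological_space \<Rightarrow> real"
  assumes P: "\<And>t. t \<in> {m+1..n} \<Longrightarrow> prob_space (P t) \<and> sets (P t) = sets borel"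
    and n: "n > m" and f [measurable]: "f \<in> borel_measurable borel" and B: "\<And>x. \<bar>f x\<bar> \<le> B"
  shows "(\<integral>x. f x \<partial>average_law m n P) = time_avg m n (\<lambda>t. \<integral>x. f x \<partial>P t)"
proof -
  let ?A = "{m+1..n}"
  have A: "?A \<noteq> {}" "finite ?A" using n by auto
  \<comment> \<open>The kernel has to consist of probability measures at every index, also outside
    the support of the uniform law.\<close>
  define P' where "P' t = (if t \<in> ?A then P t else P n)" for t
  have P': "prob_space (P' t)" "sets (P' t) = sets borel" for t
    using P n by (auto simp: P'_def)
  have kernel: "P' \<in> measurable (measure_pmf (pmf_of_set ?A)) (subprob_algebra borel)"
    using P' by (auto simp: space_subprob_algebra prob_space_imp_subprob_space)
  have eq: "average_law m n P = measure_pmf (pmf_of_set ?A) \<bind> P'"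
  proof (rule measure_eqI)
    show sets: "sets (average_law m n P) = sets (measure_pmf (pmf_of_set ?A) \<bind> P')"
      by (subst sets_bind[where N = borel]) (auto simp: P' sets_average_law)
    fix X assume "X \<in> sets (average_law m n P)"
    then have X: "X \<in> sets borel" by (simp add: sets_average_law)
    have "emeasure (measure_pmf (pmf_of_set ?A) \<bind> P') X = (\<Sum>t\<in>?A. emeasure (P' t) X) / of_nat (n - m)"
      using X A by (subst emeasure_bind[OF _ kernel]) (auto simp: nn_integral_pmf_of_set ennreal_of_nat_eq_real_of_nat)
    also have "(\<Sum>t\<in>?A. emeasure (P' t) X) = (\<Sum>t\<in>?A. emeasure (P t) X)"
      by (intro sum.cong) (auto simp: P'_def)
    finally show "emeasure (average_law m n P) X = emeasure (measure_pmf (pmf_of_set ?A) \<bind> P') X"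
      using P X by (subst emeasure_average_law) auto
  qed
  have "(\<integral>x. f x \<partial>average_law m n P) = (\<integral>t. \<integral>x. f x \<partial>P' t \<partial>measure_pmf (pmf_of_set ?A))"
    unfolding eq
    by (rule integral_bind[OF f _ kernel, where B = B and B' = 1])
      (auto simp: B P' prob_space.emeasure_space_1 intro!: measure_pmf.finite_measure_axioms)
  also have "\<dots> = (\<Sum>t\<in>?A. \<integral>x. f x \<partial>P' t) / card ?A"
    by (rule integral_pmf_of_set[OF A])
  also have "(\<Sum>t\<in>?A. \<integral>x. f x \<partial>P' t) = (\<Sum>t\<in>?A. \<integral>x. f x \<partial>P t)"
    by (intro sum.cong) (auto simp: P'_def)
  finally show ?thesis by (simp add: time_avg_def divide_inverse mult.commute)
qed

text \<open>Lipschitz features turn closeness of \<open>H n\<close> and \<open>H'\<close> on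
  average, as given by (A2), into closeness of the mean features. Each of the
  \<open>CARD('m)\<close> rows contributes a shifted copy of the same sum of distances.\<close>

lemma (in iid_past) mean_transfer:
  fixes H :: "nat \<Rightarrow> nat \<Rightarrow> (nat \<Rightarrow> real) \<Rightarrow> real^'d" and \<phi> :: "real^'d^'m::{finite,linorder} \<Rightarrow> real"
  assumes m: "CARD('m) = m + 1"
    and H_meas: "\<And>n t. n \<ge> 1 \<Longrightarrow> t \<ge> 1 \<Longrightarrow> H n t \<in> borel_measurable S"
    and H'_meas: "\<And>t. t \<ge> 1 \<Longrightarrow> H' t \<in> borel_measurable S"
    and \<phi> [measurable]: "\<phi> \<in> borel_measurable borel" and bound: "\<And>x. \<bar>\<phi> x\<bar> \<le> 1"
    and lipschitz: "\<And>x y. \<bar>\<phi> x - \<phi> y\<bar> \<le> L * (\<Sum>k\<in>UNIV. norm (x $ k - y $ k))" and L: "L > 0"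
    and u: "\<And>n. n \<ge> 1 \<Longrightarrow> (\<Sum>t\<in>{1..n}. \<integral>\<^sup>+x. ennreal (norm (H n t x - H' t x)) \<partial>S) / of_nat n \<le> u n"
      "u \<longlonglongrightarrow> 0"
    and lim: "(\<lambda>n. time_avg m n (\<lambda>t. \<integral>x. \<phi> (lagged_window H' t x) \<partial>S)) \<longlonglongrightarrow> p"
  shows "(\<lambda>n. time_avg m n (\<lambda>t. \<integral>x. \<phi> (lagged_window (H n) t x) \<partial>S)) \<longlonglongrightarrow> p"
proof -
  let ?a = "\<lambda>n. time_avg m n (\<lambda>t. \<integral>x. \<phi> (lagged_window (H n) t x) \<partial>S)"
  let ?b = "\<lambda>n. time_avg m n (\<lambda>t. \<integral>x. \<phi> (lagged_window H' t x) \<partial>S)"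
  let ?K = "2 * L * CARD('m)"
  \<comment> \<open>For \<open>n > 2 * m\<close> the weights \<open>1 / (n - m)\<close> and
    \<open>1 / n\<close> differ by at most a factor 2, which is the 2 in \<open>?K\<close>.\<close>
  have le: "ennreal \<bar>?a n - ?b n\<bar> \<le> ennreal ?K * u n" if n: "n > 2 * m" for n
  proof -
    define D where "D t = (\<integral>\<^sup>+x. ennreal (norm (H n t x - H' t x)) \<partial>S)" for t
    have lag: "lag (k :: 'm) \<le> m" for k
      using lag_less_card[of k] m by simp
    have step: "ennreal \<bar>(\<integral>x. \<phi> (lagged_window (H n) t x) \<partial>S) - (\<integral>x. \<phi> (lagged_window H' t x) \<partial>S)\<bar>
        \<le> (\<Sum>k\<in>(UNIV :: 'm set). ennreal L * D (t - lag k))" if t: "t \<in> {m+1..n}" for t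
    proof -
      have [measurable]: "H n (t - lag (k :: 'm)) \<in> borel_measurable S" "H' (t - lag k) \<in> borel_measurable S" for k
        using t lag[of k] by (auto intro!: H_meas H'_meas)
      have [measurable]: "(lagged_window (H n) t :: _ \<Rightarrow> real^'d^('m::{finite,linorder})) \<in> borel_measurable S"
        "(lagged_window H' t :: _ \<Rightarrow> real^'d^('m::{finite,linorder})) \<in> borel_measurable S"
        unfolding lagged_window_def by measurable
      have int: "integrable S (\<lambda>x. \<phi> (lagged_window (H n) t x))" "integrable S (\<lambda>x. \<phi> (lagged_window H' t x))"
        by (rule abs_expectation_le(1)[OF _ bound]; measurable)+
      have "ennreal \<bar>(\<integral>x. \<phi> (lagged_window (H n) t x) \<partial>S) - (\<integral>x. \<phi> (lagged_window H' t x) \<partial>S)\<bar>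
         \<le> (\<integral>\<^sup>+x. ennreal \<bar>\<phi> (lagged_window (H n) t x) - \<phi> (lagged_window H' t x)\<bar> \<partial>S)"
        using integral_norm_bound_ennreal[OF Bochner_Integration.integrable_diff[OF int]] int by simp
      also have "\<dots> \<le> (\<integral>\<^sup>+x. (\<Sum>k\<in>(UNIV :: 'm set). ennreal L *
          ennreal (norm (H n (t - lag k) (\<lambda>l. x (l + lag k)) - H' (t - lag k) (\<lambda>l. x (l + lag k))))) \<partial>S)"
        by (intro nn_integral_mono order_trans[OF ennreal_lipschitz_le[OF lipschitz L]])
          (simp add: lagged_window_def)
      also have "\<dots> = (\<Sum>k\<in>(UNIV :: 'm set). ennreal L *
          (\<integral>\<^sup>+x. ennreal (norm (H n (t - lag k) (\<lambda>l. x (l + lag k)) - H' (t - lag k) (\<lambda>l. x (l + lag k)))) \<partial>S))"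
        by (simp add: nn_integral_sum nn_integral_cmult)
      also have "\<dots> = (\<Sum>k\<in>(UNIV :: 'm set). ennreal L * D (t - lag k))"
        unfolding D_def by (intro sum.cong refl arg_cong[where f = "(*) _"] nn_integral_shift) measurable
      finally show ?thesis .
    qed
    define T where "T = (\<Sum>t\<in>{1..n}. D t)"
    have T: "T \<le> u n * of_nat n"
    proof -
      have "T = T / of_nat n * of_nat n"
        using n by (simp add: ennreal_divide_times ennreal_divide_self of_nat_less_top)
      also have "\<dots> \<le> u n * of_nat n"
        using u(1)[of n] n by (intro mult_right_mono) (auto simp: T_def D_def)
      finally show ?thesis .
    qed
    have "ennreal \<bar>?a n - ?b n\<bar> \<le> ennreal (1 / real (n - m)) * (\<Sum>t\<in>{m+1..n}. \<Sum>k\<in>(UNIV :: 'm set). ennreal L * D (t - lag k))"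
      unfolding time_avg_diff by (intro order_trans[OF ennreal_abs_time_avg_le] mult_left_mono sum_mono step) auto
    also have "(\<Sum>t\<in>{m+1..n}. \<Sum>k\<in>(UNIV :: 'm set). ennreal L * D (t - lag k))
        = (\<Sum>k\<in>(UNIV :: 'm set). ennreal L * (\<Sum>t\<in>{m+1..n}. D (t - lag k)))"
      by (subst sum.swap) (simp add: sum_distrib_left)
    also have "ennreal (1 / real (n - m)) * \<dots> \<le> ennreal (1 / real (n - m)) * (\<Sum>k\<in>(UNIV :: 'm set). ennreal L * T)"
    proof (intro mult_left_mono sum_mono)
      fix k :: 'm
      \<comment> \<open>Since \<open>lag k \<le> m\<close>, the shifted times stay between 1 and
        \<open>n\<close>, the range of the sum \<open>T\<close>.\<close>
      have "(\<Sum>t\<in>{m+1..n}. D (t - lag k)) = sum D ((\<lambda>t. t - lag k) ` {m+1..n})"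
        using lag[of k] by (subst sum.reindex) (auto simp: inj_on_def)
      also have "\<dots> \<le> T"
        unfolding T_def using lag[of k] by (intro sum_mono2) auto
      finally show "(\<Sum>t\<in>{m+1..n}. D (t - lag k)) \<le> T" .
    qed auto
    also have "\<dots> \<le> ennreal (1 / real (n - m)) * (\<Sum>k\<in>(UNIV :: 'm set). ennreal L * (u n * of_nat n))"
      by (intro mult_left_mono sum_mono T) auto
    also have "\<dots> = ennreal (1 / real (n - m) * (CARD('m) * (L * n))) * u n"
    proof -
      have "ennreal (1 / real (n - m) * (CARD('m) * (L * n)))
          = ennreal (1 / real (n - m)) * (ennreal CARD('m) * (ennreal L * ennreal n))"
        using L by (simp only: ennreal_mult zero_le_divide_1_iff of_nat_0_le_iff mult_nonneg_nonneg less_imp_le)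
      then show ?thesis
        by (simp add: ennreal_of_nat_eq_real_of_nat mult_ac)
    qed
    also have "\<dots> \<le> ennreal ?K * u n"
    proof (intro mult_right_mono ennreal_leI)
      have "real n \<le> 2 * real (n - m)" using n by simp
      then have "real CARD('m) * L * real n \<le> real CARD('m) * L * (2 * real (n - m))"
        using L by (intro mult_left_mono) auto
      then show "1 / real (n - m) * (real CARD('m) * (L * real n)) \<le> ?K"
        using n by (simp add: divide_le_eq mult_ac)
    qed auto
    finally show ?thesis .
  qed
  have upper: "(\<lambda>n. ennreal ?K * u n) \<longlonglongrightarrow> 0"
    using ennreal_tendsto_cmult[OF ennreal_less_top u(2), of ?K] by simp
  have "(\<lambda>n. ennreal \<bar>?a n - ?b n\<bar>) \<longlonglongrightarrow> 0"
  proof (rule tendsto_sandwich[OF _ _ tendsto_const upper])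
    show "\<forall>\<^sub>F n in sequentially. ennreal \<bar>?a n - ?b n\<bar> \<le> ennreal ?K * u n"
      by (rule eventually_mono[OF eventually_gt_at_top[of "2 * m"]]) (rule le)
  qed simp
  then have "(\<lambda>n. ennreal \<bar>?a n - ?b n\<bar>) \<longlonglongrightarrow> ennreal 0"
    by simp
  then have "(\<lambda>n. \<bar>?a n - ?b n\<bar>) \<longlonglongrightarrow> 0"
    by (rule tendsto_ennrealD) auto
  then have "(\<lambda>n. ?a n - ?b n) \<longlonglongrightarrow> 0"
    by (simp add: tendsto_rabs_zero_iff)
  from tendsto_add[OF this lim] show ?thesis by simp
qed

section \<open>Random Fourier features and averages of vectors\<close>

lemma abs_cos_diff_le: "\<bar>cos x - cos y\<bar> \<le> \<bar>x - y :: real\<bar>"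
proof -
  have "\<bar>cos x - cos y\<bar> = 2 * (\<bar>sin ((x + y) / 2)\<bar> * \<bar>sin ((y - x) / 2)\<bar>)"
    by (simp add: cos_diff_cos abs_mult)
  also have "\<dots> \<le> 2 * (1 * \<bar>(y - x) / 2\<bar>)"
    by (intro mult_left_mono mult_mono abs_sin_le_one abs_sin_x_le_abs_x) auto
  finally show ?thesis by simp
qed

text \<open>The constant is deliberately coarse: the sum over all frequencies serves every feature
  at once, and the added 1 keeps it positive.\<close>

lemma rff_lipschitz:
  fixes Om :: "real^'d^'m^'k"
  shows "\<bar>rff Om al x $ i - rff Om al y $ i\<bar>
    \<le> (1 + (\<Sum>i\<in>UNIV. \<Sum>j\<in>UNIV. norm (Om $ i $ j))) * (\<Sum>j\<in>UNIV. norm (x $ j - y $ j))"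
proof -
  let ?L = "1 + (\<Sum>i\<in>UNIV. \<Sum>j\<in>UNIV. norm (Om $ i $ j))"
  have L: "norm (Om $ i $ j) \<le> ?L" for j
  proof -
    have "norm (Om $ i $ j) \<le> (\<Sum>j\<in>UNIV. norm (Om $ i $ j))"
      by (intro member_le_sum) auto
    also have "\<dots> \<le> (\<Sum>i\<in>UNIV. \<Sum>j\<in>UNIV. norm (Om $ i $ j))"
      by (intro member_le_sum[of i UNIV "\<lambda>i. \<Sum>j\<in>UNIV. norm (Om $ i $ j)"]) (auto intro: sum_nonneg)
    finally show ?thesis by simp
  qed
  have "\<bar>rff Om al x $ i - rff Om al y $ i\<bar> \<le> \<bar>\<Sum>j\<in>UNIV. Om $ i $ j \<bullet> (x $ j - y $ j)\<bar>"
    using abs_cos_diff_le[of "(\<Sum>j\<in>UNIV. Om $ i $ j \<bullet> x $ j) + al $ i" "(\<Sum>j\<in>UNIV. Om $ i $ j \<bullet> y $ j) + al $ i"]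
    by (simp add: rff_def inner_diff_right sum_subtractf)
  also have "\<dots> \<le> (\<Sum>j\<in>UNIV. ?L * norm (x $ j - y $ j))"
    by (intro order_trans[OF sum_abs] sum_mono order_trans[OF Cauchy_Schwarz_ineq2] mult_right_mono L) auto
  finally show ?thesis by (simp add: sum_distrib_left)
qed

lemma continuous_on_rff: "continuous_on A (rff Om al)"
  unfolding rff_def by (intro continuous_intros)

lemma norm_le_card_times:
  fixes x :: "real^'k" and b :: real
  assumes "\<And>i. \<bar>x $ i\<bar> \<le> b"
  shows "norm x \<le> real CARD('k) * b"
  using order_trans[OF norm_le_l1_cart sum_mono[of UNIV "\<lambda>i. \<bar>x $ i\<bar>" "\<lambda>_. b"]] assms by simp

lemma time_avg_vec_nth: "time_avg m n f $ i = time_avg m n (\<lambda>t. f t $ i)"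
  by (simp add: time_avg_def sum_component)

lemma time_avg_scaleR_sum:
  "time_avg m n (\<lambda>t. a *\<^sub>R (\<Sum>r\<in>I. f r t)) = a *\<^sub>R (\<Sum>r\<in>I. time_avg m n (f r))"
proof -
  have "(\<Sum>t\<in>{m+1..n}. \<Sum>r\<in>I. f r t) = (\<Sum>r\<in>I. \<Sum>t\<in>{m+1..n}. f r t)"
    by (rule sum.swap)
  then show ?thesis
    unfolding time_avg_def by (simp add: scaleR_sum_right[symmetric] scaleR_left_commute)
qed

section \<open>Assembly of the hypotheses\<close>

theorem theorem2:
  fixes M :: "'w measure" and \<epsilon> :: "noise_source \<Rightarrow> int \<Rightarrow> 'w \<Rightarrow> real"
    and N :: "'x measure" and Om :: "'x \<Rightarrow> real^'d^('m::{finite,linorder})^'k" and al :: "'x \<Rightarrow> real^'k" and u :: 'x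
    and s m :: nat and \<Theta> :: "(real^'p) set" and \<theta>0 :: "real^'p"
    and G :: "nat \<Rightarrow> nat \<Rightarrow> nat \<Rightarrow> (nat \<Rightarrow> real) \<Rightarrow> real^'p \<Rightarrow> real^'d"
    and Glim :: "nat \<Rightarrow> nat \<Rightarrow> (nat \<Rightarrow> real) \<Rightarrow> real^'p \<Rightarrow> real^'d"
    and Xobs :: "nat \<Rightarrow> nat \<Rightarrow> 'w \<Rightarrow> real^'d"
    and Xsim :: "nat \<Rightarrow> nat \<Rightarrow> real^'p \<Rightarrow> nat \<Rightarrow> 'w \<Rightarrow> real^'d"
    and P :: "real^'p \<Rightarrow> (real^'d^'m::_) measure"
    and \<theta>hat :: "nat \<Rightarrow> 'w \<Rightarrow> real^'p"
  assumes s: "s \<ge> 1"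
    and m: "CARD('m) = m + 1"
    and k: "CARD('k) = 2 * CARD('p) + 1"
    and \<theta>0: "\<theta>0 \<in> \<Theta>"
    and noise: "iid_noise M s \<epsilon>"
    and G_meas: "\<And>t i r. t \<ge> 1 \<Longrightarrow> i \<ge> 1 \<Longrightarrow> r \<le> s \<Longrightarrow>
      (\<lambda>(e, \<theta>). G t i r e \<theta>) \<in> borel_measurable (R_inf \<Otimes>\<^sub>M restrict_space borel \<Theta>)"
    and G_ergodic: "\<And>t i r \<theta>. t \<ge> 1 \<Longrightarrow> i \<ge> 1 \<Longrightarrow> r \<le> s \<Longrightarrow> \<theta> \<in> \<Theta> \<Longrightarrow>
      stationary_ergodic M (\<lambda>j w. G t i r (past (\<epsilon> Base) j w) \<theta>)"
    and draw: "rff_draw N Om al" "u \<in> space N"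
    and A1_obs: "\<And>n t w. 1 \<le> t \<Longrightarrow> t \<le> n \<Longrightarrow> w \<in> space M \<Longrightarrow>
      Xobs n t w = G t n 0 (past (\<epsilon> (Copy 0)) (int t) w) \<theta>0"
    and A1_sim: "\<And>n r \<theta> t w. 1 \<le> t \<Longrightarrow> t \<le> n \<Longrightarrow> 1 \<le> r \<Longrightarrow> r \<le> s \<Longrightarrow> \<theta> \<in> \<Theta> \<Longrightarrow> w \<in> space M \<Longrightarrow>
      Xsim n r \<theta> t w = G t n r (past (\<epsilon> (Copy r)) (int t) w) \<theta>"
    and A2_meas: "\<And>t r. t \<ge> 1 \<Longrightarrow> r \<le> s \<Longrightarrow>
      (\<lambda>(e, \<theta>). Glim t r e \<theta>) \<in> borel_measurable (R_inf \<Otimes>\<^sub>M restrict_space borel \<Theta>)"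
    and A2_ergodic: "\<And>t r \<theta>. t \<ge> 1 \<Longrightarrow> r \<le> s \<Longrightarrow> \<theta> \<in> \<Theta> \<Longrightarrow>
      stationary_ergodic M (\<lambda>j w. Glim t r (past (\<epsilon> Base) j w) \<theta>)"
    and A2_lim: "\<exists>q>2. \<forall>r\<le>s.
      (\<lambda>n. SUP \<theta>\<in>\<Theta>. (\<Sum>t\<in>{1..n}. Lq_norm M q
          (\<lambda>w. G t n r (past (\<epsilon> Base) 0 w) \<theta> - Glim t r (past (\<epsilon> Base) 0 w) \<theta>)) / of_nat n)
        \<longlonglongrightarrow> 0"
    and A3_P: "\<And>\<theta>. \<theta> \<in> \<Theta> \<Longrightarrow> prob_space (P \<theta>) \<and> sets (P \<theta>) = sets borel"
    and A3_lim: "\<And>\<phi> :: real^'d^('m::_) \<Rightarrow> real. continuous_on UNIV \<phi> \<Longrightarrow> bounded (range \<phi>) \<Longrightarrow>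
      (\<lambda>n. SUP \<theta>\<in>\<Theta>. MAX r\<in>{0..s}. ennreal
          \<bar>(\<integral>x. \<phi> x \<partial>average_law m n (window_law M (\<epsilon> Base) Glim r \<theta>)) - (\<integral>x. \<phi> x \<partial>P \<theta>)\<bar>)
        \<longlonglongrightarrow> 0"
    and A4_i: "compact \<Theta>" "semialgebraic \<Theta>" "interior \<Theta> \<noteq> {}"
    and A4_ii: "inj_on P \<Theta>"
    and A4_iii: "\<exists>U (g :: (real^'p) \<times> (real^'d^('m::_)) \<Rightarrow> complex). open U \<and> \<Theta> \<subseteq> U \<and>
      complex_real_analytic_on g (U \<times> UNIV) \<and>
      (\<forall>\<theta>\<in>\<Theta>. \<forall>\<omega>. g (\<theta>, \<omega>) = char_fun (P \<theta>) \<omega>)"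
    and A5: "inj_on (\<lambda>\<theta>. \<integral>x. rff (Om u) (al u) x \<partial>P \<theta>) \<Theta>"
    and A6: "\<exists>\<eta> :: real \<Rightarrow> real.
      (\<forall>\<delta>>0. \<eta> \<delta> > 0 \<and>
        (SUP i\<in>{1..}. SUP t\<in>{1..}. MAX r\<in>{0..s}.
          upper_expectation (distr M R_inf (past (\<epsilon> Base) 0))
            (\<lambda>e. SUP (\<theta>, \<theta>')\<in>{(\<theta>, \<theta>'). \<theta> \<in> \<Theta> \<and> \<theta>' \<in> \<Theta> \<and> norm (\<theta> - \<theta>') \<le> \<delta>}.
                   ennreal (norm (G t i r e \<theta> - G t i r e \<theta>'))))
        < ennreal (\<eta> \<delta>)) \<and>
      (\<eta> \<longlongrightarrow> 0) (at_right 0)"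
    and A7: "\<exists>\<Psi>>0. \<exists>\<beta>>2. \<exists>q>2.
      (\<forall>j. (SUP i\<in>{1..}. SUP \<theta>\<in>\<Theta>. SUP t\<in>{1..}. MAX r\<in>{0..s}.
          Lq_norm M q (\<lambda>w. G t i r (past (\<epsilon> Base) 0 w) \<theta>
                          - G t i r (past_replaced (\<epsilon> Base) (\<epsilon> Star) 0 j w) \<theta>))
        \<le> ennreal (\<Psi> * real (max j 1) powr (- \<beta>))) \<and>
      (SUP i\<in>{1..}. SUP \<theta>\<in>\<Theta>. SUP t\<in>{1..}. MAX r\<in>{0..s}.
          Lq_norm M q (\<lambda>w. G t i r (past (\<epsilon> Base) 0 w) \<theta>))
        \<le> ennreal \<Psi>"
    and estimator: "approx_minimizer M m \<Theta>
      (\<lambda>n w \<theta>. Q_TA (rff (Om u) (al u)) m s n (\<lambda>t. Xobs n t w) (\<lambda>r t. Xsim n r \<theta> t w)) \<theta>hat"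
  shows "tendsto_in_prob M \<theta>hat \<theta>0"
proof -
  let ?\<mu> = "distr M borel (\<epsilon> Base 0)"
  let ?S = "PiM (UNIV :: nat set) (\<lambda>_. ?\<mu>)"
  let ?f = "rff (Om u) (al u)"
  let ?\<phi> = "\<lambda>i x. ?f x $ i"
  let ?L = "1 + (\<Sum>i\<in>UNIV. \<Sum>j\<in>UNIV. norm (Om u $ i $ j))"
  let ?H = "\<lambda>r n \<theta> t x. G t n r x \<theta>"
  let ?\<Phi> = "\<lambda>i \<theta>. \<integral>x. ?\<phi> i x \<partial>P \<theta>"
  have M: "prob_space M" using noise by (simp add: iid_noise_def)
  have sources: "Base \<in> noise_sources s" "\<And>r. r \<le> s \<Longrightarrow> Copy r \<in> noise_sources s"
    by (auto simp: noise_sources_def)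
  interpret B: iid_past M ?\<mu> "\<epsilon> Base"
    by (rule iid_noise_iid_past[OF noise sources(1)])
  have sets_S: "sets ?S = sets R_inf"
    by (rule sets_PiM_cong) (simp_all add: B.sets_noise)
  \<comment> \<open>(A6) integrates over the law of the past on \<open>R_inf\<close>; it is the
    product measure on which the oscillations are computed.\<close>
  have law: "distr M R_inf (past (\<epsilon> Base) 0) = ?S"
    using B.distr_past[of 0] distr_cong[OF refl sets_S, of M "past (\<epsilon> Base) 0" "past (\<epsilon> Base) 0"] by simp
  have meas_section: "(\<lambda>x. f x \<theta>) \<in> borel_measurable ?S"
    if "(\<lambda>(e, \<theta>). f e \<theta>) \<in> borel_measurable (R_inf \<Otimes>\<^sub>M restrict_space borel \<Theta>)" "\<theta> \<in> \<Theta>"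
    for f :: "(nat \<Rightarrow> real) \<Rightarrow> real^'p \<Rightarrow> real^'d" and \<theta>
  proof -
    have "(\<lambda>x. (x, \<theta>)) \<in> measurable R_inf (R_inf \<Otimes>\<^sub>M restrict_space borel \<Theta>)"
      using that(2) by (intro measurable_Pair2') (simp add: space_restrict_space)
    from measurable_compose[OF this that(1)] show ?thesis
      by (simp cong: measurable_cong_sets[OF sets_S refl])
  qed
  have H_meas: "?H r n \<theta> t \<in> borel_measurable ?S" if "n \<ge> 1" "t \<ge> 1" "r \<le> s" "\<theta> \<in> \<Theta>" for r n \<theta> t
    using meas_section[OF G_meas] that by blast
  have Hlim_meas: "(\<lambda>x. Glim t r x \<theta>) \<in> borel_measurable ?S" if "t \<ge> 1" "r \<le> s" "\<theta> \<in> \<Theta>" for r \<theta> t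
    using meas_section[OF A2_meas] that by blast
  have f_meas: "?f \<in> borel_measurable borel"
    by (intro borel_measurable_continuous_onI continuous_on_rff)
  have \<phi>_cont: "continuous_on UNIV (?\<phi> i)" for i
    by (intro continuous_on_component continuous_on_rff)
  then have \<phi>_meas: "?\<phi> i \<in> borel_measurable borel" for i
    by (rule borel_measurable_continuous_onI)
  have \<phi>_bound: "\<bar>?\<phi> i x\<bar> \<le> 1" for i x
    by (simp add: rff_def)
  have L: "?L > 0"
    by (intro add_pos_nonneg sum_nonneg) auto

  obtain \<Psi> \<beta> q where A7': "\<Psi> > 0" "\<beta> > 2" "q > 2"
    and rep: "\<And>j. (SUP i\<in>{1..}. SUP \<theta>\<in>\<Theta>. SUP t\<in>{1..}. MAX r\<in>{0..s}.
          Lq_norm M q (\<lambda>w. G t i r (past (\<epsilon> Base) 0 w) \<theta>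
                          - G t i r (past_replaced (\<epsilon> Base) (\<epsilon> Star) 0 j w) \<theta>))
        \<le> ennreal (\<Psi> * real (max j 1) powr (- \<beta>))"
    using A7 by blast
  \<comment> \<open>The factor 2 is the price for passing from the \<open>q\<close>-norm to the L1
    norm.\<close>
  define c where "c j = 2 * (\<Psi> * real (max j 1) powr (- \<beta>))" for j :: nat
  have c_nonneg: "c j \<ge> 0" for j
    using A7'(1) by (simp add: c_def)
  have "summable (\<lambda>j. 2 * (\<Psi> * real j powr (- \<beta>)))"
    using A7'(2) by (intro summable_mult) (simp add: summable_real_powr_iff)
  moreover have "\<forall>\<^sub>F j in sequentially. c j = 2 * (\<Psi> * real j powr (- \<beta>))"
    by (rule eventually_mono[OF eventually_ge_at_top[of 1]]) (simp add: c_def max_absorb1)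
  ultimately have summable_c: "summable c"
    using summable_cong by fast
  have dependence: "(\<integral>\<^sup>+x. \<integral>\<^sup>+y. ennreal (norm (?H r n \<theta> t x - ?H r n \<theta> t (x(j := y)))) \<partial>?\<mu> \<partial>?S) \<le> ennreal (c j)"
    if *: "n \<ge> 1" "t \<ge> 1" "r \<le> s" "\<theta> \<in> \<Theta>" for n t r \<theta> j
  proof -
    let ?X = "\<lambda>w. ?H r n \<theta> t (past (\<epsilon> Base) 0 w) - ?H r n \<theta> t (past_replaced (\<epsilon> Base) (\<epsilon> Star) 0 j w)"
    have [measurable]: "?H r n \<theta> t \<in> borel_measurable R_inf"
      using H_meas[OF *] by (simp cong: measurable_cong_sets[OF sets_S refl])
    have "(\<integral>\<^sup>+x. \<integral>\<^sup>+y. ennreal (norm (?H r n \<theta> t x - ?H r n \<theta> t (x(j := y)))) \<partial>?\<mu> \<partial>?S)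
        = (\<integral>\<^sup>+w. ennreal (norm (?X w)) \<partial>M)"
      by (rule nn_integral_past_replaced[OF noise, of "\<lambda>x y. ennreal (norm (?H r n \<theta> t x - ?H r n \<theta> t y))"]) measurable
    also have "\<dots> \<le> 2 * Lq_norm M q ?X"
    proof (rule nn_integral_norm_le_Lq_norm[OF M])
      have "past_replaced (\<epsilon> Base) (\<epsilon> Star) 0 j \<in> measurable M R_inf"
        by (rule past_replaced_measurable[OF noise])
      moreover have "past (\<epsilon> Base) 0 \<in> measurable M R_inf"
        using B.past_measurable[of 0] by (simp cong: measurable_cong_sets[OF refl sets_S])
      ultimately show "?X \<in> borel_measurable M" by measurable
    qed (use A7' in simp)
    also have "Lq_norm M q ?X \<le> (MAX r\<in>{0..s}. Lq_norm M q (\<lambda>w. G t n r (past (\<epsilon> Base) 0 w) \<theta>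
                          - G t n r (past_replaced (\<epsilon> Base) (\<epsilon> Star) 0 j w) \<theta>))"
      using *(3) by (intro Max_ge) auto
    also have "\<dots> \<le> (SUP i\<in>{1..}. SUP \<theta>\<in>\<Theta>. SUP t\<in>{1..}. MAX r\<in>{0..s}.
          Lq_norm M q (\<lambda>w. G t i r (past (\<epsilon> Base) 0 w) \<theta>
                          - G t i r (past_replaced (\<epsilon> Base) (\<epsilon> Star) 0 j w) \<theta>))"
      using * by (intro SUP_upper2[of n] SUP_upper2[of \<theta>] SUP_upper2[of t]) auto
    also note rep[of j]
    also have "2 * ennreal (\<Psi> * real (max j 1) powr (- \<beta>)) = ennreal (c j)"
      using A7'(1) unfolding c_def by (subst ennreal_mult) auto
    finally show ?thesis by (simp add: mult_left_mono)
  qed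

  obtain \<eta>G where \<eta>G: "\<And>\<delta>. \<delta> > 0 \<Longrightarrow> (SUP i\<in>{1..}. SUP t\<in>{1..}. MAX r\<in>{0..s}.
          upper_expectation (distr M R_inf (past (\<epsilon> Base) 0))
            (\<lambda>e. SUP (\<theta>, \<theta>')\<in>{(\<theta>, \<theta>'). \<theta> \<in> \<Theta> \<and> \<theta>' \<in> \<Theta> \<and> norm (\<theta> - \<theta>') \<le> \<delta>}.
                   ennreal (norm (G t i r e \<theta> - G t i r e \<theta>')))) < ennreal (\<eta>G \<delta>)"
      "(\<eta>G \<longlongrightarrow> 0) (at_right 0)"
    using A6 by blast
  have equi: "\<exists>\<delta>>0. \<forall>n\<ge>1. \<forall>t\<ge>1. \<exists>g\<in>borel_measurable ?S.
       (\<forall>\<theta>\<in>\<Theta>. \<forall>\<theta>'\<in>\<Theta>. dist \<theta> \<theta>' \<le> \<delta> \<longrightarrow> (\<forall>x. ennreal (norm (?H r n \<theta> t x - ?H r n \<theta>' t x)) \<le> g x)) \<and>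
       (\<integral>\<^sup>+x. g x \<partial>?S) \<le> ennreal \<eta>" if "\<eta> > 0" and r: "r \<le> s" for \<eta> r
  proof -
    have "\<forall>\<^sub>F \<delta> in at_right 0. \<eta>G \<delta> < \<eta>"
      using \<eta>G(2) \<open>\<eta> > 0\<close> by (rule order_tendstoD)
    then obtain b where "b > 0" "\<And>\<delta>. \<delta> > 0 \<Longrightarrow> \<delta> < b \<Longrightarrow> \<eta>G \<delta> < \<eta>"
      by (auto simp: eventually_at_right_field)
    then obtain \<delta> where \<delta>: "\<delta> > 0" "\<eta>G \<delta> < \<eta>"
      using dense[of 0 b] by blast
    let ?D = "\<lambda>n t e. SUP (\<theta>, \<theta>')\<in>{(\<theta>, \<theta>'). \<theta> \<in> \<Theta> \<and> \<theta>' \<in> \<Theta> \<and> norm (\<theta> - \<theta>') \<le> \<delta>}.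
                   ennreal (norm (G t n r e \<theta> - G t n r e \<theta>'))"
    have "\<exists>g\<in>borel_measurable ?S.
       (\<forall>\<theta>\<in>\<Theta>. \<forall>\<theta>'\<in>\<Theta>. dist \<theta> \<theta>' \<le> \<delta> \<longrightarrow> (\<forall>x. ennreal (norm (?H r n \<theta> t x - ?H r n \<theta>' t x)) \<le> g x)) \<and>
       (\<integral>\<^sup>+x. g x \<partial>?S) \<le> ennreal \<eta>" if "n \<ge> 1" "t \<ge> 1" for n t
    proof -
      have "upper_expectation (distr M R_inf (past (\<epsilon> Base) 0)) (?D n t) \<le> (MAX r\<in>{0..s}.
          upper_expectation (distr M R_inf (past (\<epsilon> Base) 0))
            (\<lambda>e. SUP (\<theta>, \<theta>')\<in>{(\<theta>, \<theta>'). \<theta> \<in> \<Theta> \<and> \<theta>' \<in> \<Theta> \<and> norm (\<theta> - \<theta>') \<le> \<delta>}.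
                   ennreal (norm (G t n r e \<theta> - G t n r e \<theta>'))))"
        using r by (intro Max_ge) auto
      also have "\<dots> \<le> (SUP i\<in>{1..}. SUP t\<in>{1..}. MAX r\<in>{0..s}.
          upper_expectation (distr M R_inf (past (\<epsilon> Base) 0))
            (\<lambda>e. SUP (\<theta>, \<theta>')\<in>{(\<theta>, \<theta>'). \<theta> \<in> \<Theta> \<and> \<theta>' \<in> \<Theta> \<and> norm (\<theta> - \<theta>') \<le> \<delta>}.
                   ennreal (norm (G t i r e \<theta> - G t i r e \<theta>'))))"
        using that by (intro SUP_upper2[of n] SUP_upper2[of t]) auto
      also have "\<dots> < ennreal \<eta>"
        using \<eta>G(1)[OF \<delta>(1)] \<delta>(2) by (meson ennreal_leI less_imp_le order_less_le_trans)
      \<comment> \<open>An upper expectation is an infimum over measurable majorants, so a strict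
        bound on it yields one majorant whose integral obeys that bound.\<close>
      finally obtain g where g: "g \<in> borel_measurable ?S" "\<And>x. x \<in> space ?S \<Longrightarrow> ?D n t x \<le> g x" "(\<integral>\<^sup>+x. g x \<partial>?S) < ennreal \<eta>"
        unfolding upper_expectation_def law INF_less_iff by blast
      have "ennreal (norm (?H r n \<theta> t x - ?H r n \<theta>' t x)) \<le> g x"
        if "\<theta> \<in> \<Theta>" "\<theta>' \<in> \<Theta>" "dist \<theta> \<theta>' \<le> \<delta>" for \<theta> \<theta>' x
      proof -
        have "x \<in> space ?S" by (simp add: space_PiM)
        have "ennreal (norm (?H r n \<theta> t x - ?H r n \<theta>' t x)) \<le> ?D n t x"
          using that by (intro SUP_upper2[of "(\<theta>, \<theta>')"]) (auto simp: dist_norm)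
        also note g(2)[OF \<open>x \<in> space ?S\<close>]
        finally show ?thesis .
      qed
      with g show ?thesis by (intro bexI[of _ g]) auto
    qed
    with \<delta>(1) show ?thesis by blast
  qed

  obtain q2 where q2: "q2 > 2" and A2_lim': "\<And>r. r \<le> s \<Longrightarrow>
      (\<lambda>n. SUP \<theta>\<in>\<Theta>. (\<Sum>t\<in>{1..n}. Lq_norm M q2
          (\<lambda>w. G t n r (past (\<epsilon> Base) 0 w) \<theta> - Glim t r (past (\<epsilon> Base) 0 w) \<theta>)) / of_nat n) \<longlonglongrightarrow> 0"
    using A2_lim by blast
  have mean: "(\<lambda>n. time_avg m n (\<lambda>t. \<integral>x. ?\<phi> i (lagged_window (?H r n \<theta>) t x) \<partial>?S)) \<longlonglongrightarrow> ?\<Phi> i \<theta>"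
    if \<theta>: "\<theta> \<in> \<Theta>" and r: "r \<le> s" for \<theta> r i
  proof (rule B.mean_transfer[OF m])
    let ?D = "\<lambda>n t w. G t n r (past (\<epsilon> Base) 0 w) \<theta> - Glim t r (past (\<epsilon> Base) 0 w) \<theta>"
    let ?v = "\<lambda>n. SUP \<theta>\<in>\<Theta>. (\<Sum>t\<in>{1..n}. Lq_norm M q2
          (\<lambda>w. G t n r (past (\<epsilon> Base) 0 w) \<theta> - Glim t r (past (\<epsilon> Base) 0 w) \<theta>)) / of_nat n"
    \<comment> \<open>The supremum in (A2) dominates the single parameter \<open>\<theta>\<close>;
      the 2 comes again from \<open>nn_integral_norm_le_Lq_norm\<close>.\<close>
    show "(\<lambda>n. 2 * ?v n) \<longlonglongrightarrow> 0"
      using ennreal_tendsto_cmult[OF _ A2_lim'[OF r], of 2] by simp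
    show "(\<Sum>t\<in>{1..n}. \<integral>\<^sup>+x. ennreal (norm (G t n r x \<theta> - Glim t r x \<theta>)) \<partial>?S) / of_nat n \<le> 2 * ?v n"
      if n: "n \<ge> 1" for n
    proof -
      have "(\<integral>\<^sup>+x. ennreal (norm (G t n r x \<theta> - Glim t r x \<theta>)) \<partial>?S) \<le> 2 * Lq_norm M q2 (?D n t)" if "t \<in> {1..n}" for t
      proof -
        have [measurable]: "(\<lambda>x. G t n r x \<theta>) \<in> borel_measurable ?S" "(\<lambda>x. Glim t r x \<theta>) \<in> borel_measurable ?S"
          using that n r \<theta> by (auto intro!: H_meas Hlim_meas)
        have "(\<integral>\<^sup>+x. ennreal (norm (G t n r x \<theta> - Glim t r x \<theta>)) \<partial>?S) = (\<integral>\<^sup>+w. ennreal (norm (?D n t w)) \<partial>M)"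
          by (rule B.nn_integral_past[symmetric]) measurable
        also have "\<dots> \<le> 2 * Lq_norm M q2 (?D n t)"
          by (rule nn_integral_norm_le_Lq_norm[OF M]) (use q2 in \<open>measurable, simp\<close>)
        finally show ?thesis .
      qed
      then have "(\<Sum>t\<in>{1..n}. \<integral>\<^sup>+x. ennreal (norm (G t n r x \<theta> - Glim t r x \<theta>)) \<partial>?S) \<le> 2 * (\<Sum>t\<in>{1..n}. Lq_norm M q2 (?D n t))"
        unfolding sum_distrib_left by (rule sum_mono)
      then have "(\<Sum>t\<in>{1..n}. \<integral>\<^sup>+x. ennreal (norm (G t n r x \<theta> - Glim t r x \<theta>)) \<partial>?S) / of_nat n
          \<le> 2 * ((\<Sum>t\<in>{1..n}. Lq_norm M q2 (?D n t)) / of_nat n)"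
        unfolding ennreal_times_divide by (rule divide_right_mono_ennreal)
      also have "\<dots> \<le> 2 * ?v n"
        using \<theta> by (intro mult_left_mono SUP_upper) auto
      finally show ?thesis .
    qed
    have eq: "(\<integral>x. ?\<phi> i x \<partial>average_law m n (window_law M (\<epsilon> Base) Glim r \<theta>))
        = time_avg m n (\<lambda>t. \<integral>x. ?\<phi> i (lagged_window (\<lambda>t x. Glim t r x \<theta>) t x) \<partial>?S)" if n: "n > m" for n
    proof -
      let ?W = "\<lambda>t. lagged_window (\<lambda>t x. Glim t r x \<theta>) t :: _ \<Rightarrow> real^'d^('m::{finite,linorder})"
      have W: "?W t \<in> borel_measurable ?S" if "t \<in> {m+1..n}" for t
      proof -
        have [measurable]: "(\<lambda>x. Glim (t - lag (k :: 'm)) r x \<theta>) \<in> borel_measurable ?S" for k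
          using that lag_less_card[of k] m r \<theta> by (intro Hlim_meas) auto
        show ?thesis unfolding lagged_window_def by measurable
      qed
      \<comment> \<open>\<open>window_law\<close> reads row \<open>j\<close> from the past at time
        \<open>- lag j\<close>, which is the past at time 0 shifted by \<open>lag j\<close>. The
        rows are thus functions of one past.\<close>
      have wl: "window_law M (\<epsilon> Base) Glim r \<theta> t = distr M borel (\<lambda>w. ?W t (past (\<epsilon> Base) 0 w))" for t
        unfolding window_law_def lagged_window_def
        using B.past_shift[of 0] by simp
      have "(\<integral>x. ?\<phi> i x \<partial>average_law m n (window_law M (\<epsilon> Base) Glim r \<theta>))
          = time_avg m n (\<lambda>t. \<integral>x. ?\<phi> i x \<partial>window_law M (\<epsilon> Base) Glim r \<theta> t)"
        unfolding wl using n W \<phi>_meas \<phi>_bound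
        by (intro integral_average_law[where B = 1])
          (auto intro!: B.W.prob_space_distr measurable_compose[OF B.past_measurable])
      also have "\<dots> = time_avg m n (\<lambda>t. \<integral>x. ?\<phi> i (?W t x) \<partial>?S)"
        unfolding time_avg_def
      proof (intro arg_cong[where f = "scaleR _"] sum.cong refl)
        fix t assume t: "t \<in> {m+1..n}"
        have "(\<integral>x. ?\<phi> i x \<partial>window_law M (\<epsilon> Base) Glim r \<theta> t) = (\<integral>w. ?\<phi> i (?W t (past (\<epsilon> Base) 0 w)) \<partial>M)"
          unfolding wl by (rule integral_distr[OF measurable_compose[OF B.past_measurable W[OF t]] \<phi>_meas])
        also have "\<dots> = (\<integral>x. ?\<phi> i (?W t x) \<partial>?S)"
          by (rule B.integral_past[OF measurable_compose[OF W[OF t] \<phi>_meas]])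
        finally show "(\<integral>x. ?\<phi> i x \<partial>window_law M (\<epsilon> Base) Glim r \<theta> t) = \<dots>" .
      qed
      finally show ?thesis .
    qed
    let ?I = "\<lambda>n. \<integral>x. ?\<phi> i x \<partial>average_law m n (window_law M (\<epsilon> Base) Glim r \<theta>)"
    let ?E = "\<lambda>n r \<theta>. ennreal \<bar>(\<integral>x. ?\<phi> i x \<partial>average_law m n (window_law M (\<epsilon> Base) Glim r \<theta>)) - (\<integral>x. ?\<phi> i x \<partial>P \<theta>)\<bar>"
    \<comment> \<open>(A3) applies to a feature because a cosine of an affine map is bounded and
      continuous.\<close>
    have upper: "(\<lambda>n. SUP \<theta>\<in>\<Theta>. MAX r\<in>{0..s}. ?E n r \<theta>) \<longlonglongrightarrow> 0"
      using \<phi>_bound by (intro A3_lim \<phi>_cont) (auto simp: bounded_iff)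
    have le: "?E n r \<theta> \<le> (SUP \<theta>\<in>\<Theta>. MAX r\<in>{0..s}. ?E n r \<theta>)" for n
      using \<theta> r by (intro SUP_upper2[of \<theta>] Max_ge) auto
    have "(\<lambda>n. ?E n r \<theta>) \<longlonglongrightarrow> 0"
      by (rule tendsto_sandwich[OF _ _ tendsto_const upper]) (simp_all only: le always_eventually zero_le simp_thms)
    then have "(\<lambda>n. ?E n r \<theta>) \<longlonglongrightarrow> ennreal 0"
      by simp
    then have "(\<lambda>n. \<bar>?I n - ?\<Phi> i \<theta>\<bar>) \<longlonglongrightarrow> 0"
      by (rule tendsto_ennrealD) auto
    then have "?I \<longlonglongrightarrow> ?\<Phi> i \<theta>"
      by (simp add: tendsto_rabs_zero_iff LIM_zero_iff)
    then show "(\<lambda>n. time_avg m n (\<lambda>t. \<integral>x. ?\<phi> i (lagged_window (\<lambda>t x. Glim t r x \<theta>) t x) \<partial>?S)) \<longlonglongrightarrow> ?\<Phi> i \<theta>"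
      by (rule Lim_transform_eventually)
        (rule eventually_mono[OF eventually_gt_at_top[of m]], erule eq)
  qed (use \<theta> r L \<phi>_meas \<phi>_bound rff_lipschitz H_meas Hlim_meas in auto)

  \<comment> \<open>Index \<open>r = 0\<close> is included: the observed series is the path with
    this index, taken at \<open>\<theta>0\<close>.\<close>
  have family: "feature_family M ?\<mu> (\<epsilon> (Copy r)) \<Theta> (?H r) (?\<phi> i) ?L m c (?\<Phi> i)" if "r \<le> s" for r i
    by (intro feature_family.intro feature_family_axioms.intro iid_noise_iid_past[OF noise] sources(2) that
        m A4_i(1) H_meas \<phi>_meas \<phi>_bound rff_lipschitz L dependence summable_c c_nonneg equi mean)

  let ?q = "\<lambda>\<theta>. (\<integral>x. ?f x \<partial>P \<theta>0) - (\<integral>x. ?f x \<partial>P \<theta>)"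
  have \<Phi>_nth: "(\<integral>x. ?f x \<partial>P \<theta>) $ i = ?\<Phi> i \<theta>" if "\<theta> \<in> \<Theta>" for \<theta> i
  proof -
    interpret P: prob_space "P \<theta>" using A3_P[OF that] by simp
    \<comment> \<open>Coordinates are pulled out of the integral of an integrable vector; the bound
      on the cosines provides integrability.\<close>
    have "integrable (P \<theta>) ?f"
    proof (rule P.integrable_const_bound[where B = "real CARD('k) * 1"])
      show "AE x in P \<theta>. norm (?f x) \<le> real CARD('k) * 1"
        using norm_le_card_times[OF \<phi>_bound] by auto
      show "?f \<in> borel_measurable (P \<theta>)"
        using f_meas A3_P[OF that] by (simp cong: measurable_cong_sets)
    qed
    then show ?thesis
      by (rule integral_bounded_linear[OF bounded_linear_vec_nth, symmetric])
  qed
  show ?thesis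
  proof (rule approx_minimizer_consistent[where q = ?q, OF M estimator _ A4_i(1) _ \<theta>0])
    show "?q \<theta>0 = 0" by simp
    show "\<theta> = \<theta>0" if "\<theta> \<in> \<Theta>" "?q \<theta> = 0" for \<theta>
      using A5 that \<theta>0 by (auto simp: inj_on_def)
    show "continuous_on \<Theta> ?q"
    proof (intro continuous_on_diff continuous_on_const)
      have "continuous_on \<Theta> (\<lambda>\<theta>. \<chi> i. ?\<Phi> i \<theta>)"
        by (intro continuous_on_vec_lambda feature_family.continuous_on_limit[OF family[of 0]]) simp
      then show "continuous_on \<Theta> (\<lambda>\<theta>. \<integral>x. ?f x \<partial>P \<theta>)"
        by (rule continuous_on_eq) (simp add: vec_eq_iff \<Phi>_nth)
    qed
    let ?A = "\<lambda>(r, i) n w \<theta>. time_avg m n (\<lambda>t. ?\<phi> i (window (\<lambda>t. ?H r n \<theta> t (past (\<epsilon> (Copy r)) (int t) w)) t))"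
    let ?Q = "\<lambda>n w \<theta>. Q_TA ?f m s n (\<lambda>t. Xobs n t w) (\<lambda>r t. Xsim n r \<theta> t w)"
    show "uniform_tendsto_in_prob M \<Theta> ?Q ?q"
      unfolding uniform_tendsto_in_prob_def
    proof (intro allI impI)
      fix \<delta> \<rho> :: real assume pos: "\<delta> > 0" "\<rho> > 0"
      \<comment> \<open>Each coordinate carries an error \<open>\<kappa>\<close> from the observed
        average and one from the simulated average; \<open>norm_le_card_times\<close> multiplies
        their sum by the dimension \<open>CARD('k)\<close>.\<close>
      define \<kappa> where "\<kappa> = \<delta> / (2 * CARD('k))"
      have \<kappa>: "\<kappa> > 0" "CARD('k) * (2 * \<kappa>) = \<delta>"
        using pos by (auto simp: \<kappa>_def)
      have "\<forall>\<^sub>F n in sequentially. \<exists>A\<in>sets M. measure M A \<le> \<rho> \<and>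
         (\<forall>w\<in>space M - A. \<forall>p\<in>{0..s} \<times> UNIV. \<forall>\<theta>\<in>\<Theta>. dist (?A p n w \<theta>) (?\<Phi> (snd p) \<theta>) \<le> \<kappa>)"
        using \<kappa> pos feature_family.uniform_law[OF family]
        by (intro uniform_tendsto_in_prob_finite_family[OF M]) auto
      then show "\<forall>\<^sub>F n in sequentially. \<exists>A\<in>sets M. measure M A \<le> \<rho> \<and>
         (\<forall>w\<in>space M - A. \<forall>\<theta>\<in>\<Theta>. dist (?Q n w \<theta>) (?q \<theta>) \<le> \<delta>)"
      proof eventually_elim
        case (elim n)
        then obtain A where A: "A \<in> sets M" "measure M A \<le> \<rho>"
          and close: "\<And>w r i \<theta>. w \<in> space M - A \<Longrightarrow> r \<le> s \<Longrightarrow> \<theta> \<in> \<Theta> \<Longrightarrow> \<bar>?A (r, i) n w \<theta> - ?\<Phi> i \<theta>\<bar> \<le> \<kappa>"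
          by (fastforce simp: dist_real_def)
        have "dist (?Q n w \<theta>) (?q \<theta>) \<le> \<delta>" if w: "w \<in> space M - A" and \<theta>: "\<theta> \<in> \<Theta>" for w \<theta>
        proof -
          \<comment> \<open>Windows only read times between 1 and \<open>n\<close>, where (A1)
            determines both series.\<close>
          have lag: "1 \<le> t - lag k" "t - lag k \<le> n" if "t \<in> {m+1..n}" for t and k :: 'm
            using that lag_less_card[of k] m by auto
          have obs: "window (\<lambda>t. Xobs n t w) t = (window (\<lambda>t. ?H 0 n \<theta>0 t (past (\<epsilon> (Copy 0)) (int t) w)) t :: real^'d^('m::{finite,linorder}))"
            if "t \<in> {m+1..n}" for t
            unfolding window_def using A1_obs lag[OF that] w by (simp add: vec_eq_iff)
          have sim: "window (\<lambda>t. Xsim n r \<theta> t w) t = (window (\<lambda>t. ?H r n \<theta> t (past (\<epsilon> (Copy r)) (int t) w)) t :: real^'d^('m::{finite,linorder}))"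
            if "t \<in> {m+1..n}" "r \<in> {1..s}" for t r
            unfolding window_def using A1_sim lag[OF that(1)] that(2) w \<theta> by (simp add: vec_eq_iff)
          have "\<bar>(?Q n w \<theta> - ?q \<theta>) $ i\<bar> \<le> 2 * \<kappa>" for i
          proof -
            have "?Q n w \<theta> $ i = time_avg m n (\<lambda>t. ?\<phi> i (window (\<lambda>t. Xobs n t w) t))
                - (1 / s) * (\<Sum>r\<in>{1..s}. time_avg m n (\<lambda>t. ?\<phi> i (window (\<lambda>t. Xsim n r \<theta> t w) t)))"
              by (simp add: Q_TA_def time_avg_scaleR_sum time_avg_vec_nth sum_component)
            also have "time_avg m n (\<lambda>t. ?\<phi> i (window (\<lambda>t. Xobs n t w) t)) = ?A (0, i) n w \<theta>0"
              by (simp only: prod.case, intro time_avg_cong) (simp only: obs)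
            also have "(\<Sum>r\<in>{1..s}. time_avg m n (\<lambda>t. ?\<phi> i (window (\<lambda>t. Xsim n r \<theta> t w) t))) = (\<Sum>r\<in>{1..s}. ?A (r, i) n w \<theta>)"
              by (intro sum.cong refl) (simp only: prod.case, intro time_avg_cong, simp only: sim)
            finally have Q: "?Q n w \<theta> $ i = ?A (0, i) n w \<theta>0 - (1 / s) * (\<Sum>r\<in>{1..s}. ?A (r, i) n w \<theta>)" .
            have "\<bar>(\<Sum>r\<in>{1..s}. ?A (r, i) n w \<theta> - ?\<Phi> i \<theta>)\<bar> \<le> (\<Sum>r\<in>{1..s}. \<kappa>)"
              using close[OF w _ \<theta>] by (intro order_trans[OF sum_abs] sum_mono) auto
            then have "\<bar>(1 / s) * (\<Sum>r\<in>{1..s}. ?A (r, i) n w \<theta> - ?\<Phi> i \<theta>)\<bar> \<le> \<kappa>"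
              using s by (simp add: abs_mult field_simps)
            \<comment> \<open>Since \<open>s \<ge> 1\<close>, averaging the constant
              \<open>?\<Phi> i \<theta>\<close> over the \<open>s\<close> simulated series returns
              it.\<close>
            moreover have "(1 / s) * (\<Sum>r\<in>{1..s}. ?A (r, i) n w \<theta> - ?\<Phi> i \<theta>)
                = (1 / s) * (\<Sum>r\<in>{1..s}. ?A (r, i) n w \<theta>) - ?\<Phi> i \<theta>"
              using s by (simp add: sum_subtractf right_diff_distrib)
            moreover have "\<bar>?A (0, i) n w \<theta>0 - ?\<Phi> i \<theta>0\<bar> \<le> \<kappa>"
              using close[OF w _ \<theta>0, of 0] by simp
            moreover have "?q \<theta> $ i = ?\<Phi> i \<theta>0 - ?\<Phi> i \<theta>"
              using \<Phi>_nth \<theta> \<theta>0 by simp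
            ultimately show ?thesis
              unfolding vector_minus_component[of "?Q n w \<theta>"] Q by linarith
          qed
          then show ?thesis
            unfolding dist_norm \<kappa>(2)[symmetric] by (rule norm_le_card_times)
        qed
        with A show ?case by blast
      qed
    qed
  qed
qed

end
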